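(* Let $v_1,\dots,v_n\in\mathbb{R}^d$ and $c_1,\dots,c_n\ge0$, not all $c_iv_i$ zero, and let $M=\sum_{i=1}^nc_iv_iv_i^\top$ and $r=\frac{\operatorname{tr}(M)}{\|M\|}$. For any positive integer $k\le r$, there exists $S\subseteq[n]$ with $|S|=k$ such that the $k$ largest eigenvalues $\lambda_1,\dots,\lambda_k$ of $\sum_{i\in S}v_iv_i^\top$ satisfy $$\Big(\frac1k\sum_{i=1}^k\frac1{\lambda_i}\Big)^{-1}\ge\frac{r-k+1}{r}\cdot\frac{\operatorname{tr}(M)}{\sum_{i=1}^nc_i}.$$ Moreover, such a set $S$ can be computed in deterministic polynomial time.
   Context: $\|M\|$ denotes the operator norm (largest eigenvalue) of the positive semidefinite matrix $M$. *)

theory Defs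
  imports
    Complex_Main
    "HOL-Library.Multiset"
    "HOL-Library.Log_Nat"
    "HOL-Computational_Algebra.Polynomial"
    "Jordan_Normal_Form.Char_Poly"
begin

section \<open>Linear algebra\<close>

definition outer_sum :: "nat \<Rightarrow> nat set \<Rightarrow> (nat \<Rightarrow> real) \<Rightarrow> (nat \<Rightarrow> real vec) \<Rightarrow> real mat" where
  "outer_sum d I w v = mat d d (\<lambda>(a, b). \<Sum>i\<in>I. w i * (v i $ a * v i $ b))"

definition mat_trace :: "real mat \<Rightarrow> real" where
  "mat_trace A = (\<Sum>i<dim_row A. A $$ (i, i))"

definition op_norm :: "real mat \<Rightarrow> real" where
  "op_norm A = (SUP x \<in> {x \<in> carrier_vec (dim_col A). x \<bullet> x \<le> 1}.
     sqrt ((A *\<^sub>v x) \<bullet> (A *\<^sub>v x)))"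

text \<open>
  The eigenvalues with multiplicity in decreasing order; the list has length \<open>dim_row A\<close> when
  \<open>A\<close> is symmetric, since then all roots of its characteristic polynomial are real.
\<close>

definition eigvals_desc :: "real mat \<Rightarrow> real list" where
  "eigvals_desc A = rev (sorted_list_of_multiset (proots (char_poly A)))"

definition trace_norm_ratio :: "real mat \<Rightarrow> real" where
  "trace_norm_ratio M = mat_trace M / op_norm M"

definition admissible :: "nat \<Rightarrow> nat \<Rightarrow> (nat \<Rightarrow> real vec) \<Rightarrow> (nat \<Rightarrow> real) \<Rightarrow> nat \<Rightarrow> bool" where
  "admissible n d v c k \<longleftrightarrow>
     (\<forall>i<n. v i \<in> carrier_vec d \<and> 0 \<le> c i) \<and>
     (\<exists>i<n. c i \<cdot>\<^sub>v v i \<noteq> 0\<^sub>v d) \<and>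
     0 < k \<and> real k \<le> trace_norm_ratio (outer_sum d {..<n} c v)"

text \<open>
  Positivity of the \<open>k\<close> largest eigenvalues is part of the assertion because of the convention
  \<open>1 / 0 = 0\<close>: with \<open>1 / 0 = \<infinity>\<close> the inequality implies it, the right-hand side being positive.
\<close>

definition good_subset ::
  "nat \<Rightarrow> nat \<Rightarrow> (nat \<Rightarrow> real vec) \<Rightarrow> (nat \<Rightarrow> real) \<Rightarrow> nat \<Rightarrow> nat set \<Rightarrow> bool" where
  "good_subset n d v c k S \<longleftrightarrow>
     S \<subseteq> {..<n} \<and> card S = k \<and>
     (let M = outer_sum d {..<n} c v;
          r = trace_norm_ratio M;
          ev = eigvals_desc (outer_sum d S (\<lambda>_. 1) v)
      in k \<le> length ev \<and> (\<forall>i<k. 0 < ev ! i) \<and>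
         inverse (1 / real k * (\<Sum>i<k. 1 / ev ! i))
           \<ge> (r - real k + 1) / r * (mat_trace M / (\<Sum>i<n. c i)))"


section \<open>Model of computation\<close>

text \<open>
  A deterministic random access machine, programmed in a while language. It has natural-number
  registers, used for control and addressing, and two-dimensional arrays of real numbers. A real
  instruction performs one exact field operation. The only real constants are integers.

  Executions are charged relative to a length measure \<open>w\<close> on real numbers: an instruction or test
  costs 1 plus the lengths of the real numbers it reads and writes. With \<open>w = (\<lambda>_. 0)\<close> this is the
  number of steps (the unit-cost real RAM). With \<open>w\<close> the binary encoding length of rationals it is
  the logarithmic-cost RAM, which is polynomially equivalent to Turing machines. Registers only
  admit addition and truncated subtraction, so their binary length grows by at most a constant
  per step and charging them 1 is harmless.
\<close>

type_synonym vname = string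

datatype iexp = N nat | V vname | Plus iexp iexp | Minus iexp iexp

datatype cell = Cell vname iexp iexp

datatype rexp =
    Const int
  | Load cell
  | Add cell cell
  | Sub cell cell
  | Mul cell cell
  | Div cell cell

datatype bexp = ILess iexp iexp | RLess cell cell | BNot bexp | BAnd bexp bexp

datatype com =
    Skip
  | IAssign vname iexp
  | RAssign cell rexp
  | Seq com com
  | Cond bexp com com
  | While bexp com

type_synonym state = "(vname \<Rightarrow> nat) \<times> (vname \<Rightarrow> nat \<Rightarrow> nat \<Rightarrow> real)"

fun ival :: "iexp \<Rightarrow> state \<Rightarrow> nat" where
  "ival (N m) s = m"
| "ival (V x) s = fst s x"
| "ival (Plus a b) s = ival a s + ival b s"
| "ival (Minus a b) s = ival a s - ival b s"

fun cval :: "cell \<Rightarrow> state \<Rightarrow> real" where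
  "cval (Cell x a b) s = snd s x (ival a s) (ival b s)"

fun rval :: "rexp \<Rightarrow> state \<Rightarrow> real" where
  "rval (Const m) s = of_int m"
| "rval (Load p) s = cval p s"
| "rval (Add p q) s = cval p s + cval q s"
| "rval (Sub p q) s = cval p s - cval q s"
| "rval (Mul p q) s = cval p s * cval q s"
| "rval (Div p q) s = cval p s / cval q s"

fun bval :: "bexp \<Rightarrow> state \<Rightarrow> bool" where
  "bval (ILess a b) s \<longleftrightarrow> ival a s < ival b s"
| "bval (RLess p q) s \<longleftrightarrow> cval p s < cval q s"
| "bval (BNot b) s \<longleftrightarrow> \<not> bval b s"
| "bval (BAnd a b) s \<longleftrightarrow> bval a s \<and> bval b s"

fun store :: "cell \<Rightarrow> real \<Rightarrow> state \<Rightarrow> state" where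
  "store (Cell x a b) y s =
     (fst s, (snd s)(x := (snd s x)(ival a s := (snd s x (ival a s))(ival b s := y))))"

fun rcost :: "(real \<Rightarrow> nat) \<Rightarrow> rexp \<Rightarrow> state \<Rightarrow> nat" where
  "rcost w (Const m) s = 1 + w (of_int m)"
| "rcost w (Load p) s = 1 + w (cval p s)"
| "rcost w (Add p q) s = 1 + w (cval p s) + w (cval q s) + w (rval (Add p q) s)"
| "rcost w (Sub p q) s = 1 + w (cval p s) + w (cval q s) + w (rval (Sub p q) s)"
| "rcost w (Mul p q) s = 1 + w (cval p s) + w (cval q s) + w (rval (Mul p q) s)"
| "rcost w (Div p q) s = 1 + w (cval p s) + w (cval q s) + w (rval (Div p q) s)"

fun bcost :: "(real \<Rightarrow> nat) \<Rightarrow> bexp \<Rightarrow> state \<Rightarrow> nat" where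
  "bcost w (ILess a b) s = 1"
| "bcost w (RLess p q) s = 1 + w (cval p s) + w (cval q s)"
| "bcost w (BNot b) s = 1 + bcost w b s"
| "bcost w (BAnd a b) s = 1 + bcost w a s + bcost w b s"

text \<open>\<open>exec w P s C t\<close>: started in \<open>s\<close>, the program \<open>P\<close> terminates in \<open>t\<close> at total cost \<open>C\<close>.\<close>

inductive exec :: "(real \<Rightarrow> nat) \<Rightarrow> com \<Rightarrow> state \<Rightarrow> nat \<Rightarrow> state \<Rightarrow> bool" for w where
  Skip: "exec w Skip s 1 s"
| IAssign: "exec w (IAssign x a) s 1 ((fst s)(x := ival a s), snd s)"
| RAssign: "exec w (RAssign p e) s (rcost w e s) (store p (rval e s) s)"
| Seq: "exec w P s C s' \<Longrightarrow> exec w Q s' C' t \<Longrightarrow> exec w (Seq P Q) s (C + C') t"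
| CondTrue: "bval b s \<Longrightarrow> exec w P s C t \<Longrightarrow> exec w (Cond b P Q) s (bcost w b s + C) t"
| CondFalse: "\<not> bval b s \<Longrightarrow> exec w Q s C t \<Longrightarrow> exec w (Cond b P Q) s (bcost w b s + C) t"
| WhileFalse: "\<not> bval b s \<Longrightarrow> exec w (While b P) s (bcost w b s) s"
| WhileTrue: "bval b s \<Longrightarrow> exec w P s C s' \<Longrightarrow> exec w (While b P) s' C' t \<Longrightarrow>
    exec w (While b P) s (bcost w b s + C + C') t"

lemma exec_deterministic:
  assumes "exec w P s C t" "exec w P s C' t'"
  shows "C = C' \<and> t = t'"
  using assms
proof (induction arbitrary: C' t' rule: exec.induct)
  case (Seq P s C s1 Q C1 t)
  from Seq.prems show ?case by cases (use Seq.IH in blast)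
next
  case (WhileTrue b s P C s1 C1 t)
  from WhileTrue.prems show ?case
    by cases (use WhileTrue.IH WhileTrue.hyps in blast)+
qed (erule exec.cases; blast)+

text \<open>
  The input occupies the registers \<open>n\<close>, \<open>d\<close>, \<open>k\<close> and the arrays \<open>v\<close> and \<open>c\<close>; the machine returns
  the subset of the index range whose characteristic function is column 0 of the array \<open>S\<close>.
\<close>

definition input_state ::
  "nat \<Rightarrow> nat \<Rightarrow> (nat \<Rightarrow> real vec) \<Rightarrow> (nat \<Rightarrow> real) \<Rightarrow> nat \<Rightarrow> state" where
  "input_state n d v c k =
     ((\<lambda>_. 0)(''n'' := n, ''d'' := d, ''k'' := k),
      (\<lambda>_ _ _. 0)(''v'' := (\<lambda>i j. if i < n \<and> j < d then v i $ j else 0),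
                  ''c'' := (\<lambda>i j. if i < n \<and> j = 0 then c i else 0)))"

definition output_set :: "nat \<Rightarrow> state \<Rightarrow> nat set" where
  "output_set n t = {i. i < n \<and> snd t ''S'' i 0 = 1}"

definition computes_within ::
  "(real \<Rightarrow> nat) \<Rightarrow> com \<Rightarrow> nat \<Rightarrow> nat \<Rightarrow> (nat \<Rightarrow> real vec) \<Rightarrow> (nat \<Rightarrow> real) \<Rightarrow> nat \<Rightarrow> nat \<Rightarrow>
   (nat set \<Rightarrow> bool) \<Rightarrow> bool" where
  "computes_within w P n d v c k B good \<longleftrightarrow>
     (\<exists>C t. exec w P (input_state n d v c k) C t \<and> C \<le> B \<and> good (output_set n t))"

text \<open>
  The number of binary digits of numerator and denominator. The minimum is attained at the
  reduced fraction. The value at irrational numbers is irrelevant.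
\<close>

definition rat_length :: "real \<Rightarrow> nat" where
  "rat_length x = (LEAST l. \<exists>p q :: int. q > 0 \<and> x = of_int p / of_int q \<and>
     l = floorlog 2 (nat \<bar>p\<bar>) + floorlog 2 (nat q))"

definition rational_input :: "nat \<Rightarrow> nat \<Rightarrow> (nat \<Rightarrow> real vec) \<Rightarrow> (nat \<Rightarrow> real) \<Rightarrow> bool" where
  "rational_input n d v c \<longleftrightarrow> (\<forall>i<n. c i \<in> \<rat> \<and> (\<forall>j<d. v i $ j \<in> \<rat>))"

definition input_length :: "nat \<Rightarrow> nat \<Rightarrow> (nat \<Rightarrow> real vec) \<Rightarrow> (nat \<Rightarrow> real) \<Rightarrow> nat" where
  "input_length n d v c = (\<Sum>i<n. rat_length (c i) + (\<Sum>j<d. rat_length (v i $ j)))"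

end

theory Submission
  imports Defs
begin

text \<open>
  For a set \<open>S\<close> of indices let \<open>G\<^sub>S\<close> be the Gram matrix of the vectors \<open>v\<^sub>i\<close>, \<open>i \<in> S\<close>. The \<open>k\<close> largest
  eigenvalues of \<open>\<Sum>\<^sub>i\<^sub>\<in>\<^sub>S v\<^sub>i v\<^sub>i\<^sup>T\<close> are those of \<open>G\<^sub>S\<close>, so \<open>\<Sum> 1 / \<lambda>\<^sub>i\<close> is the trace of the inverse of \<open>G\<^sub>S\<close>, which
  equals \<open>\<Sum>\<^sub>i det G\<^sub>S\<^sub>-\<^sub>i / det G\<^sub>S\<close>. Under volume sampling, where \<open>S\<close> has probability proportional to
  \<open>c\<^sup>S det G\<^sub>S\<close>, its mean is at most \<open>(\<Sum> c\<^sub>i) e\<^bsub>k-1\<^esub>(M) / e\<^sub>k(M)\<close>, and projecting away from the span of \<open>k - 1\<close> of the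
  vectors decreases the trace of \<open>M\<close> by at most \<open>k - 1\<close> times its norm, whence
  \<open>k e\<^sub>k(M) \<ge> (tr M - (k - 1) \<parallel>M\<parallel>) e\<^bsub>k-1\<^esub>(M)\<close>.

  To derandomise, delete vectors one at a time: averaging over all deletions preserves the mean, so
  some deletion does not increase it. The means are ratios of coefficients of characteristic
  polynomials, which the division-free Faddeev--LeVerrier recursion computes with integers of
  polynomial length once all inputs have a common denominator.
\<close>

section \<open>Gram--Schmidt residuals\<close>

text \<open>Volume sampling ranges over linearly dependent subsets too, where no inverse Gram matrix
  exists. Gram determinants are therefore introduced as products of squared Gram--Schmidt residual
  lengths, which are total thanks to \<open>x / 0 = 0\<close>; the price is a proof that the order
  of the vectors is irrelevant even when pivots vanish. In return, one recursion,
  \<open>eres_Suc\<close>, serves several ends: it yields the coefficients of det(1 + t M) and so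
  ties Gram determinants to eigenvalues, it justifies the recursion run by the machine, and the
  diagonal of that recursion supplies the numerator of the mean. The coefficients c_i are kept as
  weights because deleting a vector then means setting its weight to zero, so that one program
  evaluates every stage; once only k indices carry weight, a single subset contributes and the mean
  is its own value. Ratios are compared by cross multiplication and factorials are left in place,
  because divisions would spoil the control of the number lengths.\<close>

definition ip :: "nat \<Rightarrow> (nat \<Rightarrow> real) \<Rightarrow> (nat \<Rightarrow> real) \<Rightarrow> real" where
  "ip d x y = (\<Sum>a<d. x a * y a)"

lemma ip_commute: "ip d x y = ip d y x"
  by (simp add: ip_def mult.commute)

lemma ip_self_nonneg: "0 \<le> ip d x x"
  by (simp add: ip_def sum_nonneg)

lemma ip_diff_scale_left: "ip d (\<lambda>a. x a - t * y a) z = ip d x z - t * ip d y z"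
  by (simp add: ip_def algebra_simps sum_subtractf sum_distrib_left)

lemma ip_diff_scale_right: "ip d z (\<lambda>a. x a - t * y a) = ip d z x - t * ip d z y"
  by (simp add: ip_def algebra_simps sum_subtractf sum_distrib_left)

lemma ip_diff_sum_left: "ip d (\<lambda>a. x a - (\<Sum>i\<in>I. t i * y i a)) z = ip d x z - (\<Sum>i\<in>I. t i * ip d (y i) z)"
proof -
  have "(\<Sum>a<d. (\<Sum>i\<in>I. t i * y i a) * z a) = (\<Sum>i\<in>I. t i * (\<Sum>a<d. y i a * z a))"
    unfolding sum_distrib_right sum_distrib_left by (subst sum.swap) (simp add: mult.assoc)
  then show ?thesis
    by (simp add: ip_def left_diff_distrib sum_subtractf)
qed

lemma ip_zero_if_self_zero:
  assumes "ip d x x = 0"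
  shows "ip d x y = 0"
proof -
  have "\<forall>a\<in>{..<d}. x a * x a = 0"
    using assms sum_nonneg_eq_0_iff[of "{..<d}" "\<lambda>a. x a * x a"] by (simp add: ip_def)
  then show ?thesis
    by (simp add: ip_def)
qed

text \<open>
  A vector whose residual vanishes is skipped: the coefficient of the zero vector \<open>res d v l j\<close> is
  then \<open>0 / 0 = 0\<close>.
\<close>

fun res :: "nat \<Rightarrow> (nat \<Rightarrow> nat \<Rightarrow> real) \<Rightarrow> nat list \<Rightarrow> nat \<Rightarrow> nat \<Rightarrow> real" where
  "res d v [] i = v i"
| "res d v (j # l) i = (\<lambda>a. res d v l i a -
     ip d (res d v l i) (res d v l j) / ip d (res d v l j) (res d v l j) * res d v l j a)"

text \<open>Each new pivot performs one step of Gaussian elimination on the Gram matrix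
  (\<open>schur_Cons\<close>), so these are the entries of its Schur complement with respect to the
  vectors in \<open>l\<close>.\<close>

definition schur :: "nat \<Rightarrow> (nat \<Rightarrow> nat \<Rightarrow> real) \<Rightarrow> nat list \<Rightarrow> nat \<Rightarrow> nat \<Rightarrow> real" where
  "schur d v l a b = ip d (res d v l a) (res d v l b)"

text \<open>The product of the pivots is the Gram determinant of the listed vectors, the squared
  volume that they span.\<close>

fun gram :: "nat \<Rightarrow> (nat \<Rightarrow> nat \<Rightarrow> real) \<Rightarrow> nat list \<Rightarrow> real" where
  "gram d v [] = 1"
| "gram d v (j # l) = gram d v l * schur d v l j j"

lemma schur_commute: "schur d v l a b = schur d v l b a"
  by (simp add: schur_def ip_commute)

lemma schur_nonneg: "0 \<le> schur d v l a a"
  by (simp add: schur_def ip_self_nonneg)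

lemma schur_zero: "schur d v l a a = 0 \<Longrightarrow> schur d v l a b = 0"
  by (simp add: schur_def ip_zero_if_self_zero)

lemma schur_zero': "schur d v l a a = 0 \<Longrightarrow> schur d v l b a = 0"
  using schur_zero schur_commute by metis

lemma schur_Cons:
  "schur d v (j # l) a b = schur d v l a b - schur d v l a j * schur d v l j b / schur d v l j j"
proof (cases "schur d v l j j = 0")
  case True
  then have "ip d (res d v l j) (res d v l j) = 0"
    by (simp add: schur_def)
  then show ?thesis
    using True by (simp add: schur_def)
next
  case False
  \<comment> \<open>Both arguments lose their component along the pivot. The last bracket is the
    product of the reduced residual of \<open>a\<close> with the pivot direction, hence zero, so
    only one correction survives.\<close>
  have "schur d v (j # l) a b = schur d v l a b - schur d v l a j / schur d v l j j * schur d v l j b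
     - schur d v l b j / schur d v l j j * (schur d v l a j - schur d v l a j / schur d v l j j * schur d v l j j)"
    unfolding schur_def res.simps ip_diff_scale_left ip_diff_scale_right
    by (simp add: algebra_simps)
  then show ?thesis
    using False by simp
qed

text \<open>Two successive pivots amount to inverting a 2 by 2 block with determinant \<delta>. The
  right-hand side is symmetric in the two pivots, which is what exchanging them requires.\<close>

lemma two_step_elimination:
  fixes \<alpha> \<beta> \<gamma> \<delta> :: real
  assumes "\<beta> \<noteq> 0" "\<delta> \<noteq> 0" "\<delta> = \<alpha> * \<beta> - \<gamma> * \<gamma>"
  shows "x - p * q / \<beta> - (r - p * \<gamma> / \<beta>) * (s - q * \<gamma> / \<beta>) / (\<delta> / \<beta>)
    = x - (\<alpha> * (p * q) + \<beta> * (r * s) - \<gamma> * (r * q + p * s)) / \<delta>"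
proof -
  have "p * q / \<beta> + (r - p * \<gamma> / \<beta>) * (s - q * \<gamma> / \<beta>) / (\<delta> / \<beta>)
      = (p * q * \<delta> + (r * \<beta> - p * \<gamma>) * (s * \<beta> - q * \<gamma>)) / (\<beta> * \<delta>)"
    using assms(1,2) by (simp add: divide_simps)
  also have "p * q * \<delta> + (r * \<beta> - p * \<gamma>) * (s * \<beta> - q * \<gamma>)
      = \<beta> * (\<alpha> * (p * q) + \<beta> * (r * s) - \<gamma> * (r * q + p * s))"
    unfolding assms(3) by (simp add: algebra_simps)
  finally show ?thesis
    using assms(1) by simp
qed

lemma schur_swap: "schur d v (i # j # l) a b = schur d v (j # i # l) a b"
proof -
  define B where "B = schur d v l"
  define \<alpha> \<beta> \<gamma> where "\<alpha> = B i i" and "\<beta> = B j j" and "\<gamma> = B i j"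
  have \<gamma>': "B j i = \<gamma>" "B i b = B b i" "B j b = B b j"
    unfolding B_def \<gamma>_def by (rule schur_commute)+
  have zi: "\<alpha> = 0 \<Longrightarrow> B x i = 0 \<and> B i x = 0" for x
    unfolding B_def \<alpha>_def using schur_zero schur_zero' by blast
  have zj: "\<beta> = 0 \<Longrightarrow> B x j = 0 \<and> B j x = 0" for x
    unfolding B_def \<beta>_def using schur_zero schur_zero' by blast
  have ji: "schur d v (j # l) x y = B x y - B x j * B j y / \<beta>" for x y
    by (simp add: schur_Cons B_def \<beta>_def)
  have ij: "schur d v (i # l) x y = B x y - B x i * B i y / \<alpha>" for x y
    by (simp add: schur_Cons B_def \<alpha>_def)
  have L: "schur d v (i # j # l) a b = B a b - B a j * B b j / \<beta> -
    (B a i - B a j * \<gamma> / \<beta>) * (B b i - B b j * \<gamma> / \<beta>) / (\<alpha> - \<gamma> * \<gamma> / \<beta>)"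
    unfolding schur_Cons[of d v i "j # l"] ji \<gamma>' \<alpha>_def[symmetric] \<gamma>_def[symmetric]
    by (simp only: mult.commute)
  have R: "schur d v (j # i # l) a b = B a b - B a i * B b i / \<alpha> -
    (B a j - B a i * \<gamma> / \<alpha>) * (B b j - B b i * \<gamma> / \<alpha>) / (\<beta> - \<gamma> * \<gamma> / \<alpha>)"
    unfolding schur_Cons[of d v j "i # l"] ij \<gamma>' \<beta>_def[symmetric] \<gamma>_def[symmetric]
    by (simp only: mult.commute)
  consider "\<alpha> = 0" | "\<beta> = 0" | "\<alpha> \<noteq> 0" "\<beta> \<noteq> 0" "\<alpha> * \<beta> = \<gamma> * \<gamma>" | "\<alpha> \<noteq> 0" "\<beta> \<noteq> 0" "\<alpha> * \<beta> \<noteq> \<gamma> * \<gamma>"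
    by blast
  then show ?thesis
  proof cases
    case 1
    then show ?thesis
      unfolding L R using zi[OF 1, of a] zi[OF 1, of b] zi[OF 1, of j] \<gamma>'(1) by simp
  next
    case 2
    then show ?thesis
      unfolding L R using zj[OF 2, of a] zj[OF 2, of b] zj[OF 2, of i] \<gamma>'(1) by simp
  next
    case 3
    \<comment> \<open>Dependent pivots: after eliminating i the residual of j vanishes, so column j
      of \<open>B\<close> is \<gamma> / \<alpha> times column i. In either order the second pivot is
      zero and drops out.\<close>
    have "schur d v (i # l) j j = 0"
      unfolding ij \<gamma>' \<gamma>_def[symmetric] \<beta>_def[symmetric] 3(3)[symmetric] using 3(1) by simp
    then have x: "B x j = B x i * \<gamma> / \<alpha>" for x
      using schur_zero'[of d v "i # l" j x] unfolding ij \<gamma>_def[symmetric] by simp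
    have d: "\<alpha> - \<gamma> * \<gamma> / \<beta> = 0" "\<beta> - \<gamma> * \<gamma> / \<alpha> = 0"
      unfolding 3(3)[symmetric] using 3(1,2) by simp_all
    have "B a j * B b j / \<beta> = B a i * B b i * (\<gamma> * \<gamma>) / (\<alpha> * \<alpha> * \<beta>)"
      unfolding x by simp
    also have "\<dots> = B a i * B b i / \<alpha>"
      unfolding 3(3)[symmetric] using 3(1,2) by simp
    finally show ?thesis
      unfolding L R d by simp
  next
    case 4
    define \<delta> where "\<delta> = \<alpha> * \<beta> - \<gamma> * \<gamma>"
    have d: "\<alpha> - \<gamma> * \<gamma> / \<beta> = \<delta> / \<beta>" "\<beta> - \<gamma> * \<gamma> / \<alpha> = \<delta> / \<alpha>" "\<delta> \<noteq> 0"
      using 4 by (simp_all add: \<delta>_def diff_divide_distrib)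
    have \<delta>': "\<delta> = \<beta> * \<alpha> - \<gamma> * \<gamma>"
      by (simp add: \<delta>_def mult.commute)
    show ?thesis
      unfolding L R d two_step_elimination[OF 4(2) d(3) \<delta>_def] two_step_elimination[OF 4(1) d(3) \<delta>']
      by (simp only: add.commute mult.commute)
  qed
qed

text \<open>Two pivots multiply to a 2 by 2 principal minor of the Schur complement, which is
  symmetric in i and j. A zero pivot is harmless because its off-diagonal entry is zero as
  well.\<close>

lemma gram_swap: "gram d v (i # j # l) = gram d v (j # i # l)"
proof -
  have *: "schur d v l p p * schur d v (p # l) q q
      = schur d v l p p * schur d v l q q - schur d v l p q * schur d v l p q" for p q
  proof (cases "schur d v l p p = 0")
    case False
    then show ?thesis
      by (simp add: schur_Cons schur_commute[of d v l q p] right_diff_distrib)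
  qed (use schur_zero[of d v l p q] in simp)
  show ?thesis
    using *[of i j] *[of j i] schur_commute[of d v l i j] by (simp add: mult.assoc)
qed

lemma schur_move: "schur d v (l1 @ i # l2) = schur d v (i # l1 @ l2)"
proof (induction l1)
  case (Cons w l1)
  have "schur d v (w # (l1 @ i # l2)) = schur d v (w # i # l1 @ l2)"
    by (intro ext) (simp only: schur_Cons[of d v w] Cons.IH)
  also have "\<dots> = schur d v (i # w # l1 @ l2)"
    by (intro ext) (rule schur_swap)
  finally show ?case
    by simp
qed simp

lemma gram_move: "gram d v (l1 @ i # l2) = gram d v (i # l1 @ l2)"
proof (induction l1)
  case (Cons w l1)
  have "gram d v (w # (l1 @ i # l2)) = gram d v (w # i # l1 @ l2)"
    unfolding gram.simps(2)[of d v w] Cons.IH schur_move ..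
  then show ?case
    by (simp only: append_Cons gram_swap)
qed simp

text \<open>Exchanges of neighbours generate all permutations; this permits indexing by finite sets,
  with the sorted list as representative.\<close>

lemma schur_gram_mset:
  "mset l = mset l' \<Longrightarrow> schur d v l = schur d v l' \<and> gram d v l = gram d v l'"
proof (induction l arbitrary: l')
  case (Cons i l)
  from Cons.prems have "i \<in> set l'"
    by (metis list.set_intros(1) set_mset_mset)
  then obtain l1 l2 where l': "l' = l1 @ i # l2"
    by (auto dest: split_list)
  then have IH: "schur d v l = schur d v (l1 @ l2)" "gram d v l = gram d v (l1 @ l2)"
    using Cons.IH[of "l1 @ l2"] Cons.prems by auto
  have "schur d v (i # l) = schur d v (i # l1 @ l2)"
    by (intro ext) (simp only: schur_Cons[of d v i] IH)
  then show ?case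
    unfolding l' schur_move gram_move using IH by simp
qed simp

section \<open>Residuals, Schur complements and Gram determinants of finite sets\<close>

definition resS :: "nat \<Rightarrow> (nat \<Rightarrow> nat \<Rightarrow> real) \<Rightarrow> nat set \<Rightarrow> nat \<Rightarrow> nat \<Rightarrow> real" where
  "resS d v S = res d v (sorted_list_of_set S)"

definition schurS :: "nat \<Rightarrow> (nat \<Rightarrow> nat \<Rightarrow> real) \<Rightarrow> nat set \<Rightarrow> nat \<Rightarrow> nat \<Rightarrow> real" where
  "schurS d v S = schur d v (sorted_list_of_set S)"

definition gramS :: "nat \<Rightarrow> (nat \<Rightarrow> nat \<Rightarrow> real) \<Rightarrow> nat set \<Rightarrow> real" where
  "gramS d v S = gram d v (sorted_list_of_set S)"

lemma mset_sorted_list_insert: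
  assumes "finite S" "i \<notin> S"
  shows "mset (sorted_list_of_set (insert i S)) = mset (i # sorted_list_of_set S)"
  using assms by (simp add: sorted_list_of_set_insert_remove)

lemma schurS_empty: "schurS d v {} a b = ip d (v a) (v b)"
  by (simp add: schurS_def schur_def)

lemma gramS_empty: "gramS d v {} = 1"
  by (simp add: gramS_def)

lemma schurS_insert:
  assumes "finite S" "i \<notin> S"
  shows "schurS d v (insert i S) a b = schurS d v S a b - schurS d v S a i * schurS d v S i b / schurS d v S i i"
  unfolding schurS_def using schur_gram_mset[OF mset_sorted_list_insert[OF assms], of d v]
  by (simp add: schur_Cons)

lemma gramS_insert:
  assumes "finite S" "i \<notin> S"
  shows "gramS d v (insert i S) = gramS d v S * schurS d v S i i"
  unfolding schurS_def gramS_def using schur_gram_mset[OF mset_sorted_list_insert[OF assms], of d v]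
  by simp

lemma gramS_remove:
  assumes "finite S" "i \<in> S"
  shows "gramS d v S = gramS d v (S - {i}) * schurS d v (S - {i}) i i"
  using gramS_insert[of "S - {i}" i d v] assms by (simp add: insert_absorb)

lemma schurS_commute: "schurS d v S a b = schurS d v S b a"
  by (simp add: schurS_def schur_commute)

lemma schurS_nonneg: "0 \<le> schurS d v S a a"
  by (simp add: schurS_def schur_nonneg)

lemma schurS_zero: "schurS d v S a a = 0 \<Longrightarrow> schurS d v S a b = 0"
  by (simp add: schurS_def schur_zero)

lemma schurS_res: "schurS d v S a b = ip d (resS d v S a) (resS d v S b)"
  by (simp add: schurS_def resS_def schur_def)

lemma gramS_nonneg: "0 \<le> gramS d v S"
proof -
  have "0 \<le> gram d v l" for l
    by (induction l) (simp_all add: schur_nonneg)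
  then show ?thesis
    by (simp add: gramS_def)
qed

text \<open>Orthogonal projection is self-adjoint and idempotent, so it suffices to project one of
  the two arguments.\<close>

lemma ip_res: "ip d (v a) (res d v l b) = schur d v l a b"
proof (induction l arbitrary: b)
  case (Cons j l)
  then show ?case
    unfolding res.simps ip_diff_scale_right Cons.IH schur_Cons schur_def[symmetric]
    by (simp add: schur_commute[of d v l b j])
qed (simp add: schur_def)

lemma ip_resS: "ip d (v a) (resS d v S b) = schurS d v S a b"
  by (simp add: resS_def schurS_def ip_res)

lemma res_span: "\<exists>y. \<forall>x. res d v l b x = v b x - (\<Sum>i\<in>set l. y i * v i x)"
proof (induction l arbitrary: b)
  case (Cons j l)
  define t where "t = ip d (res d v l b) (res d v l j) / ip d (res d v l j) (res d v l j)"
  obtain y where y: "\<And>x. res d v l b x = v b x - (\<Sum>i\<in>set l. y i * v i x)"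
    using Cons by blast
  obtain z where z: "\<And>x. res d v l j x = v j x - (\<Sum>i\<in>set l. z i * v i x)"
    using Cons by blast
  \<comment> \<open>The two conditionals are separate because j may already occur in
    \<open>l\<close>.\<close>
  define u where "u = (\<lambda>i. (if i \<in> set l then y i - t * z i else 0) + (if i = j then t else 0))"
  have "(\<Sum>i\<in>set (j # l). u i * v i x) = (\<Sum>i\<in>set l. (y i - t * z i) * v i x) + t * v j x" for x
  proof -
    have "(\<Sum>i\<in>set (j # l). u i * v i x) =
       (\<Sum>i\<in>insert j (set l). (if i \<in> set l then (y i - t * z i) * v i x else 0)) +
       (\<Sum>i\<in>insert j (set l). (if i = j then t * v i x else 0))"
      unfolding sum.distrib[symmetric] by (intro sum.cong) (auto simp: u_def algebra_simps)
    also have "(\<Sum>i\<in>insert j (set l). (if i \<in> set l then (y i - t * z i) * v i x else 0)) =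
        (\<Sum>i\<in>set l. (y i - t * z i) * v i x)"
      by (simp add: sum.inter_restrict[symmetric] Int_insert_left insert_absorb)
    also have "(\<Sum>i\<in>insert j (set l). (if i = j then t * v i x else 0)) = t * v j x"
      by (subst sum.delta) auto
    finally show ?thesis .
  qed
  then have "res d v (j # l) b x = v b x - (\<Sum>i\<in>set (j # l). u i * v i x)" for x
    unfolding res.simps t_def[symmetric] y z
    by (simp add: algebra_simps sum_subtractf sum_distrib_left)
  then show ?case
    by blast
qed simp

lemma resS_span:
  assumes "finite S"
  obtains y where "\<And>x. resS d v S b x = v b x - (\<Sum>i\<in>S. y i * v i x)"
  using res_span[of d v "sorted_list_of_set S" b] assms by (auto simp: resS_def)

text \<open>Pivoting on i clears its row; a zero pivot means that the row was zero already. Sums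
  over all indices thereby restrict themselves to those outside \<open>S\<close>.\<close>

lemma schurS_mem_zero:
  assumes "finite S" "i \<in> S"
  shows "schurS d v S i b = 0"
proof -
  define T where "T = S - {i}"
  have S: "S = insert i T" "finite T" "i \<notin> T"
    using assms by (auto simp: T_def)
  show ?thesis
    unfolding S(1) schurS_insert[OF S(2,3)]
    using schurS_zero[of d v T i b] by (cases "schurS d v T i i = 0") simp_all
qed

text \<open>
  If the Gram determinant is nonzero, the vectors \<open>resS d v (S - {i}) i\<close>, rescaled, form the dual
  basis of \<open>v\<^sub>i\<close>, \<open>i \<in> S\<close>; otherwise every summand vanishes.
\<close>

lemma gram_dual_expansion:
  assumes S: "finite S"
  shows "(\<Sum>i\<in>S. gramS d v (S - {i}) * schurS d v (S - {i}) i b * v i x)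
    = gramS d v S * (v b x - resS d v S b x)"
proof (cases "gramS d v S = 0")
  case True
  have "gramS d v (S - {i}) * schurS d v (S - {i}) i b = 0" if "i \<in> S" for i
    using gramS_remove[OF S that, of d v] True schurS_zero[of d v "S - {i}" i b] by auto
  then have "(\<Sum>i\<in>S. gramS d v (S - {i}) * schurS d v (S - {i}) i b * v i x) = 0"
    by (intro sum.neutral) simp
  then show ?thesis
    using True by simp
next
  case False
  obtain y where y: "\<And>x. resS d v S b x = v b x - (\<Sum>i\<in>S. y i * v i x)"
    using resS_span[OF S] by metis
  have "gramS d v S * y i = gramS d v (S - {i}) * schurS d v (S - {i}) i b" if i: "i \<in> S" for i
  proof -
    define T where "T = S - {i}"
    have T: "finite T" "T \<subseteq> S" "S = insert i T" "i \<notin> T"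
      using S i by (auto simp: T_def)
    obtain z where z: "\<And>x. resS d v T i x = v i x - (\<Sum>j\<in>T. z j * v j x)"
      using resS_span[OF T(1)] by metis
    \<comment> \<open>The residual of b relative to \<open>S\<close> is paired with the residual of
      i relative to the other vectors. Expanding the latter shows that the product is zero;
      expanding the former isolates the coefficient \<open>y i\<close>.\<close>
    have "ip d (resS d v T i) (resS d v S b) = schurS d v S i b - (\<Sum>j\<in>T. z j * schurS d v S j b)"
      unfolding z[abs_def] ip_diff_sum_left ip_resS ..
    also have "\<dots> = 0"
      using schurS_mem_zero[OF S, of _ d v b] i T(2) by (auto intro!: sum.neutral)
    finally have 0: "ip d (resS d v S b) (resS d v T i) = 0"
      by (simp add: ip_commute)
    have "ip d (resS d v S b) (resS d v T i) = schurS d v T b i - (\<Sum>j\<in>S. y j * schurS d v T j i)"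
      unfolding y[abs_def] ip_diff_sum_left ip_resS ..
    also have "(\<Sum>j\<in>S. y j * schurS d v T j i) = y i * schurS d v T i i"
      unfolding T(3) using T(1,4) schurS_mem_zero[OF T(1), of _ d v i] by simp
    finally have "y i * schurS d v T i i = schurS d v T i b"
      using 0 schurS_commute[of d v T b i] by simp
    then show ?thesis
      unfolding gramS_remove[OF S i] T_def[symmetric] by (simp add: mult.assoc mult.commute)
  qed
  then have "(\<Sum>i\<in>S. gramS d v (S - {i}) * schurS d v (S - {i}) i b * v i x)
      = (\<Sum>i\<in>S. gramS d v S * (y i * v i x))"
    by (intro sum.cong) (simp_all add: mult.assoc[symmetric])
  then show ?thesis
    by (simp add: y sum_distrib_left)
qed

section \<open>Weighted elementary symmetric functions\<close>

definition subs :: "nat \<Rightarrow> nat \<Rightarrow> nat set set" where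
  "subs n k = {S. S \<subseteq> {..<n} \<and> card S = k}"

lemma finite_subs: "finite (subs n k)"
  by (rule finite_subset[of _ "Pow {..<n}"]) (auto simp: subs_def)

lemma subs_finite: "S \<in> subs n k \<Longrightarrow> finite S"
  by (auto simp: subs_def intro: finite_subset)

lemma subs_0: "subs n 0 = {{}}"
  by (auto simp: subs_def dest: finite_subset)

text \<open>Double counting: a k-set with a marked outside element is a (k+1)-set with a marked
  member.\<close>

lemma sum_subs_Suc:
  fixes f :: "nat set \<Rightarrow> nat \<Rightarrow> real"
  shows "(\<Sum>T\<in>subs n k. \<Sum>i\<in>{..<n} - T. f T i) = (\<Sum>S\<in>subs n (Suc k). \<Sum>i\<in>S. f (S - {i}) i)"
proof -
  have "(\<Sum>T\<in>subs n k. \<Sum>i\<in>{..<n} - T. f T i) = (\<Sum>(T, i)\<in>(SIGMA T:subs n k. {..<n} - T). f T i)"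
    by (rule sum.Sigma) (auto simp: finite_subs)
  also have "\<dots> = (\<Sum>(S, i)\<in>(SIGMA S:subs n (Suc k). S). f (S - {i}) i)"
    by (rule sum.reindex_bij_witness[where i = "\<lambda>(S, i). (S - {i}, i)" and j = "\<lambda>(T, i). (insert i T, i)"])
      (auto simp: subs_def insert_absorb card_insert_if finite_subset)
  also have "\<dots> = (\<Sum>S\<in>subs n (Suc k). \<Sum>i\<in>S. f (S - {i}) i)"
    by (rule sum.Sigma[symmetric]) (auto simp: finite_subs subs_finite)
  finally show ?thesis .
qed

text \<open>By Cauchy--Binet this is the k-th elementary symmetric function of the eigenvalues of
  \<Sum> W i v_i v_i^T.\<close>

definition esym :: "nat \<Rightarrow> nat \<Rightarrow> (nat \<Rightarrow> nat \<Rightarrow> real) \<Rightarrow> (nat \<Rightarrow> real) \<Rightarrow> nat \<Rightarrow> real" where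
  "esym n d v W k = (\<Sum>S\<in>subs n k. prod W S * gramS d v S)"

definition ekernel :: "nat \<Rightarrow> nat \<Rightarrow> (nat \<Rightarrow> nat \<Rightarrow> real) \<Rightarrow> (nat \<Rightarrow> real) \<Rightarrow> nat \<Rightarrow> nat \<Rightarrow> nat \<Rightarrow> real" where
  "ekernel n d v W k a b = (\<Sum>S\<in>subs n k. prod W S * gramS d v S * schurS d v S a b)"

text \<open>These vectors are the coefficients in t of adj(1 + t M) applied to v_b, where M = \<Sum>
  W i v_i v_i^T; \<open>ekernel\<close> collects their products with the v_a.\<close>

definition eres :: "nat \<Rightarrow> nat \<Rightarrow> (nat \<Rightarrow> nat \<Rightarrow> real) \<Rightarrow> (nat \<Rightarrow> real) \<Rightarrow> nat \<Rightarrow> nat \<Rightarrow> nat \<Rightarrow> real" where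
  "eres n d v W k b x = (\<Sum>S\<in>subs n k. prod W S * gramS d v S * resS d v S b x)"

lemma esym_0: "esym n d v W 0 = 1"
  by (simp add: esym_def subs_0 gramS_empty)

lemma ekernel_0: "ekernel n d v W 0 a b = ip d (v a) (v b)"
  by (simp add: ekernel_def subs_0 gramS_empty schurS_empty)

lemma eres_0: "eres n d v W 0 b = v b"
  by (rule ext) (simp add: eres_def subs_0 gramS_empty resS_def)

lemma ip_eres: "ip d (v a) (eres n d v W k b) = ekernel n d v W k a b"
proof -
  have "ip d (v a) (eres n d v W k b) =
      (\<Sum>S\<in>subs n k. prod W S * gramS d v S * ip d (v a) (resS d v S b))"
    unfolding ip_def eres_def sum_distrib_left
    by (subst sum.swap) (simp add: mult_ac)
  then show ?thesis
    by (simp add: ip_resS ekernel_def)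
qed

lemma esym_nonneg:
  assumes "\<And>i. i < n \<Longrightarrow> 0 \<le> W i"
  shows "0 \<le> esym n d v W k"
  unfolding esym_def
  by (intro sum_nonneg mult_nonneg_nonneg prod_nonneg gramS_nonneg) (use assms in \<open>auto simp: subs_def\<close>)

text \<open>The common pattern of \<open>esym_Suc\<close>, \<open>eres_Suc\<close> and
  \<open>enum_eq\<close>: terms with i in \<open>S\<close> vanish, and the remaining pairs are
  regrouped by \<open>insert i S\<close>.\<close>

lemma sum_kernel:
  assumes "\<And>S i. S \<in> subs n k \<Longrightarrow> i \<in> S \<Longrightarrow> h S i = 0"
  shows "(\<Sum>i<n. f i * (\<Sum>S\<in>subs n k. prod W S * h S i)) =
    (\<Sum>S\<in>subs n (Suc k). \<Sum>i\<in>S. f i * (prod W (S - {i}) * h (S - {i}) i :: real))"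
proof -
  have "(\<Sum>i<n. f i * (\<Sum>S\<in>subs n k. prod W S * h S i)) =
      (\<Sum>S\<in>subs n k. \<Sum>i<n. f i * (prod W S * h S i))"
    unfolding sum_distrib_left by (rule sum.swap)
  also have "\<dots> = (\<Sum>S\<in>subs n k. \<Sum>i\<in>{..<n} - S. f i * (prod W S * h S i))"
    by (intro sum.cong refl sum.mono_neutral_right) (auto simp: assms)
  also have "\<dots> = (\<Sum>S\<in>subs n (Suc k). \<Sum>i\<in>S. f i * (prod W (S - {i}) * h (S - {i}) i))"
    by (rule sum_subs_Suc)
  finally show ?thesis .
qed

text \<open>Every (k+1)-subset arises k + 1 times, once for each choice of the vector that is
  adjoined last.\<close>

lemma esym_Suc: "real (Suc k) * esym n d v W (Suc k) = (\<Sum>i<n. W i * ekernel n d v W k i i)"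
proof -
  have "(\<Sum>i<n. W i * ekernel n d v W k i i) =
     (\<Sum>S\<in>subs n (Suc k). \<Sum>i\<in>S. W i * (prod W (S - {i}) * (gramS d v (S - {i}) * schurS d v (S - {i}) i i)))"
    unfolding ekernel_def mult.assoc
    by (rule sum_kernel) (simp add: schurS_mem_zero subs_finite)
  also have "\<dots> = (\<Sum>S\<in>subs n (Suc k). \<Sum>i\<in>S. prod W S * gramS d v S)"
  proof (intro sum.cong refl)
    fix S i assume S: "S \<in> subs n (Suc k)" "i \<in> S"
    have "W i * prod W (S - {i}) = prod W S"
      using prod.remove[OF subs_finite[OF S(1)] S(2), of W] by simp
    then show "W i * (prod W (S - {i}) * (gramS d v (S - {i}) * schurS d v (S - {i}) i i)) = prod W S * gramS d v S"
      unfolding gramS_remove[OF subs_finite[OF S(1)] S(2)] by (simp add: mult.assoc[symmetric])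
  qed
  also have "\<dots> = real (Suc k) * esym n d v W (Suc k)"
    unfolding esym_def sum_distrib_left by (intro sum.cong) (auto simp: subs_def)
  finally show ?thesis ..
qed

text \<open>This is the Faddeev--LeVerrier recursion N_{k+1} = e_{k+1} 1 - M N_k applied to v_b. It
  is the dual-basis expansion of v_b summed over all (k+1)-subsets.\<close>

lemma eres_Suc:
  "eres n d v W (Suc k) b x = esym n d v W (Suc k) * v b x - (\<Sum>i<n. W i * v i x * ekernel n d v W k i b)"
proof -
  have "(\<Sum>i<n. W i * v i x * ekernel n d v W k i b) =
     (\<Sum>S\<in>subs n (Suc k). \<Sum>i\<in>S. W i * v i x * (prod W (S - {i}) * (gramS d v (S - {i}) * schurS d v (S - {i}) i b)))"
    unfolding ekernel_def mult.assoc[of _ _ "schurS d v _ _ _"]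
    by (rule sum_kernel) (simp add: schurS_mem_zero subs_finite)
  also have "\<dots> = (\<Sum>S\<in>subs n (Suc k). prod W S * (gramS d v S * (v b x - resS d v S b x)))"
  proof (intro sum.cong refl)
    fix S assume S: "S \<in> subs n (Suc k)"
    have "W i * v i x * (prod W (S - {i}) * (gramS d v (S - {i}) * schurS d v (S - {i}) i b))
        = prod W S * (gramS d v (S - {i}) * schurS d v (S - {i}) i b * v i x)" if "i \<in> S" for i
      using prod.remove[OF subs_finite[OF S] that, of W] by simp
    then show "(\<Sum>i\<in>S. W i * v i x * (prod W (S - {i}) * (gramS d v (S - {i}) * schurS d v (S - {i}) i b)))
        = prod W S * (gramS d v S * (v b x - resS d v S b x))"
      unfolding gram_dual_expansion[OF subs_finite[OF S], symmetric] sum_distrib_left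
      by (intro sum.cong) simp_all
  qed
  also have "\<dots> = esym n d v W (Suc k) * v b x - eres n d v W (Suc k) b x"
    unfolding esym_def eres_def sum_distrib_right sum_subtractf[symmetric]
    by (intro sum.cong) (simp_all add: algebra_simps)
  finally show ?thesis
    by simp
qed

lemma ekernel_Suc:
  "ekernel n d v W (Suc k) a b =
    esym n d v W (Suc k) * ip d (v a) (v b) - (\<Sum>i<n. W i * ip d (v a) (v i) * ekernel n d v W k i b)"
proof -
  have "ekernel n d v W (Suc k) a b =
     (\<Sum>x<d. esym n d v W (Suc k) * (v a x * v b x)) - (\<Sum>x<d. \<Sum>i<n. W i * (v a x * v i x) * ekernel n d v W k i b)"
    unfolding ip_eres[symmetric] ip_def[of d _ "eres n d v W (Suc k) b"] eres_Suc sum_subtractf[symmetric]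
    by (intro sum.cong refl) (simp add: right_diff_distrib sum_distrib_left mult_ac)
  also have "(\<Sum>x<d. \<Sum>i<n. W i * (v a x * v i x) * ekernel n d v W k i b) =
      (\<Sum>i<n. W i * ip d (v a) (v i) * ekernel n d v W k i b)"
    unfolding ip_def sum_distrib_left sum_distrib_right by (rule sum.swap)
  finally show ?thesis
    by (simp add: ip_def sum_distrib_left)
qed

section \<open>Deleting a vector by setting its weight to zero\<close>

lemma ekernel_delete:
  assumes "i < n"
  shows "ekernel n d v (W(i := 0)) k i i = ekernel n d v W k i i"
  unfolding ekernel_def
proof (intro sum.cong refl)
  fix S assume S: "S \<in> subs n k"
  show "prod (W(i := 0)) S * gramS d v S * schurS d v S i i = prod W S * gramS d v S * schurS d v S i i"
  proof (cases "i \<in> S")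
    \<comment> \<open>Changing the weight of i affects only sets that contain i, and relative to
      those the residual of i is zero.\<close>
    case True
    then show ?thesis
      by (simp add: schurS_mem_zero subs_finite[OF S])
  next
    case False
    then have "prod (W(i := 0)) S = prod W S"
      by (intro prod.cong) auto
    then show ?thesis
      by simp
  qed
qed

lemma subs_containing:
  fixes f :: "nat set \<Rightarrow> real"
  assumes "i < n"
  shows "(\<Sum>S\<in>{S \<in> subs n (Suc k). i \<in> S}. f S) = (\<Sum>T\<in>{T \<in> subs n k. i \<notin> T}. f (insert i T))"
  by (rule sum.reindex_bij_witness[where i = "insert i" and j = "\<lambda>S. S - {i}"])
    (use assms in \<open>auto simp: subs_def insert_absorb card_insert_if finite_subset\<close>)

lemma esym_delete_eq:
  "esym n d v (W(i := 0)) k = (\<Sum>S\<in>{S \<in> subs n k. i \<notin> S}. prod W S * gramS d v S)"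
proof -
  have "esym n d v (W(i := 0)) k = (\<Sum>S\<in>{S \<in> subs n k. i \<notin> S}. prod (W(i := 0)) S * gramS d v S)"
    unfolding esym_def
  proof (intro sum.mono_neutral_right finite_subs ballI)
    fix S assume "S \<in> subs n k - {S \<in> subs n k. i \<notin> S}"
    then have "prod (W(i := 0)) S = 0"
      by (intro prod_zero) (auto simp: subs_finite)
    then show "prod (W(i := 0)) S * gramS d v S = 0"
      by simp
  qed auto
  also have "\<dots> = (\<Sum>S\<in>{S \<in> subs n k. i \<notin> S}. prod W S * gramS d v S)"
    by (intro sum.cong refl arg_cong2[where f = "(*)"] prod.cong) auto
  finally show ?thesis .
qed

lemma esym_split:
  "esym n d v W k = esym n d v (W(i := 0)) k + (\<Sum>S\<in>{S \<in> subs n k. i \<in> S}. prod W S * gramS d v S)"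
proof -
  have "esym n d v W k = (\<Sum>S\<in>{S \<in> subs n k. i \<notin> S} \<union> {S \<in> subs n k. i \<in> S}. prod W S * gramS d v S)"
    unfolding esym_def by (intro sum.cong) auto
  also have "\<dots> = esym n d v (W(i := 0)) k + (\<Sum>S\<in>{S \<in> subs n k. i \<in> S}. prod W S * gramS d v S)"
    unfolding esym_delete_eq by (rule sum.union_disjoint) (auto simp: finite_subs)
  finally show ?thesis .
qed

lemma esym_delete:
  assumes "i < n"
  shows "esym n d v W (Suc k) = esym n d v (W(i := 0)) (Suc k) + W i * ekernel n d v W k i i"
proof -
  have "(\<Sum>S\<in>{S \<in> subs n (Suc k). i \<in> S}. prod W S * gramS d v S) =
      (\<Sum>T\<in>{T \<in> subs n k. i \<notin> T}. W i * (prod W T * gramS d v T * schurS d v T i i))"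
    unfolding subs_containing[OF assms]
    by (intro sum.cong) (auto simp: subs_finite gramS_insert mult_ac)
  also have "\<dots> = (\<Sum>T\<in>subs n k. W i * (prod W T * gramS d v T * schurS d v T i i))"
    by (intro sum.mono_neutral_left) (auto simp: finite_subs subs_finite schurS_mem_zero)
  finally show ?thesis
    unfolding esym_split[of n d v W "Suc k" i] ekernel_def sum_distrib_left by simp
qed

lemma esym_delete_le:
  assumes "\<And>i. i < n \<Longrightarrow> 0 \<le> W i"
  shows "esym n d v (W(i := 0)) k \<le> esym n d v W k"
proof -
  have "0 \<le> (\<Sum>S\<in>{S \<in> subs n k. i \<in> S}. prod W S * gramS d v S)"
    by (intro sum_nonneg mult_nonneg_nonneg prod_nonneg gramS_nonneg) (use assms in \<open>auto simp: subs_def\<close>)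
  then show ?thesis
    unfolding esym_split[of n d v W k i] by simp
qed

text \<open>
  For weights \<open>W\<close> this is \<open>\<Sum>\<^sub>S W\<^sup>S det(G\<^sub>S) tr(G\<^sub>S\<^sup>-\<^sup>1)\<close> over the \<open>k\<close>-subsets \<open>S\<close>, where \<open>G\<^sub>S\<close>
  is the Gram matrix, so \<open>enum / esym\<close> is the mean of \<open>tr(G\<^sub>S\<^sup>-\<^sup>1)\<close> under volume sampling.
\<close>

definition enum :: "nat \<Rightarrow> nat \<Rightarrow> (nat \<Rightarrow> nat \<Rightarrow> real) \<Rightarrow> (nat \<Rightarrow> real) \<Rightarrow> nat \<Rightarrow> real" where
  "enum n d v W k = (\<Sum>i<n. W i * esym n d v (W(i := 0)) (k - 1))"

lemma enum_nonneg:
  assumes "\<And>i. i < n \<Longrightarrow> 0 \<le> W i"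
  shows "0 \<le> enum n d v W k"
  unfolding enum_def by (intro sum_nonneg mult_nonneg_nonneg esym_nonneg) (use assms in auto)

text \<open>An index i together with a (k-1)-set avoiding it is a k-set with a marked member. At k =
  0 the truncated \<open>k - 1\<close> would break the correspondence.\<close>

lemma enum_eq:
  assumes "0 < k"
  shows "enum n d v W k = (\<Sum>S\<in>subs n k. prod W S * (\<Sum>i\<in>S. gramS d v (S - {i})))"
proof -
  obtain k' where k: "k = Suc k'"
    using assms by (cases k) auto
  have "enum n d v W k = (\<Sum>i<n. W i * (\<Sum>S\<in>subs n k'. prod W S * (if i \<in> S then 0 else gramS d v S)))"
    unfolding enum_def k diff_Suc_1 esym_delete_eq
    by (intro sum.cong refl arg_cong2[where f = "(*)"] sum.mono_neutral_cong_left) (auto simp: finite_subs)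
  also have "\<dots> = (\<Sum>S\<in>subs n k. \<Sum>i\<in>S. W i * (prod W (S - {i}) * (if i \<in> S - {i} then 0 else gramS d v (S - {i}))))"
    unfolding k by (rule sum_kernel) simp
  also have "\<dots> = (\<Sum>S\<in>subs n k. prod W S * (\<Sum>i\<in>S. gramS d v (S - {i})))"
  proof (intro sum.cong refl)
    fix S assume S: "S \<in> subs n k"
    show "(\<Sum>i\<in>S. W i * (prod W (S - {i}) * (if i \<in> S - {i} then 0 else gramS d v (S - {i})))) =
       prod W S * (\<Sum>i\<in>S. gramS d v (S - {i}))"
      unfolding sum_distrib_left
      using prod.remove[OF subs_finite[OF S], of _ W] by (intro sum.cong) (simp_all add: mult.assoc[symmetric])
  qed
  finally show ?thesis .
qed


lemma enum_le:
  assumes "\<And>i. i < n \<Longrightarrow> 0 \<le> W i"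
  shows "enum n d v W k \<le> (\<Sum>i<n. W i) * esym n d v W (k - 1)"
  unfolding enum_def sum_distrib_right
  by (intro sum_mono mult_left_mono esym_delete_le) (use assms in auto)

text \<open>A k-subset of \<open>A\<close> survives exactly the deletions of the
  \<open>card A - k\<close> indices outside it, while sets not contained in \<open>A\<close> carry
  weight zero.\<close>

lemma sum_delete_subs:
  fixes h :: "nat set \<Rightarrow> real"
  assumes A: "A \<subseteq> {..<n}" and W: "\<And>i. i < n \<Longrightarrow> i \<notin> A \<Longrightarrow> W i = 0"
  shows "(\<Sum>i\<in>A. \<Sum>S\<in>subs n k. prod (W(i := 0)) S * h S) =
    (real (card A) - real k) * (\<Sum>S\<in>subs n k. prod W S * h S)"
proof -
  have fA: "finite A"
    using A finite_subset by blast
  have "(\<Sum>i\<in>A. prod (W(i := 0)) S) = (real (card A) - real k) * prod W S" if S: "S \<in> subs n k" for S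
  proof -
    have "prod (W(i := 0)) S = (if i \<in> S then 0 else \<Prod>j\<in>S. W j)" for i
      using subs_finite[OF S] by (auto intro!: prod_zero prod.cong)
    then have *: "(\<Sum>i\<in>A. prod (W(i := 0)) S) = real (card (A - S)) * prod W S"
      using fA by (simp add: sum.If_cases Diff_eq)
    show ?thesis
    proof (cases "S \<subseteq> A")
      case True
      then have "card (A - S) = card A - k" "k \<le> card A"
        using S fA subs_finite[OF S] by (auto simp: subs_def card_Diff_subset card_mono)
      then show ?thesis
        unfolding * by (simp add: of_nat_diff)
    next
      case False
      then obtain j where "j \<in> S" "j \<notin> A"
        by auto
      moreover from this have "W j = 0"
        using S W by (auto simp: subs_def)
      ultimately have "prod W S = 0"
        using subs_finite[OF S] by (auto intro: prod_zero)
      then show ?thesis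
        unfolding * by simp
    qed
  qed
  then have "(\<Sum>S\<in>subs n k. (\<Sum>i\<in>A. prod (W(i := 0)) S) * h S) =
      (\<Sum>S\<in>subs n k. (real (card A) - real k) * prod W S * h S)"
    by (intro sum.cong) simp_all
  then show ?thesis
    by (subst sum.swap) (simp add: sum_distrib_right sum_distrib_left mult.assoc)
qed

text \<open>
  Averaging over all one-element deletions preserves the ratio of numerator and denominator, so
  some deletion does not increase it.
\<close>

lemma exists_deletable:
  assumes A: "A \<subseteq> {..<n}" and W: "\<And>i. i < n \<Longrightarrow> i \<notin> A \<Longrightarrow> W i = 0"
    and W0: "\<And>i. i < n \<Longrightarrow> 0 \<le> W i" and k: "0 < k" "k < card A"
    and pos: "0 < esym n d v W k" "0 \<le> p" "0 < q" and le: "enum n d v W k * q \<le> p * esym n d v W k"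
  obtains i where "i \<in> A" "0 < esym n d v (W(i := 0)) k"
    "enum n d v (W(i := 0)) k * q \<le> p * esym n d v (W(i := 0)) k"
proof (rule ccontr)
  note obt = that
  assume "\<not> thesis"
  then have no: "\<not> enum n d v (W(i := 0)) k * q \<le> p * esym n d v (W(i := 0)) k"
    if "i \<in> A" "0 < esym n d v (W(i := 0)) k" for i
    using obt[OF that] by blast
  let ?e = "\<lambda>i. esym n d v (W(i := 0)) k" and ?f = "\<lambda>i. enum n d v (W(i := 0)) k"
  have fA: "finite A"
    using A finite_subset by blast
  have e: "(\<Sum>i\<in>A. ?e i) = (real (card A) - real k) * esym n d v W k"
    unfolding esym_def by (rule sum_delete_subs[OF A W])
  have f: "(\<Sum>i\<in>A. ?f i) = (real (card A) - real k) * enum n d v W k"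
    unfolding enum_eq[OF k(1)] by (rule sum_delete_subs[OF A W])
  have e0: "0 \<le> ?e i" for i
    by (rule esym_nonneg) (use W0 in auto)
  have f0: "0 \<le> ?f i" for i
    by (rule enum_nonneg) (use W0 in auto)
  have le1: "p * ?e i - ?f i * q \<le> 0" if "i \<in> A" for i
  proof (cases "0 < ?e i")
    case True
    then show ?thesis
      using no[OF that True] by simp
  next
    case False
    then have "?e i = 0"
      using e0[of i] by simp
    then show ?thesis
      using f0[of i] pos(3) by simp
  qed
  \<comment> \<open>As k is below \<open>card A\<close>, some deletion keeps a positive denominator.
    It contributes a strictly negative term, whereas deletions with zero denominator contribute at
    most zero.\<close>
  have "(\<Sum>i\<in>A. ?e i) > 0"
    unfolding e using k(2) pos(1) by simp
  then have "\<not> (\<forall>j\<in>A. ?e j \<le> 0)"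
    using sum_nonpos[of A ?e] by auto
  then obtain j where j: "j \<in> A" "0 < ?e j"
    by auto
  then have lt: "p * ?e j - ?f j * q < 0"
    using no[OF j] by simp
  have "(\<Sum>i\<in>A. p * ?e i - ?f i * q) < (\<Sum>i\<in>A. 0)"
    by (rule sum_strict_mono_ex1[OF fA]) (use le1 lt j in auto)
  moreover have "(\<Sum>i\<in>A. p * ?e i - ?f i * q) = (real (card A) - real k) * (p * esym n d v W k - enum n d v W k * q)"
    unfolding sum_subtractf sum_distrib_left[symmetric] sum_distrib_right[symmetric] e f
    by (simp add: algebra_simps)
  moreover have "0 \<le> (real (card A) - real k) * (p * esym n d v W k - enum n d v W k * q)"
    using k(2) le by simp
  ultimately show False
    by simp
qed

text \<open>Projecting away one further unit direction x costs the weighted trace \<Sum> W i <v_i,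
  x>^2, which is at most \<open>L\<close>. A zero pivot costs nothing, which is where
  \<open>L\<close> must be nonnegative.\<close>

lemma schurS_trace_ge:
  assumes L: "\<And>x. (\<Sum>i<n. W i * (ip d (v i) x)\<^sup>2) \<le> L * ip d x x" and L0: "0 \<le> L" and S: "finite S"
  shows "(\<Sum>i<n. W i * ip d (v i) (v i)) - real (card S) * L \<le> (\<Sum>i<n. W i * schurS d v S i i)"
  using S
proof (induction S rule: finite_induct)
  case empty
  then show ?case
    by (simp add: schurS_empty)
next
  case (insert j S)
  let ?B = "schurS d v S"
  have "(\<Sum>i<n. W i * (?B i j * ?B j i / ?B j j)) \<le> L"
  proof (cases "?B j j = 0")
    case False
    then have pos: "0 < ?B j j"
      using schurS_nonneg[of d v S j] by simp
    have "W i * (?B i j * ?B j i / ?B j j) =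
        W i * (ip d (v i) (resS d v S j))\<^sup>2 / ?B j j" for i
      unfolding ip_resS schurS_commute[of d v S j i] power2_eq_square by simp
    then have "(\<Sum>i<n. W i * (?B i j * ?B j i / ?B j j)) =
        (\<Sum>i<n. W i * (ip d (v i) (resS d v S j))\<^sup>2) / ?B j j"
      unfolding sum_divide_distrib by (simp only:)
    also have "\<dots> \<le> L * ?B j j / ?B j j"
      using L[of "resS d v S j"] pos by (intro divide_right_mono) (simp_all add: schurS_res)
    finally show ?thesis
      using pos by simp
  qed (simp add: L0)
  then show ?case
    using insert by (simp add: schurS_insert right_diff_distrib sum_subtractf distrib_right)
qed

lemma esym_Suc_ge:
  assumes L: "\<And>x. (\<Sum>i<n. W i * (ip d (v i) x)\<^sup>2) \<le> L * ip d x x" and L0: "0 \<le> L"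
    and W: "\<And>i. i < n \<Longrightarrow> 0 \<le> W i"
  shows "((\<Sum>i<n. W i * ip d (v i) (v i)) - real k * L) * esym n d v W k \<le> real (Suc k) * esym n d v W (Suc k)"
proof -
  let ?t = "(\<Sum>i<n. W i * ip d (v i) (v i)) - real k * L"
  have "?t * esym n d v W k = (\<Sum>S\<in>subs n k. prod W S * gramS d v S * ?t)"
    unfolding esym_def sum_distrib_left by (simp add: mult_ac)
  also have "\<dots> \<le> (\<Sum>S\<in>subs n k. prod W S * gramS d v S * (\<Sum>i<n. W i * schurS d v S i i))"
  proof (intro sum_mono mult_left_mono)
    fix S assume S: "S \<in> subs n k"
    then show "?t \<le> (\<Sum>i<n. W i * schurS d v S i i)"
      using schurS_trace_ge[OF L L0 subs_finite[OF S]] by (simp add: subs_def)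
    show "0 \<le> prod W S * gramS d v S"
      using S W by (auto intro!: mult_nonneg_nonneg prod_nonneg gramS_nonneg simp: subs_def)
  qed
  also have "\<dots> = real (Suc k) * esym n d v W (Suc k)"
    unfolding esym_Suc ekernel_def sum_distrib_left by (subst sum.swap) (simp add: mult_ac)
  finally show ?thesis .
qed

section \<open>The division-free Faddeev--LeVerrier recursion\<close>

text \<open>
  For \<open>A = wgram d v W\<close> the matrix \<open>flv n A j\<close> is \<open>j!\<close> times the \<open>j\<close>-th coefficient of the adjugate
  of \<open>x 1 + A\<close>; the factor \<open>j!\<close> absorbs the division by \<open>j\<close> of the usual recursion.
\<close>

fun flv :: "nat \<Rightarrow> (nat \<Rightarrow> nat \<Rightarrow> real) \<Rightarrow> nat \<Rightarrow> nat \<Rightarrow> nat \<Rightarrow> real" where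
  "flv n A 0 a b = (if a = b then 1 else 0)"
| "flv n A (Suc j) a b = (if a = b then \<Sum>i<n. \<Sum>l<n. A i l * flv n A j l i else 0)
     - real (Suc j) * (\<Sum>l<n. A a l * flv n A j l b)"

abbreviation wgram :: "nat \<Rightarrow> (nat \<Rightarrow> nat \<Rightarrow> real) \<Rightarrow> (nat \<Rightarrow> real) \<Rightarrow> nat \<Rightarrow> nat \<Rightarrow> real" where
  "wgram d v W \<equiv> \<lambda>a b. W a * ip d (v a) (v b)"

text \<open>The induction is stated for the product with the matrix because both terms of the
  recursion use only that product: its trace is evaluated by \<open>esym_Suc\<close>, and one more
  multiplication is \<open>ekernel_Suc\<close>.\<close>

lemma flv_mult:
  assumes "b < n"
  shows "(\<Sum>l<n. wgram d v W a l * flv n (wgram d v W) j l b) = fact j * (W a * ekernel n d v W j a b)"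
  using assms
proof (induction j arbitrary: a b)
  case 0
  then show ?case
    by (simp add: ekernel_0 if_distrib sum.delta cong: if_cong)
next
  case (Suc j)
  let ?A = "wgram d v W"
  have "(\<Sum>i<n. \<Sum>l<n. ?A i l * flv n ?A j l i) = (\<Sum>i<n. fact j * (W i * ekernel n d v W j i i))"
    by (intro sum.cong refl Suc.IH) simp
  then have tr: "(\<Sum>i<n. \<Sum>l<n. ?A i l * flv n ?A j l i) = fact (Suc j) * esym n d v W (Suc j)"
    using esym_Suc[of j n d v W] by (simp add: sum_distrib_left[symmetric] mult_ac)
  have fl: "flv n ?A (Suc j) l b = fact (Suc j) * ((if l = b then esym n d v W (Suc j) else 0) - W l * ekernel n d v W j l b)" for l
    unfolding flv.simps tr Suc.IH[OF Suc.prems] by (simp add: algebra_simps)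
  have "(\<Sum>l<n. ?A a l * flv n ?A (Suc j) l b) =
     (\<Sum>l<n. (if l = b then fact (Suc j) * (?A a l * esym n d v W (Suc j)) else 0)) -
     (\<Sum>l<n. fact (Suc j) * (?A a l * (W l * ekernel n d v W j l b)))"
    unfolding fl sum_subtractf[symmetric]
    by (intro sum.cong refl) (auto simp: algebra_simps simp del: fact_Suc)
  also have "(\<Sum>l<n. (if l = b then fact (Suc j) * (?A a l * esym n d v W (Suc j)) else 0))
      = fact (Suc j) * (?A a b * esym n d v W (Suc j))"
    using Suc.prems by (subst sum.delta) auto
  also have "\<dots> - (\<Sum>l<n. fact (Suc j) * (?A a l * (W l * ekernel n d v W j l b)))
      = fact (Suc j) * (W a * ekernel n d v W (Suc j) a b)"
    unfolding ekernel_Suc by (simp only: right_diff_distrib sum_distrib_left mult_ac)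
  finally show ?case .
qed

lemma flv_trace:
  "(\<Sum>i<n. \<Sum>l<n. wgram d v W i l * flv n (wgram d v W) j l i) = fact (Suc j) * esym n d v W (Suc j)"
proof -
  have "(\<Sum>i<n. \<Sum>l<n. wgram d v W i l * flv n (wgram d v W) j l i) = (\<Sum>i<n. fact j * (W i * ekernel n d v W j i i))"
    by (intro sum.cong refl flv_mult) simp
  then show ?thesis
    using esym_Suc[of j n d v W] by (simp add: sum_distrib_left[symmetric] mult_ac)
qed

text \<open>Diagonal entries of an adjugate are principal minors, that is, the quantities with
  vector i removed. One run of the recursion thus gives all terms of the numerator
  \<open>enum\<close>.\<close>

lemma flv_diag:
  assumes "i < n"
  shows "flv n (wgram d v W) j i i = fact j * esym n d v (W(i := 0)) j"
proof (cases j)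
  case 0
  then show ?thesis
    by (simp add: esym_0)
next
  case (Suc m)
  show ?thesis
    unfolding Suc flv.simps flv_trace flv_mult[OF assms]
    using esym_delete[OF assms, of d v W m] by (simp add: algebra_simps)
qed

lemma flv_enum:
  "(\<Sum>i<n. W i * flv n (wgram d v W) (k - 1) i i) = fact (k - 1) * enum n d v W k"
  by (simp add: flv_diag enum_def sum_distrib_left mult_ac)

section \<open>Characteristic polynomials\<close>

text \<open>The matrix determinant lemma, with \<open>z\<close> in the role of the adjugate of
  \<open>B\<close> applied to \<open>u\<close> so that no inverse occurs. The bordered matrix
  \<open>X\<close> is reduced in two ways by unit-triangular factors.\<close>

lemma det_rank_one_update:
  fixes B :: "real mat"
  assumes B: "B \<in> carrier_mat d d" and u: "u \<in> carrier_vec d" and z: "z \<in> carrier_vec d"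
    and Bz: "B *\<^sub>v z = det B \<cdot>\<^sub>v u" and p: "det B \<noteq> 0"
  shows "det (mat d d (\<lambda>(a, b). B $$ (a, b) + t * (u $ a * u $ b))) = det B + t * (\<Sum>a<d. u $ a * z $ a)"
proof -
  let ?I = "(1\<^sub>m 1)"
  let ?O = "(0\<^sub>m 1 d)"
  let ?F = "four_block_mat (1\<^sub>m d)"
  define U where "U = mat d 1 (\<lambda>(a, b). t * u $ a)"
  define R where "R = mat 1 d (\<lambda>(a, b). u $ b)"
  define Z where "Z = mat d 1 (\<lambda>(a, b). t / det B * z $ a)"
  define B' where "B' = mat d d (\<lambda>(a, b). B $$ (a, b) + t * (u $ a * u $ b))"
  define X where "X = four_block_mat B (- U) R ?I"
  have c: "U \<in> carrier_mat d 1" "R \<in> carrier_mat 1 d" "Z \<in> carrier_mat d 1" "B' \<in> carrier_mat d d"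
    by (auto simp: U_def R_def Z_def B'_def)
  have cX: "X \<in> carrier_mat (d + 1) (d + 1)"
    unfolding X_def by (rule four_block_carrier_mat) (use B in auto)
  have unit: "?F Y ?O ?I \<in> carrier_mat (d + 1) (d + 1)"
      "det (?F Y ?O ?I) = 1" if "Y \<in> carrier_mat d 1" for Y :: "real mat"
    subgoal by (rule four_block_carrier_mat) auto
    subgoal using det_four_block_mat_lower_left_zero[OF one_carrier_mat that refl one_carrier_mat] by simp
    done
  have Bza: "(\<Sum>b<d. B $$ (a, b) * z $ b) = det B * u $ a" if "a < d" for a
  proof -
    have "(B *\<^sub>v z) $ a = (\<Sum>b<d. B $$ (a, b) * z $ b)"
      using that B z by (simp add: scalar_prod_def lessThan_atLeast0)
    then show ?thesis
      unfolding Bz using that u by simp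
  qed
  \<comment> \<open>From the left, the border row removes the border column and adds the rank-one
    term to \<open>B\<close>.\<close>
  have "?F U ?O ?I * X =
      four_block_mat (1\<^sub>m d * B + U * R) (1\<^sub>m d * (- U) + U * 1\<^sub>m 1) (0\<^sub>m 1 d * B + 1\<^sub>m 1 * R) (0\<^sub>m 1 d * (- U) + 1\<^sub>m 1 * 1\<^sub>m 1)"
    unfolding X_def by (rule mult_four_block_mat) (use c B in auto)
  also have "1\<^sub>m d * B + U * R = B'"
    by (rule eq_matI) (use B in \<open>auto simp: U_def R_def B'_def scalar_prod_def\<close>)
  also have "1\<^sub>m d * (- U) + U * 1\<^sub>m 1 = 0\<^sub>m d 1"
    by (rule eq_matI) (auto simp: U_def scalar_prod_def)
  also have "0\<^sub>m 1 d * B + 1\<^sub>m 1 * R = R"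
    using B c by simp
  also have "0\<^sub>m 1 d * (- U) + 1\<^sub>m 1 * 1\<^sub>m 1 = (1\<^sub>m 1 :: real mat)"
    by (rule eq_matI) (use c in \<open>auto simp: scalar_prod_def\<close>)
  finally have "det (?F U ?O ?I * X) = det (four_block_mat B' (0\<^sub>m d 1) R ?I)"
    by simp
  moreover have "det (?F U ?O ?I * X) = det X"
    unfolding det_mult[OF unit(1)[OF c(1)] cX] unit(2)[OF c(1)] by simp
  moreover have "det (four_block_mat B' (0\<^sub>m d 1) R ?I) = det B'"
    using c by (simp add: det_four_block_mat_upper_right_zero[of _ d _ 1])
  ultimately have 1: "det X = det B'"
    by simp
  define q where "q = mat 1 1 (\<lambda>(a, b). 1 + t / det B * (\<Sum>a<d. u $ a * z $ a))"
  have cq: "q \<in> carrier_mat 1 1"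
    by (simp add: q_def)
  \<comment> \<open>From the right, the scaled solution \<open>z\<close> removes the border column
    and leaves the scalar \<open>q\<close> in the corner.\<close>
  have "X * ?F Z ?O ?I =
      four_block_mat (B * 1\<^sub>m d + (- U) * 0\<^sub>m 1 d) (B * Z + (- U) * 1\<^sub>m 1) (R * 1\<^sub>m d + 1\<^sub>m 1 * 0\<^sub>m 1 d) (R * Z + 1\<^sub>m 1 * 1\<^sub>m 1)"
    unfolding X_def by (rule mult_four_block_mat) (use c B in auto)
  also have "B * 1\<^sub>m d + (- U) * 0\<^sub>m 1 d = B"
    using B c by simp
  also have "B * Z + (- U) * 1\<^sub>m 1 = 0\<^sub>m d 1"
  proof (rule eq_matI)
    fix a b assume ab: "a < dim_row (0\<^sub>m d 1 :: real mat)" "b < dim_col (0\<^sub>m d 1 :: real mat)"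
    have "(\<Sum>i = 0..<d. B $$ (a, i) * (t / det B * z $ i)) = t / det B * (\<Sum>i<d. B $$ (a, i) * z $ i)"
      unfolding sum_distrib_left lessThan_atLeast0 by (intro sum.cong) auto
    also have "\<dots> = t * u $ a"
      using Bza[of a] ab p by simp
    finally show "(B * Z + (- U) * 1\<^sub>m 1) $$ (a, b) = 0\<^sub>m d 1 $$ (a, b)"
      using ab B by (simp add: Z_def U_def scalar_prod_def)
  qed (use B c in auto)
  also have "R * 1\<^sub>m d + 1\<^sub>m 1 * 0\<^sub>m 1 d = R"
    using c by simp
  also have "R * Z + 1\<^sub>m 1 * 1\<^sub>m 1 = q"
  proof (rule eq_matI)
    fix a b assume ab: "a < dim_row q" "b < dim_col q"
    have "(\<Sum>i = 0..<d. u $ i * (t / det B * z $ i)) = t / det B * (\<Sum>i<d. u $ i * z $ i)"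
      unfolding sum_distrib_left lessThan_atLeast0 by (intro sum.cong) auto
    then show "(R * Z + 1\<^sub>m 1 * 1\<^sub>m 1) $$ (a, b) = q $$ (a, b)"
      using ab by (simp add: R_def Z_def q_def scalar_prod_def)
  qed (use cq c in auto)
  finally have "det (X * ?F Z ?O ?I) = det (four_block_mat B (0\<^sub>m d 1) R q)"
    by simp
  moreover have "det (X * ?F Z ?O ?I) = det X"
    unfolding det_mult[OF cX unit(1)[OF c(3)]] unit(2)[OF c(3)] by simp
  moreover have "det (four_block_mat B (0\<^sub>m d 1) R q) = det B * det q"
    using c B cq by (simp add: det_four_block_mat_upper_right_zero[of _ d _ 1])
  moreover have "det q = 1 + t / det B * (\<Sum>a<d. u $ a * z $ a)"
    by (subst det_single) (simp_all add: q_def)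
  ultimately have "det X = det B + t * (\<Sum>a<d. u $ a * z $ a)"
    using p by (simp add: distrib_left)
  then show ?thesis
    using 1 by (simp add: B'_def)
qed

lemma subs_empty:
  assumes "n < k"
  shows "subs n k = {}"
proof -
  have "card S \<le> n" if "S \<subseteq> {..<n}" for S
    using card_mono[OF finite_lessThan that] by simp
  then show ?thesis
    using assms by (auto simp: subs_def not_le[symmetric])
qed

definition id_plus :: "nat \<Rightarrow> nat \<Rightarrow> (nat \<Rightarrow> nat \<Rightarrow> real) \<Rightarrow> (nat \<Rightarrow> real) \<Rightarrow> real \<Rightarrow> real mat" where
  "id_plus n d v W t = mat d d (\<lambda>(a, b). (if a = b then 1 else 0) + t * (\<Sum>i<n. W i * (v i a * v i b)))"

text \<open>By \<open>eres_Suc\<close> multiplication with M turns coefficient j into e_{j+1} v_b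
  minus coefficient j + 1, so the sum telescopes. It closes at n because there is no subset of size
  n + 1.\<close>

lemma id_plus_resolvent:
  assumes x: "x < d"
  shows "(\<Sum>y<d. id_plus n d v W t $$ (x, y) * (\<Sum>j\<le>n. t ^ j * eres n d v W j b y)) =
    (\<Sum>j\<le>n. t ^ j * esym n d v W j) * v b x"
proof -
  define z where "z j = eres n d v W j b" for j
  define e where "e = esym n d v W"
  have Mz: "(\<Sum>y<d. (\<Sum>i<n. W i * (v i x * v i y)) * z j y) = e (Suc j) * v b x - z (Suc j) x" for j
  proof -
    have "(\<Sum>y<d. (\<Sum>i<n. W i * (v i x * v i y)) * z j y) = (\<Sum>i<n. W i * v i x * ip d (v i) (z j))"
      unfolding ip_def sum_distrib_left sum_distrib_right by (subst sum.swap) (simp add: mult_ac)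
    then show ?thesis
      unfolding z_def ip_eres eres_Suc e_def by simp
  qed
  have z0: "z 0 x = e 0 * v b x"
    by (simp add: z_def e_def eres_0 esym_0)
  have zn: "z (Suc n) x = 0" "e (Suc n) = 0"
    by (simp_all add: z_def e_def eres_def esym_def subs_empty)
  have expand: "(r + t * s) * (\<Sum>j\<le>n. t ^ j * z j y) =
      r * (\<Sum>j\<le>n. t ^ j * z j y) + (\<Sum>j\<le>n. t ^ Suc j * (s * z j y))" for r s y
    unfolding sum_distrib_left sum.distrib[symmetric] by (intro sum.cong) (simp_all add: algebra_simps)
  have "(\<Sum>y<d. id_plus n d v W t $$ (x, y) * (\<Sum>j\<le>n. t ^ j * z j y)) =
     (\<Sum>y<d. if x = y then (\<Sum>j\<le>n. t ^ j * z j y) else 0) +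
     (\<Sum>y<d. \<Sum>j\<le>n. t ^ Suc j * ((\<Sum>i<n. W i * (v i x * v i y)) * z j y))"
    unfolding sum.distrib[symmetric] using x
    by (intro sum.cong refl) (simp add: id_plus_def expand del: power_Suc)
  also have "(\<Sum>y<d. if x = y then (\<Sum>j\<le>n. t ^ j * z j y) else 0) = (\<Sum>j\<le>n. t ^ j * z j x)"
    using x by (subst sum.delta') auto
  also have "(\<Sum>y<d. \<Sum>j\<le>n. t ^ Suc j * ((\<Sum>i<n. W i * (v i x * v i y)) * z j y)) =
     (\<Sum>j\<le>n. t ^ Suc j * (e (Suc j) * v b x - z (Suc j) x))"
    by (subst sum.swap) (simp only: sum_distrib_left[symmetric] Mz)
  also have "(\<Sum>j\<le>n. t ^ j * z j x) + \<dots> = (\<Sum>j\<le>n. t ^ j * z j x) - (\<Sum>j\<le>n. t ^ Suc j * z (Suc j) x)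
      + (\<Sum>j\<le>n. t ^ Suc j * (e (Suc j) * v b x))"
    unfolding right_diff_distrib sum_subtractf by simp
  also have "(\<Sum>j\<le>n. t ^ j * z j x) - (\<Sum>j\<le>n. t ^ Suc j * z (Suc j) x) = z 0 x"
    using sum_telescope[of "\<lambda>j. t ^ j * z j x" n] unfolding sum_subtractf zn by (simp del: power_Suc)
  also have "z 0 x + (\<Sum>j\<le>n. t ^ Suc j * (e (Suc j) * v b x)) = (\<Sum>j\<le>Suc n. t ^ j * (e j * v b x))"
    unfolding sum.atMost_Suc_shift z0 by (simp del: power_Suc)
  also have "\<dots> = (\<Sum>j\<le>n. t ^ j * e j) * v b x"
    unfolding sum_distrib_right by (simp add: zn(2) mult.assoc)
  finally show ?thesis
    unfolding z_def e_def .
qed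

text \<open>The vectors enter one at a time, by induction on a bound for the support of
  \<open>W\<close>. Nonnegative weights and t keep every intermediate determinant at least 1, so the
  rank-one update applies.\<close>

lemma det_id_plus:
  assumes W: "\<And>i. i < n \<Longrightarrow> 0 \<le> W i" and t: "0 \<le> t"
  shows "det (id_plus n d v W t) = (\<Sum>j\<le>n. t ^ j * esym n d v W j)"
proof -
  let ?e = "esym n d v"
  have "m \<le> n \<Longrightarrow> (\<And>i. i < n \<Longrightarrow> 0 \<le> W i) \<Longrightarrow> (\<And>i. m \<le> i \<Longrightarrow> i < n \<Longrightarrow> W i = 0) \<Longrightarrow>
    det (id_plus n d v W t) = (\<Sum>j\<le>n. t ^ j * ?e W j)" for m
  proof (induction m arbitrary: W)
    case 0
    then have "id_plus n d v W t = 1\<^sub>m d"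
      by (intro eq_matI) (auto simp: id_plus_def)
    moreover have e: "t ^ j * ?e W j = (if j = 0 then 1 else 0)" for j
    proof (cases j)
      case (Suc i)
      have "prod W S = 0" if "S \<in> subs n j" for S
      proof -
        have "S \<noteq> {}" "S \<subseteq> {..<n}"
          using that Suc by (auto simp: subs_def)
        then show ?thesis
          using 0 that by (intro prod_zero) (auto simp: subs_finite)
      qed
      then show ?thesis
        using Suc by (simp add: esym_def)
    qed (simp add: esym_0)
    ultimately show ?case
      by (simp only: e) simp
  next
    case (Suc m)
    define W' where "W' = W(m := 0)"
    define B where "B = id_plus n d v W' t"
    have m: "m < n"
      using Suc.prems by simp
    have W': "0 \<le> W' i" "m \<le> i \<Longrightarrow> W' i = 0" if "i < n" for i
      using Suc.prems that by (auto simp: W'_def)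
    have detB: "det B = (\<Sum>j\<le>n. t ^ j * ?e W' j)"
      unfolding B_def by (rule Suc.IH) (use m W' in auto)
    have "1 \<le> (\<Sum>j\<le>n. t ^ j * ?e W' j)"
    proof -
      have "t ^ 0 * ?e W' 0 \<le> (\<Sum>j\<le>n. t ^ j * ?e W' j)"
        by (rule member_le_sum) (use t W' in \<open>auto intro!: mult_nonneg_nonneg esym_nonneg\<close>)
      then show ?thesis
        by (simp add: esym_0)
    qed
    then have p0: "det B \<noteq> 0"
      using detB by simp
    have cB: "B \<in> carrier_mat d d"
      by (simp add: B_def id_plus_def)
    define z where "z = vec d (\<lambda>y. \<Sum>j\<le>n. t ^ j * eres n d v W' j m y)"
    define u where "u = vec d (v m)"
    have "B *\<^sub>v z = det B \<cdot>\<^sub>v u"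
    proof (rule eq_vecI)
      fix x assume "x < dim_vec (det B \<cdot>\<^sub>v u)"
      then have x: "x < d"
        by (simp add: u_def)
      then have "(B *\<^sub>v z) $ x = (\<Sum>y<d. B $$ (x, y) * (\<Sum>j\<le>n. t ^ j * eres n d v W' j m y))"
        using cB by (simp add: z_def scalar_prod_def lessThan_atLeast0)
      then show "(B *\<^sub>v z) $ x = (det B \<cdot>\<^sub>v u) $ x"
        unfolding B_def id_plus_resolvent[OF x] unfolding B_def[symmetric] detB using x by (simp add: u_def)
    qed (use cB in \<open>auto simp: u_def\<close>)
    then have "det (mat d d (\<lambda>(a, b). B $$ (a, b) + t * W m * (u $ a * u $ b))) =
        det B + t * W m * (\<Sum>a<d. u $ a * z $ a)"
      by (intro det_rank_one_update) (use cB p0 in \<open>auto simp: u_def z_def\<close>)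
    moreover have "mat d d (\<lambda>(a, b). B $$ (a, b) + t * W m * (u $ a * u $ b)) = id_plus n d v W t"
    proof (rule eq_matI)
      fix a b assume ab: "a < dim_row (id_plus n d v W t)" "b < dim_col (id_plus n d v W t)"
      have "(\<Sum>i<n. W i * (v i a * v i b)) = (\<Sum>i<n. W' i * (v i a * v i b)) + W m * (v m a * v m b)"
      proof -
        have "(\<Sum>i<n. W i * (v i a * v i b)) =
           (\<Sum>i<n. W' i * (v i a * v i b) + (if i = m then W m * (v m a * v m b) else 0))"
          by (intro sum.cong) (auto simp: W'_def)
        then show ?thesis
          using m by (simp add: sum.distrib)
      qed
      then show "mat d d (\<lambda>(a, b). B $$ (a, b) + t * W m * (u $ a * u $ b)) $$ (a, b) = id_plus n d v W t $$ (a, b)"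
        using ab by (simp add: B_def id_plus_def u_def algebra_simps)
    qed (auto simp: id_plus_def)
    \<comment> \<open>The kernel comes from the reduced weights \<open>W'\<close>, but its entry (m,
      m) does not see the weight of m, so \<open>W\<close> may replace them.\<close>
    moreover have "(\<Sum>a<d. u $ a * z $ a) = (\<Sum>j\<le>n. t ^ j * ekernel n d v W j m m)"
    proof -
      have "(\<Sum>a<d. u $ a * z $ a) = (\<Sum>j\<le>n. t ^ j * ip d (v m) (eres n d v W' j m))"
        unfolding ip_def sum_distrib_left by (subst sum.swap) (simp add: u_def z_def sum_distrib_left mult_ac)
      then show ?thesis
        by (simp add: ip_eres W'_def ekernel_delete[OF m])
    qed
    ultimately have "det (id_plus n d v W t) =
        (\<Sum>j\<le>n. t ^ j * ?e W' j) + (\<Sum>j\<le>n. t ^ Suc j * (W m * ekernel n d v W j m m))"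
      by (simp add: detB sum_distrib_left mult_ac)
    also have "(\<Sum>j\<le>n. t ^ Suc j * (W m * ekernel n d v W j m m)) =
        (\<Sum>j\<le>n. t ^ Suc j * ?e W (Suc j)) - (\<Sum>j\<le>n. t ^ Suc j * ?e W' (Suc j))"
      unfolding sum_subtractf[symmetric] W'_def esym_delete[OF m, of d v W]
      by (intro sum.cong) (simp_all add: algebra_simps)
    also have "(\<Sum>j\<le>n. t ^ Suc j * ?e W' (Suc j)) = (\<Sum>j\<le>n. t ^ j * ?e W' j) - 1"
      using sum.atMost_Suc_shift[of "\<lambda>j. t ^ j * ?e W' j" n]
      by (simp add: esym_0 esym_def[of n d v W' "Suc n"] subs_empty)
    also have "(\<Sum>j\<le>n. t ^ Suc j * ?e W (Suc j)) = (\<Sum>j\<le>n. t ^ j * ?e W j) - 1"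
      using sum.atMost_Suc_shift[of "\<lambda>j. t ^ j * ?e W j" n]
      by (simp add: esym_0 esym_def[of n d v W "Suc n"] subs_empty)
    finally show ?case
      by simp
  qed
  from this[of n] show ?thesis
    using W by auto
qed

section \<open>The spectrum of a sum of rank-one matrices\<close>

text \<open>The characteristic polynomial factors over the complex numbers, and positive
  semidefiniteness forces each root to be a nonnegative real.\<close>

lemma char_poly_outer_sum_splits:
  fixes v :: "nat \<Rightarrow> real vec"
  assumes S: "finite S" and A: "A = outer_sum d S (\<lambda>_. 1) v"
  obtains ls where "char_poly A = (\<Prod>l\<leftarrow>ls. [:- l, 1:])" "length ls = d" "\<And>l. l \<in> set ls \<Longrightarrow> 0 \<le> l"
proof -
  interpret hp: map_poly_inj_comm_ring_hom "of_real :: real \<Rightarrow> complex" ..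
  have cA: "A \<in> carrier_mat d d"
    by (simp add: A outer_sum_def)
  let ?A = "map_mat complex_of_real A"
  have cA': "?A \<in> carrier_mat d d"
    using cA by simp
  obtain as where as: "char_poly ?A = (\<Prod>a\<leftarrow>as. [:- a, 1:])" "length as = d"
    using char_poly_factorized[OF cA'] by blast
  have real: "\<exists>l. 0 \<le> l \<and> a = complex_of_real l" if "a \<in> set as" for a
  proof -
    have "poly (char_poly ?A) a = 0"
      unfolding as(1) by (rule linear_poly_root[OF that])
    then obtain z where z: "z \<in> carrier_vec d" "z \<noteq> 0\<^sub>v d" "?A *\<^sub>v z = a \<cdot>\<^sub>v z"
      using eigenvalue_root_char_poly[OF cA'] cA' by (auto simp: eigenvalue_def eigenvector_def)
    define y where "y i = (\<Sum>b<d. complex_of_real (v i $ b) * z $ b)" for i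
    have Az: "(?A *\<^sub>v z) $ x = (\<Sum>i\<in>S. complex_of_real (v i $ x) * y i)" if x: "x < d" for x
    proof -
      have "(?A *\<^sub>v z) $ x = (\<Sum>b<d. \<Sum>i\<in>S. complex_of_real (v i $ x) * (complex_of_real (v i $ b) * z $ b))"
        using x z(1) by (simp add: A outer_sum_def scalar_prod_def lessThan_atLeast0 sum_distrib_right mult.assoc)
      then show ?thesis
        unfolding y_def sum_distrib_left by (subst (asm) sum.swap)
    qed
  let ?z = "(\<Sum>x<d. (cmod (z $ x))\<^sup>2)"
  let ?y = "(\<Sum>i\<in>S. (cmod (y i))\<^sup>2)"
    \<comment> \<open>The Rayleigh quotient: pairing the eigenvector equation with z gives a |z|^2 =
      \<Sum> |<v_i, z>|^2.\<close>
    have "a * complex_of_real ?z = (\<Sum>x<d. cnj (z $ x) * (a \<cdot>\<^sub>v z) $ x)"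
      using z(1) by (simp add: sum_distrib_left complex_norm_square mult_ac del: of_real_power)
    also have "\<dots> = (\<Sum>x<d. \<Sum>i\<in>S. cnj (complex_of_real (v i $ x) * z $ x) * y i)"
      unfolding z(3)[symmetric] by (intro sum.cong refl) (simp add: Az sum_distrib_left mult_ac del: index_mult_mat_vec)
    also have "\<dots> = (\<Sum>i\<in>S. cnj (y i) * y i)"
      by (subst sum.swap) (simp add: y_def sum_distrib_right)
    also have "\<dots> = complex_of_real ?y"
      by (simp add: complex_norm_square mult_ac del: of_real_power)
    finally have eq: "a * complex_of_real ?z = complex_of_real ?y" .
    obtain x where x: "x < d" "z $ x \<noteq> 0"
    proof (rule ccontr)
      assume "\<not> thesis"
      then have "z = 0\<^sub>v d"
        using z(1) that by (intro eq_vecI) auto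
      then show False
        using z(2) by simp
    qed
    have "(cmod (z $ x))\<^sup>2 \<le> ?z"
      by (rule member_le_sum) (use x in auto)
    moreover have "0 < (cmod (z $ x))\<^sup>2"
      using x by simp
    ultimately have pos: "0 < ?z"
      by linarith
    then have "a = complex_of_real (?y / ?z)"
      using eq unfolding of_real_divide by (simp add: nonzero_eq_divide_eq del: of_real_sum)
    moreover have "0 \<le> ?y / ?z"
      by (intro divide_nonneg_nonneg sum_nonneg) auto
    ultimately show ?thesis
      by blast
  qed
  have asR: "a = complex_of_real (Re a)" "0 \<le> Re a" if "a \<in> set as" for a
    using real[OF that] by auto
  have "map_poly complex_of_real (char_poly A) = char_poly ?A"
    by (rule of_real_hom.char_poly_hom[OF cA, symmetric])
  also have "\<dots> = (\<Prod>a\<leftarrow>as. map_poly complex_of_real [:- Re a, 1:])"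
    unfolding as(1) by (rule arg_cong[of _ _ prod_list], rule map_cong) (use asR(1) in auto)
  also have "\<dots> = map_poly complex_of_real (\<Prod>l\<leftarrow>map Re as. [:- l, 1:])"
    by (simp add: hp.hom_prod_list o_def)
  finally have "char_poly A = (\<Prod>l\<leftarrow>map Re as. [:- l, 1:])"
    by simp
  then show ?thesis
    using that[of "map Re as"] as(2) asR(2) by auto
qed

text \<open>1 + t A is (- t) times (- 1 / t) 1 - A, so its determinant is a rescaled value of the
  characteristic polynomial.\<close>

lemma det_id_plus_char_poly:
  assumes A: "A \<in> carrier_mat d d" and t: "0 < t" and cp: "char_poly A = (\<Prod>l\<leftarrow>ls. [:- l, 1:])" "length ls = d"
  shows "det (mat d d (\<lambda>(a, b). (if a = b then 1 else 0) + t * A $$ (a, b))) = (\<Prod>l\<leftarrow>ls. 1 + t * l :: real)"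
proof -
  let ?M = "mat d d (\<lambda>(a, b). (if a = b then 1 else 0) + t * A $$ (a, b))"
  have "?M = (- t) \<cdot>\<^sub>m (- char_matrix A (- (1 / t)))"
    by (rule eq_matI) (use A t in \<open>auto simp: char_matrix_def algebra_simps\<close>)
  then have "det ?M = (- t) ^ d * poly (char_poly A) (- (1 / t))"
    unfolding char_poly_matrix[OF A] using A by (simp add: char_matrix_def)
  also have "\<dots> = (\<Prod>l\<leftarrow>ls. 1 + t * l)"
  proof -
    have "(- t) ^ length ls * poly (\<Prod>l\<leftarrow>ls. [:- l, 1:]) (- (1 / t)) = (\<Prod>l\<leftarrow>ls. 1 + t * l)"
    proof (induction ls)
      case (Cons l ls)
      have *: "- t * (- (1 / t) - l) = 1 + t * l"
        using t by (simp add: algebra_simps)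
      have "(- t) ^ length (l # ls) * poly (\<Prod>l\<leftarrow>l # ls. [:- l, 1:]) (- (1 / t)) =
          (- t * (- (1 / t) - l)) * ((- t) ^ length ls * poly (\<Prod>l\<leftarrow>ls. [:- l, 1:]) (- (1 / t)))"
        by (simp add: algebra_simps)
      then show ?case
        unfolding * Cons.IH by simp
    qed simp
    then show ?thesis
      unfolding cp by (simp add: cp(2))
  qed
  finally show ?thesis .
qed

text \<open>The quotient of the two leading coefficients is the sum of reciprocals; this is how
  \<Sum> 1 / \<lambda>_i is read off a determinant.\<close>

lemma prod_linear_coeffs:
  assumes "0 \<notin> set ls"
  shows "degree (\<Prod>l\<leftarrow>ls. [:1, l :: real:]) = length ls \<and>
    coeff (\<Prod>l\<leftarrow>ls. [:1, l:]) (length ls) = prod_list ls \<and>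
    (ls \<noteq> [] \<longrightarrow> coeff (\<Prod>l\<leftarrow>ls. [:1, l:]) (length ls - 1) = prod_list ls * (\<Sum>l\<leftarrow>ls. 1 / l))"
  using assms
proof (induction ls)
  case (Cons l ls)
  define q where "q = (\<Prod>l\<leftarrow>ls. [:1, l:])"
  have IH: "degree q = length ls" "coeff q (length ls) = prod_list ls"
    "ls \<noteq> [] \<Longrightarrow> coeff q (length ls - 1) = prod_list ls * (\<Sum>l\<leftarrow>ls. 1 / l)" and l: "l \<noteq> 0" and ls: "0 \<notin> set ls"
    using Cons by (auto simp: q_def)
  have "prod_list ls \<noteq> 0"
    using ls by (simp add: prod_list_zero_iff)
  then have q0: "q \<noteq> 0"
    using IH(2) by auto
  have c: "coeff ([:1, l:] * q) (Suc m) = coeff q (Suc m) + l * coeff q m" for m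
    by simp
  have "degree ([:1, l:] * q) = Suc (length ls)"
    using q0 l IH(1) by (subst degree_mult_eq) auto
  moreover have "coeff ([:1, l:] * q) (Suc (length ls)) = l * prod_list ls"
    unfolding c using IH(1,2) by (simp add: coeff_eq_0)
  moreover have "coeff ([:1, l:] * q) (length ls) = l * prod_list ls * (1 / l + (\<Sum>l\<leftarrow>ls. 1 / l))"
  proof (cases ls)
    case Nil
    then show ?thesis
      using l by (simp add: q_def)
  next
    case (Cons a ls')
    then have "coeff ([:1, l:] * q) (length ls) = prod_list ls + l * (prod_list ls * (\<Sum>l\<leftarrow>ls. 1 / l))"
      using c[of "length ls - 1"] IH by simp
    then show ?thesis
      using l by (simp add: distrib_left)
  qed
  ultimately show ?case
    by (simp add: q_def)
qed simp

lemma sorted_desc_prefix: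
  fixes ev :: "real list"
  assumes "sorted_wrt (\<ge>) ev" "\<And>x. x \<in> set ev \<Longrightarrow> 0 \<le> x"
  shows "take (length (filter (\<lambda>x. x \<noteq> 0) ev)) ev = filter (\<lambda>x. x \<noteq> 0) ev"
  using assms
proof (induction ev)
  case (Cons x ev)
  show ?case
  proof (cases "x = 0")
    case True
    then have "filter (\<lambda>x. x \<noteq> 0) ev = []"
      using Cons.prems by (auto simp: filter_empty_conv intro: antisym)
    then show ?thesis
      using True by simp
  qed (use Cons in simp)
qed simp

text \<open>det(1 + t A) is computed once from Gram determinants and once from the eigenvalues of A.
  With indicator weights of \<open>S\<close> its leading coefficients are
  \<open>gramS d vf S\<close> and the sum of the \<open>gramS d vf (S - {i})\<close>.\<close>

lemma eigvals_desc_outer_sum: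
  fixes v :: "nat \<Rightarrow> real vec"
  assumes S: "S \<subseteq> {..<n}" "card S = k" "0 < k"
    and vf: "\<And>i a. i < n \<Longrightarrow> a < d \<Longrightarrow> vf i a = v i $ a"
    and pos: "0 < gramS d vf S"
  defines "ev \<equiv> eigvals_desc (outer_sum d S (\<lambda>_. 1) v)"
  shows "k \<le> length ev" "\<And>i. i < k \<Longrightarrow> 0 < ev ! i"
    "(\<Sum>i<k. 1 / ev ! i) = (\<Sum>i\<in>S. gramS d vf (S - {i})) / gramS d vf S"
proof -
  let ?g = "(\<Sum>i\<in>S. gramS d vf (S - {i}))"
  have fS: "finite S"
    using S finite_subset by blast
  define A where "A = outer_sum d S (\<lambda>_. 1) v"
  obtain ls where ls: "char_poly A = (\<Prod>l\<leftarrow>ls. [:- l, 1:])" "length ls = d" "\<And>l. l \<in> set ls \<Longrightarrow> 0 \<le> l"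
    using char_poly_outer_sum_splits[OF fS A_def] by metis
  define W where "W i = (if i \<in> S then 1 else 0 :: real)" for i
  have W: "prod W T = (if T \<subseteq> S then 1 else 0)" if "finite T" for T
    using that by (auto simp: W_def intro!: prod_zero prod.neutral)
  define p where "p = (\<Sum>j\<le>n. monom (esym n d vf W j) j)"
  have coeff_p: "coeff p j = esym n d vf W j" for j
  proof (cases "j \<le> n")
    case False
    then show ?thesis
      by (simp add: p_def coeff_sum esym_def subs_empty)
  qed (simp add: p_def coeff_sum)
  have eval: "poly p t = poly (\<Prod>l\<leftarrow>ls. [:1, l:]) t" if t: "0 < t" for t
  proof -
  let ?M = "mat d d (\<lambda>(a, b). (if a = b then 1 else 0) + t * A $$ (a, b))"
    have "id_plus n d vf W t = ?M"
    proof (rule eq_matI)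
      fix a b assume ab: "a < dim_row ?M"
        "b < dim_col ?M"
      have "(\<Sum>i<n. W i * (vf i a * vf i b)) = (\<Sum>i\<in>S. v i $ a * v i $ b)"
        using S(1) ab vf by (intro sum.mono_neutral_cong_right) (auto simp: W_def)
      then show "id_plus n d vf W t $$ (a, b) = ?M $$ (a, b)"
        using ab by (simp add: id_plus_def A_def outer_sum_def)
    qed (auto simp: id_plus_def)
    then have "(\<Sum>j\<le>n. t ^ j * esym n d vf W j) = (\<Prod>l\<leftarrow>ls. 1 + t * l)"
      using det_id_plus[of n W t d vf] det_id_plus_char_poly[OF _ t ls(1,2)] t
      by (simp add: W_def A_def outer_sum_def)
    moreover have "poly (\<Prod>l\<leftarrow>ls. [:1, l:]) t = (\<Prod>l\<leftarrow>ls. 1 + t * l)"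
      by (simp add: poly_prod_list o_def)
    ultimately show ?thesis
      by (simp add: p_def poly_sum poly_monom mult.commute)
  qed
  \<comment> \<open>The two polynomials agree at all positive t, hence everywhere.\<close>
  have "infinite {0::real<..}"
    by (rule infinite_Ioi)
  then have "infinite {t. poly (p - (\<Prod>l\<leftarrow>ls. [:1, l:])) t = 0}"
    by (rule infinite_super[rotated]) (use eval in auto)
  then have "p - (\<Prod>l\<leftarrow>ls. [:1, l:]) = 0"
    using poly_roots_finite by blast
  then have p_eq: "p = (\<Prod>l\<leftarrow>ls. [:1, l:])"
    by simp
  \<comment> \<open>Zero eigenvalues contribute the factor 1. Without them the degree counts the
    eigenvalues, and it equals k because the Gram determinant of \<open>S\<close> is
    positive.\<close>
  define ls' where "ls' = filter (\<lambda>x. x \<noteq> 0) ls"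
  have p_eq': "p = (\<Prod>l\<leftarrow>ls'. [:1, l:])"
  proof -
    have "(\<Prod>l\<leftarrow>ls. [:1, l:]) = (\<Prod>l\<leftarrow>filter (\<lambda>x. x \<noteq> 0) ls. [:1, l:])"
      by (induction ls) (simp_all add: one_pCons[symmetric])
    then show ?thesis
      by (simp add: p_eq ls'_def)
  qed
  have top: "{T \<in> subs n k. T \<subseteq> S} = {S}"
  proof -
    have "T = S" if "T \<subseteq> S" "card T = k" for T
      using card_subset_eq[OF fS that(1)] that S by simp
    then show ?thesis
      using S by (auto simp: subs_def)
  qed
  have esym_S: "esym n d vf W j = (\<Sum>T\<in>{T \<in> subs n j. T \<subseteq> S}. gramS d vf T)" for j
    unfolding esym_def by (intro sum.mono_neutral_cong_right) (auto simp: finite_subs W subs_finite split: if_splits)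
  have ek: "esym n d vf W k = gramS d vf S"
    unfolding esym_S top by simp
  have ek1: "esym n d vf W (k - 1) = ?g"
  proof -
    have "{T \<in> subs n (k - 1). T \<subseteq> S} = (\<lambda>i. S - {i}) ` S"
    proof (intro equalityI subsetI)
      fix T assume T: "T \<in> {T \<in> subs n (k - 1). T \<subseteq> S}"
      then have "card (S - T) = 1"
        using S fS by (auto simp: subs_def card_Diff_subset finite_subset)
      then obtain i where "S - T = {i}"
        by (auto simp: card_1_singleton_iff)
      then show "T \<in> (\<lambda>i. S - {i}) ` S"
        using T by (intro image_eqI[of _ _ i]) auto
    qed (use S fS in \<open>auto simp: subs_def\<close>)
    moreover have "inj_on (\<lambda>i. S - {i}) S"
      by (auto simp: inj_on_def)
    ultimately show ?thesis
      by (simp add: esym_S sum.reindex)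
  qed
  have eg: "esym n d vf W j = 0" if "k < j" for j
  proof -
    have "{T \<in> subs n j. T \<subseteq> S} = {}"
      using that S(2) card_mono[OF fS] by (auto simp: subs_def not_le[symmetric])
    then show ?thesis
      by (simp only: esym_S sum.empty)
  qed
  have "degree p = k"
  proof (rule antisym)
    show "degree p \<le> k"
      by (rule degree_le) (simp add: coeff_p eg)
    show "k \<le> degree p"
      by (rule le_degree) (use pos in \<open>simp add: coeff_p ek\<close>)
  qed
  moreover have ls'0: "0 \<notin> set ls'"
    by (simp add: ls'_def)
  ultimately have len: "length ls' = k"
    using prod_linear_coeffs[of ls'] p_eq' by simp
  have sum': "(\<Sum>l\<leftarrow>ls'. 1 / l) = ?g / gramS d vf S"
  proof -
    have "coeff p k = prod_list ls'" "coeff p (k - 1) = prod_list ls' * (\<Sum>l\<leftarrow>ls'. 1 / l)"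
      using prod_linear_coeffs[OF ls'0] len S(3) unfolding p_eq' by auto
    then show ?thesis
      using pos ls'0 unfolding coeff_p ek ek1 by (simp add: field_simps)
  qed
  have "proots (char_poly A) = mset ls"
  proof -
    have "proots (\<Prod>l\<leftarrow>ls. [:- l, 1:]) = mset ls"
    proof (induction ls)
      case (Cons l ls)
      have "(\<Prod>l\<leftarrow>ls. [:- l, 1:]) \<noteq> 0"
        by (auto simp: prod_list_zero_iff)
      then show ?case
        using Cons.IH by (simp add: proots_mult del: mult_pCons_left)
    qed simp
    then show ?thesis
      by (simp add: ls(1))
  qed
  then have ev: "ev = rev (sort ls)"
    unfolding ev_def A_def[symmetric] eigvals_desc_def by (simp add: sorted_list_of_multiset_mset)
  have "sorted_wrt (\<ge>) ev"
    unfolding ev by (simp add: sorted_wrt_rev)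
  then have "take (length (filter (\<lambda>x. x \<noteq> 0) ev)) ev = filter (\<lambda>x. x \<noteq> 0) ev"
    by (rule sorted_desc_prefix) (use ls(3) in \<open>auto simp: ev\<close>)
  moreover have mf: "mset (filter (\<lambda>x. x \<noteq> 0) ev) = mset ls'"
    by (simp add: ev ls'_def mset_filter)
  moreover have lf: "length (filter (\<lambda>x. x \<noteq> 0) ev) = k"
    using mf len by (metis size_mset)
  ultimately have tk: "take k ev = filter (\<lambda>x. x \<noteq> 0) ev"
    by simp
  then show kl: "k \<le> length ev"
    using lf by (metis length_take min.cobounded1 min_def nat_le_linear)
  show "0 < ev ! i" if "i < k" for i
  proof -
    have "take k ev ! i \<in> set (take k ev)"
      using that kl by (intro nth_mem) simp
    then have "ev ! i \<in> set (filter (\<lambda>x. x \<noteq> 0) ev)"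
      using that unfolding tk[symmetric] by simp
    then show ?thesis
      using ls(3)[of "ev ! i"] by (auto simp: ev)
  qed
  have "(\<Sum>i<k. 1 / ev ! i) = (\<Sum>l\<leftarrow>take k ev. 1 / l)"
    using kl by (simp add: sum_list_sum_nth lessThan_atLeast0)
  also have "\<dots> = (\<Sum>l\<leftarrow>ls'. 1 / l)"
  proof -
    have "sum_mset (image_mset (\<lambda>l. 1 / l) (mset (take k ev))) = sum_mset (image_mset (\<lambda>l. 1 / l) (mset ls'))"
      unfolding tk mf ..
    then show ?thesis
      by (simp only: mset_map[symmetric] sum_mset_sum_list)
  qed
  finally show "(\<Sum>i<k. 1 / ev ! i) = ?g / gramS d vf S"
    using sum' by simp
qed


section \<open>Trace and operator norm\<close>

lemma mat_trace_outer_sum: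
  assumes "\<And>i a. i < n \<Longrightarrow> a < d \<Longrightarrow> vf i a = v i $ a"
  shows "mat_trace (outer_sum d {..<n} c v) = (\<Sum>i<n. c i * ip d (vf i) (vf i))"
proof -
  have "mat_trace (outer_sum d {..<n} c v) = (\<Sum>a<d. \<Sum>i<n. c i * (vf i a * vf i a))"
    by (simp add: mat_trace_def outer_sum_def assms)
  also have "\<dots> = (\<Sum>i<n. c i * ip d (vf i) (vf i))"
    unfolding ip_def sum_distrib_left by (rule sum.swap)
  finally show ?thesis .
qed

lemma ip_vec: "x \<in> carrier_vec d \<Longrightarrow> y \<in> carrier_vec d \<Longrightarrow> x \<bullet> y = ip d (\<lambda>a. x $ a) (\<lambda>a. y $ a)"
  by (simp add: scalar_prod_def ip_def lessThan_atLeast0)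

lemma ip_Cauchy_Schwarz: "(ip d x y)\<^sup>2 \<le> ip d x x * ip d y y"
proof (cases "ip d y y = 0")
  case True
  then have "ip d y x = 0"
    by (rule ip_zero_if_self_zero)
  then show ?thesis
    using True by (simp add: ip_commute)
next
  case False
  then have pos: "0 < ip d y y"
    using ip_self_nonneg[of d y] by simp
  define t where "t = ip d x y / ip d y y"
  have "0 \<le> ip d (\<lambda>a. x a - t * y a) (\<lambda>a. x a - t * y a)"
    by (rule ip_self_nonneg)
  also have "\<dots> = ip d x x - t * ip d x y - t * (ip d x y - t * ip d y y)"
    unfolding ip_diff_scale_left ip_diff_scale_right ip_commute[of d y x] by (simp add: algebra_simps)
  also have "t * ip d y y = ip d x y"
    using False by (simp add: t_def)
  finally have "(ip d x y)\<^sup>2 / ip d y y \<le> ip d x x"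
    by (simp add: t_def power2_eq_square)
  then show ?thesis
    using pos by (simp add: pos_divide_le_eq)
qed

text \<open>The supremum in \<open>op_norm\<close> carries information only for a set bounded above;
  the Frobenius norm is a bound.\<close>

lemma op_norm_bdd:
  assumes A: "A \<in> carrier_mat d d"
  shows "bdd_above ((\<lambda>x. sqrt ((A *\<^sub>v x) \<bullet> (A *\<^sub>v x))) ` {x \<in> carrier_vec (dim_col A). x \<bullet> x \<le> 1})"
proof (rule bdd_aboveI2)
  fix x assume x: "x \<in> {x \<in> carrier_vec (dim_col A). x \<bullet> x \<le> (1::real)}"
  then have xd: "x \<in> carrier_vec d" "ip d (\<lambda>a. x $ a) (\<lambda>a. x $ a) \<le> 1"
    using A by (auto simp: ip_vec)
  have "((A *\<^sub>v x) $ a)\<^sup>2 \<le> ip d (\<lambda>b. A $$ (a, b)) (\<lambda>b. A $$ (a, b))" if a: "a < d" for a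
  proof -
    have "(A *\<^sub>v x) $ a = ip d (\<lambda>b. A $$ (a, b)) (\<lambda>b. x $ b)"
      using a A xd by (simp add: scalar_prod_def ip_def lessThan_atLeast0)
    then have "((A *\<^sub>v x) $ a)\<^sup>2 \<le> ip d (\<lambda>b. A $$ (a, b)) (\<lambda>b. A $$ (a, b)) * ip d (\<lambda>b. x $ b) (\<lambda>b. x $ b)"
      using ip_Cauchy_Schwarz by simp
    also have "\<dots> \<le> ip d (\<lambda>b. A $$ (a, b)) (\<lambda>b. A $$ (a, b)) * 1"
      by (intro mult_left_mono xd ip_self_nonneg)
    finally show ?thesis
      by simp
  qed
  then have "(A *\<^sub>v x) \<bullet> (A *\<^sub>v x) \<le> (\<Sum>a<d. ip d (\<lambda>b. A $$ (a, b)) (\<lambda>b. A $$ (a, b)))"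
    using A xd unfolding ip_vec[OF mult_mat_vec_carrier[OF A xd(1)] mult_mat_vec_carrier[OF A xd(1)]] ip_def[of d "\<lambda>a. (A *\<^sub>v x) $ a"]
    by (intro sum_mono) (simp add: power2_eq_square)
  then show "sqrt ((A *\<^sub>v x) \<bullet> (A *\<^sub>v x)) \<le> sqrt (\<Sum>a<d. ip d (\<lambda>b. A $$ (a, b)) (\<lambda>b. A $$ (a, b)))"
    by simp
qed

text \<open>Cauchy--Schwarz bounds x^T A x by |x| |A x|, and the supremum is applied to x scaled to
  length one.\<close>

lemma op_norm_quadratic_form:
  assumes A: "A \<in> carrier_mat d d"
  shows "0 \<le> op_norm A" "ip d x (\<lambda>a. \<Sum>b<d. A $$ (a, b) * x b) \<le> op_norm A * ip d x x"
proof -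
  let ?f = "\<lambda>x. sqrt ((A *\<^sub>v x) \<bullet> (A *\<^sub>v x))" and ?X = "{x \<in> carrier_vec (dim_col A). x \<bullet> x \<le> (1::real)}"
  have "?f (0\<^sub>v d) \<le> op_norm A"
    unfolding op_norm_def by (rule cSUP_upper[OF _ op_norm_bdd[OF A]]) (use A in auto)
  then show L0: "0 \<le> op_norm A"
    using A by (simp add: scalar_prod_def)
  let ?y = "\<lambda>a. \<Sum>b<d. A $$ (a, b) * x b"
  show "ip d x ?y \<le> op_norm A * ip d x x"
  proof (cases "ip d x x = 0")
    case True
    then show ?thesis
      by (simp add: ip_zero_if_self_zero)
  next
    case False
    then have pos: "0 < ip d x x"
      using ip_self_nonneg[of d x] by simp
    define r where "r = sqrt (ip d x x)"
    have r: "0 < r" "r * r = ip d x x"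
      using pos by (simp_all add: r_def)
    define u where "u = vec d (\<lambda>a. x a / r)"
    have u: "u \<in> carrier_vec d"
      by (simp add: u_def)
    have "u \<bullet> u = ip d x x / (r * r)"
      unfolding ip_vec[OF u u] by (simp add: ip_def u_def sum_divide_distrib)
    then have uu: "u \<bullet> u = 1"
      unfolding r(2) using pos by simp
    have Au: "(A *\<^sub>v u) $ a = ?y a / r" if "a < d" for a
      using that A u by (simp add: scalar_prod_def u_def lessThan_atLeast0 sum_divide_distrib)
    have "(A *\<^sub>v u) \<bullet> (A *\<^sub>v u) = ip d ?y ?y / (r * r)"
      unfolding ip_vec[OF mult_mat_vec_carrier[OF A u] mult_mat_vec_carrier[OF A u]]
      unfolding ip_def sum_divide_distrib by (intro sum.cong refl) (simp add: Au del: index_mult_mat_vec)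
    moreover have "?f u \<le> op_norm A"
      unfolding op_norm_def by (rule cSUP_upper[OF _ op_norm_bdd[OF A]]) (use A u uu in auto)
    ultimately have "sqrt (ip d ?y ?y) / r \<le> op_norm A"
      using r(1) by (simp add: real_sqrt_divide)
    then have "sqrt (ip d ?y ?y) \<le> op_norm A * r"
      using r(1) by (simp add: pos_divide_le_eq)
    moreover have "ip d x ?y \<le> r * sqrt (ip d ?y ?y)"
    proof -
      have "sqrt ((ip d x ?y)\<^sup>2) \<le> sqrt (ip d x x * ip d ?y ?y)"
        by (intro real_sqrt_le_mono ip_Cauchy_Schwarz)
      then show ?thesis
        by (simp add: real_sqrt_mult r_def)
    qed
    ultimately have "ip d x ?y \<le> r * (op_norm A * r)"
      using r(1) by (meson less_imp_le mult_left_mono order_trans)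
    also have "\<dots> = op_norm A * ip d x x"
      unfolding r(2)[symmetric] by simp
    finally show ?thesis .
  qed
qed

lemma op_norm_outer_sum:
  assumes vf: "\<And>i a. i < n \<Longrightarrow> a < d \<Longrightarrow> vf i a = v i $ a"
  shows "(\<Sum>i<n. c i * (ip d (vf i) x)\<^sup>2) \<le> op_norm (outer_sum d {..<n} c v) * ip d x x"
proof -
  let ?M = "outer_sum d {..<n} c v"
  have "(\<Sum>i<n. c i * (ip d (vf i) x)\<^sup>2) = (\<Sum>i<n. \<Sum>a<d. \<Sum>b<d. c i * (vf i a * vf i b) * (x a * x b))"
  proof (intro sum.cong refl)
    fix i
    have "(ip d (vf i) x)\<^sup>2 = (\<Sum>a<d. \<Sum>b<d. (vf i a * vf i b) * (x a * x b))"
      by (simp add: ip_def power2_eq_square sum_product mult_ac)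
    then show "c i * (ip d (vf i) x)\<^sup>2 = (\<Sum>a<d. \<Sum>b<d. c i * (vf i a * vf i b) * (x a * x b))"
      by (simp add: sum_distrib_left mult.assoc)
  qed
  also have "\<dots> = (\<Sum>a<d. \<Sum>i<n. \<Sum>b<d. c i * (vf i a * vf i b) * (x a * x b))"
    by (rule sum.swap)
  also have "\<dots> = (\<Sum>a<d. \<Sum>b<d. \<Sum>i<n. c i * (vf i a * vf i b) * (x a * x b))"
    by (intro sum.cong refl sum.swap)
  also have "\<dots> = ip d x (\<lambda>a. \<Sum>b<d. ?M $$ (a, b) * x b)"
    unfolding ip_def sum_distrib_left
    by (intro sum.cong refl) (simp add: outer_sum_def vf sum_distrib_right sum_distrib_left mult_ac)
  also have "\<dots> \<le> op_norm ?M * ip d x x"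
    by (rule op_norm_quadratic_form) (simp add: outer_sum_def)
  finally show ?thesis .
qed

section \<open>A good subset from a small trace of the inverse Gram matrix\<close>

text \<open>The condition k \<le> r keeps tr M - j ||M|| positive for all j < k, so
  \<open>esym\<close> stays positive up to index k; hence an independent k-subset exists. The last
  bound combines \<open>enum_le\<close> with the step from k - 1 to k.\<close>

lemma admissible_bounds:
  assumes adm: "admissible n d v c k" and vf: "\<And>i a. i < n \<Longrightarrow> a < d \<Longrightarrow> vf i a = v i $ a"
  defines "M \<equiv> outer_sum d {..<n} c v"
  shows "0 < esym n d vf c k" "k \<le> n" "0 < mat_trace M" "0 < op_norm M" "0 < (\<Sum>i<n. c i)"
    "(mat_trace M - real (k - 1) * op_norm M) * enum n d vf c k \<le> real k * (\<Sum>i<n. c i) * esym n d vf c k"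
proof -
  let ?e = "esym n d vf c"
  let ?s = "(\<Sum>i<n. c i)"
  let ?D = "(mat_trace M - real (k - 1) * op_norm M)"
  have c: "\<And>i. i < n \<Longrightarrow> 0 \<le> c i" and k: "0 < k" and kr: "real k \<le> mat_trace M / op_norm M"
    using adm by (auto simp: admissible_def trace_norm_ratio_def M_def)
  have tr: "mat_trace M = (\<Sum>i<n. c i * ip d (vf i) (vf i))"
    unfolding M_def by (rule mat_trace_outer_sum) (rule vf)
  have L: "(\<Sum>i<n. c i * (ip d (vf i) x)\<^sup>2) \<le> op_norm M * ip d x x" for x
    unfolding M_def by (rule op_norm_outer_sum) (rule vf)
  have L0: "0 \<le> op_norm M"
    unfolding M_def by (rule op_norm_quadratic_form[of _ d]) (simp add: outer_sum_def)
  \<comment> \<open>With norm zero the ratio would be \<open>x / 0 = 0\<close>, below the positive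
    k.\<close>
  have "op_norm M \<noteq> 0"
    using kr k by auto
  then show Lp: "0 < op_norm M"
    using L0 by simp
  then have kL: "real k * op_norm M \<le> mat_trace M"
    using kr by (simp add: pos_le_divide_eq)
  moreover have "0 < real k * op_norm M"
    using k Lp by simp
  ultimately show trp: "0 < mat_trace M"
    by linarith
  have diff: "0 < mat_trace M - real j * op_norm M" if "j < k" for j
  proof -
    have "real j * op_norm M < real k * op_norm M"
      using that Lp by simp
    then show ?thesis
      using kL by linarith
  qed
  have step: "(mat_trace M - real j * op_norm M) * ?e j \<le> real (Suc j) * ?e (Suc j)" for j
    unfolding tr by (rule esym_Suc_ge[OF L L0 c])
  have pos: "j \<le> k \<Longrightarrow> 0 < ?e j" for j
  proof (induction j)
    case (Suc j)
    then have "0 < (mat_trace M - real j * op_norm M) * ?e j"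
      using diff[of j] by simp
    then have "0 < real (Suc j) * ?e (Suc j)"
      using step[of j] by linarith
    then show ?case
      by (simp add: zero_less_mult_iff)
  qed (simp add: esym_0)
  then show "0 < ?e k"
    by simp
  then have "subs n k \<noteq> {}"
    by (auto simp: esym_def)
  then show "k \<le> n"
    using subs_empty[of n k] not_le by blast
  have "?s \<noteq> 0"
  proof
    assume "?s = 0"
    then have "\<forall>i<n. c i = 0"
      using sum_nonneg_eq_0_iff[of "{..<n}" c] c by simp
    then show False
      using trp by (simp add: tr)
  qed
  then show sp: "0 < ?s"
    using sum_nonneg[of "{..<n}" c] c by fastforce
  have "?D * enum n d vf c k \<le>
      ?D * (?s * ?e (k - 1))"
    using diff[of "k - 1"] k by (intro mult_left_mono enum_le c) auto
  also have "\<dots> = ?s * (?D * ?e (k - 1))"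
    by simp
  also have "\<dots> \<le> ?s * (real k * ?e k)"
    using step[of "k - 1"] k sp by (intro mult_left_mono) auto
  finally show "?D * enum n d vf c k \<le> real k * ?s * ?e k"
    by (simp add: mult_ac)
qed

text \<open>For weights supported on k indices only \<open>S\<close> itself contributes to numerator
  and denominator. The product of its weights cancels, and the mean is the reciprocal eigenvalue sum
  of \<open>S\<close>.\<close>

lemma good_subset_if_ratio:
  assumes adm: "admissible n d v c k" and vf: "\<And>i a. i < n \<Longrightarrow> a < d \<Longrightarrow> vf i a = v i $ a"
    and S: "S \<subseteq> {..<n}" "card S = k" and W: "\<And>i. i < n \<Longrightarrow> W i = (if i \<in> S then c i else 0)"
    and pos: "0 < esym n d vf W k"
    and le: "enum n d vf W k * esym n d vf c k \<le> enum n d vf c k * esym n d vf W k"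
  shows "good_subset n d v c k S"
proof -
  let ?e = "esym n d vf c k"
  let ?g = "(\<Sum>i\<in>S. gramS d vf (S - {i}))"
  let ?s = "(\<Sum>i<n. c i)"
  define M where "M = outer_sum d {..<n} c v"
  note b = admissible_bounds[OF adm vf, folded M_def]
  have k: "0 < k"
    using adm by (simp add: admissible_def)
  have fS: "finite S"
    using S finite_subset by blast
  define P where "P = (\<Prod>i\<in>S. c i)"
  have WT: "prod W T = (if T = S then P else 0)" if "T \<in> subs n k" for T
  proof (cases "T = S")
    case True
    then show ?thesis
      using S W by (auto simp: P_def intro!: prod.cong)
  next
    case False
    then have "\<not> T \<subseteq> S"
      using card_subset_eq[OF fS, of T] S that by (auto simp: subs_def)
    then show ?thesis
      using False W that by (auto simp: subs_def subset_iff intro!: prod_zero finite_subset[OF _ finite_lessThan])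
  qed
  have Sn: "S \<in> subs n k"
    using S by (simp add: subs_def)
  have e: "esym n d vf W k = P * gramS d vf S"
  proof -
    have "esym n d vf W k = (\<Sum>T\<in>subs n k. if T = S then P * gramS d vf T else 0)"
      unfolding esym_def by (intro sum.cong refl) (simp add: WT)
    then show ?thesis
      using Sn by (simp add: finite_subs)
  qed
  have f: "enum n d vf W k = P * ?g"
  proof -
    have "enum n d vf W k = (\<Sum>T\<in>subs n k. if T = S then P * (\<Sum>i\<in>T. gramS d vf (T - {i})) else 0)"
      unfolding enum_eq[OF k] by (intro sum.cong refl) (simp add: WT)
    then show ?thesis
      using Sn by (simp add: finite_subs)
  qed
  have P0: "0 \<le> P"
    using adm S by (auto simp: P_def admissible_def intro!: prod_nonneg)
  then have Pp: "0 < P" and gp: "0 < gramS d vf S"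
    using pos gramS_nonneg[of d vf S] by (auto simp: e zero_less_mult_iff)
  define ev where "ev = eigvals_desc (outer_sum d S (\<lambda>_. 1) v)"
  note E = eigvals_desc_outer_sum[OF S k vf gp, folded ev_def]
  define h where "h = (\<Sum>i<k. 1 / ev ! i)"
  have "P * ?g * ?e \<le> enum n d vf c k * (P * gramS d vf S)"
    using le unfolding e f .
  then have "P * (?g * ?e) \<le> P * (enum n d vf c k * gramS d vf S)"
    by (simp add: mult_ac)
  then have "?g * ?e \<le> enum n d vf c k * gramS d vf S"
    using Pp by simp
  then have h1: "h * ?e \<le> enum n d vf c k"
    using E(3) unfolding h_def[symmetric] using gp by (simp add: pos_divide_le_eq mult_ac)
  \<comment> \<open>\<open>D / op_norm M\<close> is r - k + 1, so the claimed lower bound simplifies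
    to \<open>D\<close> divided by the sum of the c_i.\<close>
  define D where "D = mat_trace M - real (k - 1) * op_norm M"
  have hp: "0 < h"
    unfolding h_def by (rule sum_pos) (use k E(2) in auto)
  have "real k * op_norm M \<le> mat_trace M"
    using adm b(4) by (simp add: admissible_def trace_norm_ratio_def M_def[symmetric] pos_le_divide_eq)
  then have D0: "0 < D"
    using b(4) k by (simp add: D_def of_nat_diff algebra_simps)
  have "D * (h * ?e) \<le> D * enum n d vf c k"
    using D0 h1 by simp
  also have "\<dots> \<le> real k * ?s * ?e"
    using b(6) by (simp add: D_def)
  finally have "(D * h) * ?e \<le> (real k * ?s) * ?e"
    by (simp add: mult_ac)
  then have "D * h \<le> real k * ?s"
    using b(1) by simp
  then have "D / ?s \<le> real k / h"
    using hp b(5) by (simp add: field_simps)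
  moreover have "inverse (1 / real k * h) = real k / h"
    by (simp add: field_simps)
  moreover have "(trace_norm_ratio M - real k + 1) / trace_norm_ratio M * (mat_trace M / ?s) = D / ?s"
  proof -
    have "trace_norm_ratio M - real k + 1 = D / op_norm M"
      using b(4) k by (simp add: trace_norm_ratio_def D_def of_nat_diff field_simps)
    then show ?thesis
      using b(3,4) by (simp add: trace_norm_ratio_def)
  qed
  ultimately show ?thesis
    unfolding good_subset_def Let_def M_def[symmetric] ev_def[symmetric] h_def[symmetric]
    using S E(1,2) by simp
qed

section \<open>Cost-annotated program logic\<close>

fun imod :: "com \<Rightarrow> vname set" where
  "imod (IAssign x e) = {x}"
| "imod (Seq P Q) = imod P \<union> imod Q"
| "imod (Cond b P Q) = imod P \<union> imod Q"
| "imod (While b P) = imod P"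
| "imod _ = {}"

fun rmod :: "com \<Rightarrow> vname set" where
  "rmod (RAssign (Cell x i j) e) = {x}"
| "rmod (Seq P Q) = rmod P \<union> rmod Q"
| "rmod (Cond b P Q) = rmod P \<union> rmod Q"
| "rmod (While b P) = rmod P"
| "rmod _ = {}"

definition frame :: "vname set \<Rightarrow> vname set \<Rightarrow> state \<Rightarrow> state \<Rightarrow> bool" where
  "frame X Y s t \<longleftrightarrow> (\<forall>x. x \<notin> X \<longrightarrow> fst t x = fst s x) \<and> (\<forall>y. y \<notin> Y \<longrightarrow> snd t y = snd s y)"

lemma frame_trans: "frame X Y s t \<Longrightarrow> frame X' Y' t u \<Longrightarrow> X \<subseteq> Z \<Longrightarrow> X' \<subseteq> Z \<Longrightarrow> Y \<subseteq> Z' \<Longrightarrow> Y' \<subseteq> Z' \<Longrightarrow> frame Z Z' s u"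
  unfolding frame_def by (metis subsetD)

lemma frame_fst: "frame X Y s t \<Longrightarrow> x \<notin> X \<Longrightarrow> fst t x = fst s x"
  by (simp add: frame_def)

lemma frame_snd: "frame X Y s t \<Longrightarrow> y \<notin> Y \<Longrightarrow> snd t y = snd s y"
  by (simp add: frame_def)

lemma exec_frame: "exec w P s C t \<Longrightarrow> frame (imod P) (rmod P) s t"
proof (induction rule: exec.induct)
  case (RAssign p e s)
  then show ?case
    by (cases p) (simp add: frame_def)
qed (auto simp: frame_def)

definition runs :: "(real \<Rightarrow> nat) \<Rightarrow> com \<Rightarrow> state \<Rightarrow> nat \<Rightarrow> (state \<Rightarrow> bool) \<Rightarrow> bool" where
  "runs w P s B Q \<longleftrightarrow> (\<exists>C t. exec w P s C t \<and> C \<le> B \<and> Q t)"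

lemma runs_mono: "runs w P s B Q \<Longrightarrow> B \<le> B' \<Longrightarrow> (\<And>t. Q t \<Longrightarrow> Q' t) \<Longrightarrow> runs w P s B' Q'"
  unfolding runs_def by (meson le_trans)

lemma runs_frame:
  "runs w P s B Q \<Longrightarrow> B \<le> B' \<Longrightarrow> (\<And>t. Q t \<Longrightarrow> frame (imod P) (rmod P) s t \<Longrightarrow> Q' t) \<Longrightarrow> runs w P s B' Q'"
  unfolding runs_def by (meson le_trans exec_frame)

lemma runs_Skip: "Q s \<Longrightarrow> 1 \<le> B \<Longrightarrow> runs w Skip s B Q"
  unfolding runs_def using exec.Skip by blast

lemma runs_IAssign: "Q ((fst s)(x := ival e s), snd s) \<Longrightarrow> 1 \<le> B \<Longrightarrow> runs w (IAssign x e) s B Q"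
  unfolding runs_def using exec.IAssign by blast

lemma runs_RAssign: "Q (store p (rval e s) s) \<Longrightarrow> rcost w e s \<le> B \<Longrightarrow> runs w (RAssign p e) s B Q"
  unfolding runs_def using exec.RAssign by blast

text \<open>The syntactic frame of the first command is handed to the second, so postconditions need
  to mention only what changes.\<close>

lemma runs_Seq:
  assumes "runs w P s B1 Q1" "\<And>t. Q1 t \<Longrightarrow> frame (imod P) (rmod P) s t \<Longrightarrow> runs w R t B2 Q" "B1 + B2 \<le> B"
  shows "runs w (Seq P R) s B Q"
proof -
  obtain C t where 1: "exec w P s C t" "C \<le> B1" "Q1 t"
    using assms(1) by (auto simp: runs_def)
  then obtain C' t' where 2: "exec w R t C' t'" "C' \<le> B2" "Q t'"
    using assms(2)[OF 1(3) exec_frame[OF 1(1)]] by (auto simp: runs_def)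
  have "exec w (Seq P R) s (C + C') t'"
    using 1 2 by (intro exec.Seq)
  then show ?thesis
    unfolding runs_def using 1 2 assms(3) by (meson add_mono le_trans)
qed

lemma runs_Cond:
  assumes "bval b s \<Longrightarrow> runs w P s B Q" "\<not> bval b s \<Longrightarrow> runs w R s B Q" "bcost w b s + B \<le> B'"
  shows "runs w (Cond b P R) s B' Q"
proof (cases "bval b s")
  case True
  then obtain C t where "exec w P s C t" "C \<le> B" "Q t"
    using assms(1) by (auto simp: runs_def)
  then show ?thesis
    unfolding runs_def using exec.CondTrue[OF True] assms(3) by (meson add_left_mono le_trans)
next
  case False
  then obtain C t where "exec w R s C t" "C \<le> B" "Q t"
    using assms(2) by (auto simp: runs_def)
  then show ?thesis
    unfolding runs_def using exec.CondFalse[OF False] assms(3) by (meson add_left_mono le_trans)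
qed

section \<open>Counting loops and their cost\<close>

definition For :: "vname \<Rightarrow> vname \<Rightarrow> com \<Rightarrow> com" where
  "For x y P = Seq (IAssign x (N 0)) (While (ILess (V x) (V y)) (Seq P (IAssign x (Plus (V x) (N 1)))))"

lemma mod_For [simp]: "imod (For x y P) = insert x (imod P)" "rmod (For x y P) = rmod P"
  by (auto simp: For_def)

text \<open>\<open>B + 2\<close> pays for body, increment and test, and the final 1 for the failing
  test. The invariant must not depend on \<open>x\<close>, as the increment follows the
  body.\<close>

lemma runs_While_upto:
  assumes x: "x \<notin> imod P" "y \<noteq> x" "y \<notin> imod P" and m: "fst s y = m"
    and indep: "\<And>i t r. I i t \<Longrightarrow> I i ((fst t)(x := r), snd t)"
    and step: "\<And>i t. i < m \<Longrightarrow> I i t \<Longrightarrow> fst t x = i \<Longrightarrow> frame (insert x (imod P)) (rmod P) s t \<Longrightarrow> runs w P t B (I (Suc i))"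
  shows "I i t \<Longrightarrow> fst t x = i \<Longrightarrow> i \<le> m \<Longrightarrow> frame (insert x (imod P)) (rmod P) s t \<Longrightarrow>
    runs w (While (ILess (V x) (V y)) (Seq P (IAssign x (Plus (V x) (N 1))))) t ((m - i) * (B + 2) + 1) (I m)"
proof (induction "m - i" arbitrary: i t)
  case 0
  then have im: "i = m"
    by simp
  have "\<not> bval (ILess (V x) (V y)) t"
    using 0 x m im by (simp add: frame_fst)
  then have "exec w (While (ILess (V x) (V y)) (Seq P (IAssign x (Plus (V x) (N 1))))) t (bcost w (ILess (V x) (V y)) t) t"
    by (rule exec.WhileFalse)
  moreover have "bcost w (ILess (V x) (V y)) t \<le> (m - i) * (B + 2) + 1" "I m t"
    using 0 im by auto
  ultimately show ?case
    unfolding runs_def by blast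
next
  case (Suc l)
  let ?b = "ILess (V x) (V y)" and ?P = "Seq P (IAssign x (Plus (V x) (N 1)))"
  have i: "i < m"
    using Suc.hyps by simp
  then have b: "bval ?b t"
    using Suc.prems x m by (simp add: frame_fst)
  obtain C t' where 1: "exec w P t C t'" "C \<le> B" "I (Suc i) t'"
    using step[OF i Suc.prems(1,2,4)] by (auto simp: runs_def)
  have fr: "frame (imod P) (rmod P) t t'"
    using 1(1) by (rule exec_frame)
  define u where "u = ((fst t')(x := Suc i), snd t')"
  have "exec w (IAssign x (Plus (V x) (N 1))) t' 1 ((fst t')(x := ival (Plus (V x) (N 1)) t'), snd t')"
    by (rule exec.IAssign)
  moreover have "((fst t')(x := ival (Plus (V x) (N 1)) t'), snd t') = u"
    using frame_fst[OF fr x(1)] Suc.prems(2) by (simp add: u_def)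
  ultimately have ex: "exec w ?P t (C + 1) u"
    using 1(1) by (metis exec.Seq)
  have "frame (insert x (imod P)) (rmod P) s u"
    using Suc.prems(4) fr by (auto simp: frame_def u_def)
  then have "runs w (While ?b ?P) u ((m - Suc i) * (B + 2) + 1) (I m)"
    using Suc.hyps(2) i indep[OF 1(3)] by (intro Suc.hyps(1)) (auto simp: u_def)
  then obtain C' t'' where 2: "exec w (While ?b ?P) u C' t''" "C' \<le> (m - Suc i) * (B + 2) + 1" "I m t''"
    by (auto simp: runs_def)
  have "exec w (While ?b ?P) t (bcost w ?b t + (C + 1) + C') t''"
    by (rule exec.WhileTrue[OF b ex 2(1)])
  moreover have "bcost w ?b t + (C + 1) + C' \<le> (m - i) * (B + 2) + 1"
  proof -
    have "m - i = Suc (m - Suc i)"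
      using i by simp
    then show ?thesis
      using 1(2) 2(2) by simp
  qed
  ultimately show ?case
    unfolding runs_def using 2(3) by blast
qed

text \<open>The exact cost m (B + 2) + 2 is rounded up to the single product 5 X B, so that costs of
  nested loops simply multiply.\<close>

lemma runs_For_state:
  assumes x: "x \<notin> imod P" "y \<noteq> x" "y \<notin> imod P" and m: "fst s y = m" "m \<le> X" "1 \<le> X" "1 \<le> B"
    and init: "I 0 s" and indep: "\<And>i t r. I i t \<Longrightarrow> I i ((fst t)(x := r), snd t)"
    and step: "\<And>i t. i < m \<Longrightarrow> I i t \<Longrightarrow> fst t x = i \<Longrightarrow> frame (insert x (imod P)) (rmod P) s t \<Longrightarrow> runs w P t B (I (Suc i))"
    and bound: "5 * X * B \<le> B'"
  shows "runs w (For x y P) s B' (I m)"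
  unfolding For_def
proof (rule runs_Seq)
  show "runs w (IAssign x (N 0)) s 1 (\<lambda>t. I 0 t \<and> fst t x = 0 \<and> frame {x} {} s t)"
    by (rule runs_IAssign) (use indep[OF init] in \<open>auto simp: frame_def\<close>)
  show "runs w (While (ILess (V x) (V y)) (Seq P (IAssign x (Plus (V x) (N 1))))) t (m * (B + 2) + 1) (I m)"
    if "I 0 t \<and> fst t x = 0 \<and> frame {x} {} s t" for t
  proof -
    have "frame (insert x (imod P)) (rmod P) s t"
      using that by (auto simp: frame_def)
    then have "runs w (While (ILess (V x) (V y)) (Seq P (IAssign x (Plus (V x) (N 1))))) t ((m - 0) * (B + 2) + 1) (I m)"
      using that by (intro runs_While_upto[where I = I and s = s and i = 0] x m indep step) auto
    then show ?thesis
      by simp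
  qed
  have "m * (B + 2) + 2 \<le> X * (3 * B) + 2 * (X * B)"
  proof (rule add_mono)
    show "m * (B + 2) \<le> X * (3 * B)"
      using m by (intro mult_mono) auto
    show "2 \<le> 2 * (X * B)"
      using m by simp
  qed
  also have "\<dots> = 5 * X * B"
    by simp
  finally show "1 + (m * (B + 2) + 1) \<le> B'"
    using bound by simp
qed

lemma runs_For:
  assumes x: "x \<notin> imod P" "y \<noteq> x" "y \<notin> imod P" and m: "fst s y = m" "m \<le> X" "1 \<le> X" "1 \<le> B"
    and init: "I 0 (snd s)"
    and step: "\<And>i t. i < m \<Longrightarrow> I i (snd t) \<Longrightarrow> fst t x = i \<Longrightarrow> frame (insert x (imod P)) (rmod P) s t \<Longrightarrow>
      runs w P t B (\<lambda>t'. I (Suc i) (snd t'))"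
    and bound: "5 * X * B \<le> B'"
  shows "runs w (For x y P) s B' (\<lambda>t. I m (snd t))"
  by (rule runs_For_state[OF x m, where I = "\<lambda>i t. I i (snd t)"]) (use init step bound in auto)

lemma runs_matrix:
  assumes names: "x \<noteq> y" "z \<noteq> x" "z \<noteq> y" "x \<notin> imod P" "y \<notin> imod P" "z \<notin> imod P"
    and m: "fst s z = m" "m \<le> X" "1 \<le> X" "1 \<le> B"
    and step: "\<And>a b t. a < m \<Longrightarrow> b < m \<Longrightarrow> fst t x = a \<Longrightarrow> fst t y = b \<Longrightarrow>
      frame (insert x (insert y (imod P))) (rmod P) s t \<Longrightarrow>
      runs w P t B (\<lambda>t'. snd t' M = (snd t M)(a := (snd t M a)(b := f a b)))"
    and bound: "25 * X ^ 2 * B \<le> B'"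
  shows "runs w (For x z (For y z P)) s B' (\<lambda>t. \<forall>a<m. \<forall>b<m. snd t M a b = f a b)"
proof (rule runs_mono)
  show "runs w (For x z (For y z P)) s (5 * X * (5 * X * B)) (\<lambda>t. \<forall>a<m. \<forall>b<m. snd t M a b = f a b)"
  proof (rule runs_For[where I = "\<lambda>i S. \<forall>a<i. \<forall>b<m. S M a b = f a b" and X = X and B = "5 * X * B"])
    fix a t
    assume a: "a < m" "\<forall>a'<a. \<forall>b<m. snd t M a' b = f a' b" "fst t x = a"
      and fr: "frame (insert x (imod (For y z P))) (rmod (For y z P)) s t"
    have "runs w (For y z P) t (5 * X * B)
       (\<lambda>t'. (\<forall>a'<a. \<forall>b<m. snd t' M a' b = f a' b) \<and> (\<forall>b<m. snd t' M a b = f a b))"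
    proof (rule runs_For[where I = "\<lambda>i S. (\<forall>a'<a. \<forall>b<m. S M a' b = f a' b) \<and> (\<forall>b<i. S M a b = f a b)" and X = X and B = B])
      fix b t'
      assume b: "b < m" "(\<forall>a'<a. \<forall>b<m. snd t' M a' b = f a' b) \<and> (\<forall>b'<b. snd t' M a b' = f a b')" "fst t' y = b"
        and fr': "frame (insert y (imod P)) (rmod P) t t'"
      have "runs w P t' B (\<lambda>t''. snd t'' M = (snd t' M)(a := (snd t' M a)(b := f a b)))"
      proof (rule step[OF a(1) b(1) _ b(3)])
        show "fst t' x = a"
          using frame_fst[OF fr', of x] names a(3) by simp
        show "frame (insert x (insert y (imod P))) (rmod P) s t'"
          by (rule frame_trans[OF fr fr']) auto
      qed
      then show "runs w P t' B (\<lambda>t''. (\<forall>a'<a. \<forall>b<m. snd t'' M a' b = f a' b) \<and> (\<forall>b'<Suc b. snd t'' M a b' = f a b'))"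
        by (rule runs_mono) (use b(2) in \<open>auto simp: less_Suc_eq\<close>)
    qed (use names m a frame_fst[OF fr, of z] in auto)
    then show "runs w (For y z P) t (5 * X * B) (\<lambda>t'. \<forall>a'<Suc a. \<forall>b<m. snd t' M a' b = f a' b)"
      by (rule runs_mono) (auto simp: less_Suc_eq)
  qed (use names m in auto)
  show "5 * X * (5 * X * B) \<le> B'"
    using bound by (simp add: power2_eq_square mult_ac)
qed

text \<open>For updates in place: each diagonal entry is still original when visited, as earlier
  rounds touched only other diagonal entries of \<open>M\<close>.\<close>

lemma runs_diagonal:
  assumes names: "z \<noteq> x" "x \<notin> imod P" "z \<notin> imod P"
    and m: "fst s z = m" "m \<le> X" "1 \<le> X" "1 \<le> B"
    and step: "\<And>a t. a < m \<Longrightarrow> fst t x = a \<Longrightarrow> frame (insert x (imod P)) (rmod P) s t \<Longrightarrow>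
      snd t M a a = snd s M a a \<Longrightarrow> runs w P t B (\<lambda>t'. snd t' M = (snd t M)(a := (snd t M a)(a := f a)))"
    and bound: "5 * X * B \<le> B'"
  shows "runs w (For x z P) s B' (\<lambda>t. \<forall>a b. snd t M a b = (if a = b \<and> a < m then f a else snd s M a b))"
proof (rule runs_For[where I = "\<lambda>i S. \<forall>a b. S M a b = (if a = b \<and> a < i then f a else snd s M a b)" and X = X and B = B])
  fix i t
  assume i: "i < m" "\<forall>a b. snd t M a b = (if a = b \<and> a < i then f a else snd s M a b)" "fst t x = i"
    and fr: "frame (insert x (imod P)) (rmod P) s t"
  have "runs w P t B (\<lambda>t'. snd t' M = (snd t M)(i := (snd t M i)(i := f i)))"
    using i by (intro step fr) auto
  then show "runs w P t B (\<lambda>t'. \<forall>a b. snd t' M a b = (if a = b \<and> a < Suc i then f a else snd s M a b))"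
    by (rule runs_mono) (use i(2) in auto)
qed (use names m bound in auto)

section \<open>Number sizes\<close>

text \<open>
  The class \<open>\<sigma> i\<close> collects the numbers of size at most \<open>i\<close>; multiplication adds sizes. It is
  instantiated by all reals for unit cost, and by fractions with denominator \<open>Q\<^sup>i\<close> and
  numerator at most \<open>R\<^sup>i\<close> for logarithmic cost.
\<close>

locale size_classes =
  fixes w :: "real \<Rightarrow> nat" and \<sigma> :: "nat \<Rightarrow> real set" and top len :: nat
  assumes zero: "0 \<in> \<sigma> 0" and one: "1 \<in> \<sigma> 0"
    and add: "x \<in> \<sigma> i \<Longrightarrow> y \<in> \<sigma> i \<Longrightarrow> x + y \<in> \<sigma> (Suc i)"
    and diff: "x \<in> \<sigma> i \<Longrightarrow> y \<in> \<sigma> i \<Longrightarrow> x - y \<in> \<sigma> (Suc i)"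
    and mult: "x \<in> \<sigma> i \<Longrightarrow> y \<in> \<sigma> j \<Longrightarrow> x * y \<in> \<sigma> (i + j)"
    and Suc_mono: "x \<in> \<sigma> i \<Longrightarrow> x \<in> \<sigma> (Suc i)"
    and w_le: "x \<in> \<sigma> i \<Longrightarrow> i \<le> top \<Longrightarrow> w x \<le> len"
begin

text \<open>The costliest arithmetic instruction involves three numbers: two that are read and one
  that is written.\<close>

definition U :: nat where
  "U = 1 + 3 * len"

lemma U_ge_1: "1 \<le> U"
  by (simp add: U_def)

lemma size_mono: "x \<in> \<sigma> i \<Longrightarrow> i \<le> j \<Longrightarrow> x \<in> \<sigma> j"
  by (induction j) (auto simp: le_Suc_eq intro: Suc_mono)

lemma zero_any: "0 \<in> \<sigma> i" and one_any: "1 \<in> \<sigma> i"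
  using size_mono[OF zero] size_mono[OF one] by simp_all

lemma size_of_nat: "real i \<in> \<sigma> i"
proof (induction i)
  case (Suc i)
  then show ?case
    using add[OF Suc.IH one_any] by (simp add: add.commute)
qed (simp add: zero)

lemma size_sum: "(\<And>l. l < m \<Longrightarrow> h l \<in> \<sigma> i) \<Longrightarrow> (\<Sum>l<m. h l) \<in> \<sigma> (i + m)"
proof (induction m)
  case (Suc m)
  have "(\<Sum>l<m. h l) \<in> \<sigma> (i + m)"
    by (rule Suc.IH) (use Suc.prems in auto)
  moreover have "h m \<in> \<sigma> (i + m)"
    by (rule size_mono[OF Suc.prems]) auto
  ultimately show ?case
    using add by simp
qed (simp add: zero_any)

lemma rcost_le:
  "w (of_int c) \<le> len \<Longrightarrow> rcost w (Const c) s \<le> U"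
  "w (cval p s) \<le> len \<Longrightarrow> rcost w (Load p) s \<le> U"
  "w (cval p s) \<le> len \<Longrightarrow> w (cval q s) \<le> len \<Longrightarrow> w (cval p s + cval q s) \<le> len \<Longrightarrow> rcost w (Add p q) s \<le> U"
  "w (cval p s) \<le> len \<Longrightarrow> w (cval q s) \<le> len \<Longrightarrow> w (cval p s - cval q s) \<le> len \<Longrightarrow> rcost w (Sub p q) s \<le> U"
  "w (cval p s) \<le> len \<Longrightarrow> w (cval q s) \<le> len \<Longrightarrow> w (cval p s * cval q s) \<le> len \<Longrightarrow> rcost w (Mul p q) s \<le> U"
  by (simp_all add: U_def)

end

text \<open>An instruction performs a single operation, so each product passes through the scratch
  cell \<open>''x''\<close> before it is accumulated.\<close>

definition Dot :: "cell \<Rightarrow> vname \<Rightarrow> vname \<Rightarrow> cell \<Rightarrow> cell \<Rightarrow> com" where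
  "Dot r x y p q = Seq (RAssign r (Const 0))
     (For x y (Seq (RAssign (Cell ''x'' (N 0) (N 0)) (Mul p q)) (RAssign r (Add r (Cell ''x'' (N 0) (N 0))))))"

lemma mod_Dot [simp]: "imod (Dot (Cell M ra rb) x y p q) = {x}" "rmod (Dot (Cell M ra rb) x y p q) = {M, ''x''}"
  by (auto simp: Dot_def)

lemma ival_fst: "fst s = fst t \<Longrightarrow> ival e s = ival e t"
  by (induction e) auto

text \<open>The address hypotheses hold for arbitrary array contents because addresses depend on
  registers only, while the arrays change during the loop. One initial write and two instructions
  per round give U + 10 X U.\<close>

lemma (in size_classes) runs_Dot:
  assumes names: "y \<noteq> x" "M \<noteq> ''x''" "P \<noteq> ''x''" "Q \<noteq> ''x''" "P \<noteq> M" "Q \<noteq> M"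
    and m: "fst s y = m" "m \<le> X" "1 \<le> X"
    and r: "\<And>i S. ival ra ((fst s)(x := i), S) = A" "\<And>i S. ival rb ((fst s)(x := i), S) = B"
    and r': "ival ra s = A" "ival rb s = B"
    and f: "\<And>i S. i < m \<Longrightarrow> snd s P (ival pa ((fst s)(x := i), S)) (ival pb ((fst s)(x := i), S)) = f i"
    and g: "\<And>i S. i < m \<Longrightarrow> snd s Q (ival qa ((fst s)(x := i), S)) (ival qb ((fst s)(x := i), S)) = g i"
    and size: "\<And>i. i < m \<Longrightarrow> f i \<in> \<sigma> \<alpha>" "\<And>i. i < m \<Longrightarrow> g i \<in> \<sigma> \<beta>" "\<alpha> + \<beta> + m \<le> top"
    and bound: "11 * X * U \<le> B'"
  shows "runs w (Dot (Cell M ra rb) x y (Cell P pa pb) (Cell Q qa qb)) s B'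
    (\<lambda>t. snd t M = (snd s M)(A := (snd s M A)(B := \<Sum>i<m. f i * g i)))"
  unfolding Dot_def
proof (rule runs_Seq)
  show "runs w (RAssign (Cell M ra rb) (Const 0)) s U
     (\<lambda>t. t = (fst s, (snd s)(M := (snd s M)(A := (snd s M A)(B := 0)))))"
    by (rule runs_RAssign) (use r' w_le[OF zero] in \<open>auto simp: U_def\<close>)
next
  fix s1
  assume s1: "s1 = (fst s, (snd s)(M := (snd s M)(A := (snd s M A)(B := 0))))"
  let ?I = "\<lambda>i S. S M = (snd s M)(A := (snd s M A)(B := \<Sum>l<i. f l * g l))"
  let ?c = "Cell ''x'' (N 0) (N 0)"
  let ?r = "Cell M ra rb"
  let ?m = "Mul (Cell P pa pb) (Cell Q qa qb)"
  let ?P = "Seq (RAssign ?c ?m) (RAssign ?r (Add ?r ?c))"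
  show "runs w (For x y ?P)
     s1 (10 * X * U) (\<lambda>t. ?I m (snd t))"
  proof (rule runs_For[where I = ?I and X = X and B = "2 * U"])
    fix i t
    assume i: "i < m" "?I i (snd t)" "fst t x = i"
      and fr: "frame (insert x (imod ?P))
        (rmod ?P) s1 t"
    have ft: "fst t = (fst s)(x := i)"
      using frame_fst[OF fr] i(3) by (auto simp: s1)
    have iv: "ival e t = ival e ((fst s)(x := i), snd t)" for e
      by (rule ival_fst) (simp add: ft)
    have st: "snd t P = snd s P" "snd t Q = snd s Q"
      using frame_snd[OF fr, of P] frame_snd[OF fr, of Q] names by (auto simp: s1)
    have pv: "cval (Cell P pa pb) t = f i" and qv: "cval (Cell Q qa qb) t = g i"
      using f[OF i(1), of "snd t"] g[OF i(1), of "snd t"] by (simp_all add: st iv)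
    have sum_size: "(\<Sum>l<j. f l * g l) \<in> \<sigma> (\<alpha> + \<beta> + j)" if "j \<le> m" for j
      by (rule size_sum) (use that size in \<open>auto intro: mult\<close>)
    have fg: "f i * g i \<in> \<sigma> (\<alpha> + \<beta>)"
      using i(1) size by (auto intro: mult)
    show "runs w ?P t (2 * U)
       (\<lambda>t'. ?I (Suc i) (snd t'))"
    proof (rule runs_Seq)
      show "runs w (RAssign ?c ?m) t U (\<lambda>t'. t' = store ?c (f i * g i) t)"
      proof (rule runs_RAssign)
        show "rcost w ?m t \<le> U"
          by (rule rcost_le; unfold pv qv)
            (use i(1) size in \<open>auto intro: w_le[OF size(1)] w_le[OF size(2)] w_le[OF fg]\<close>)
      qed (simp only: rval.simps pv qv)
    next
      fix t' assume t': "t' = store ?c (f i * g i) t"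
      have ft': "fst t' = (fst s)(x := i)"
        by (simp add: t' ft)
      have iv': "ival ra t' = A" "ival rb t' = B"
        using r ival_fst[of t' "((fst s)(x := i), snd t')"] by (simp_all add: ft')
      have Mv: "cval ?r t' = (\<Sum>l<i. f l * g l)"
        unfolding cval.simps iv' using i(2) names by (simp add: t')
      have cv: "cval ?c t' = f i * g i"
        by (simp add: t')
      show "runs w (RAssign ?r (Add ?r ?c)) t' U (\<lambda>t'. ?I (Suc i) (snd t'))"
      proof (rule runs_RAssign)
        show "rcost w (Add ?r ?c) t' \<le> U"
        proof (rule rcost_le; unfold Mv cv)
          show "w (\<Sum>l<i. f l * g l) \<le> len"
            by (rule w_le[OF sum_size]) (use i(1) size(3) in auto)
          show "w (f i * g i) \<le> len"
            by (rule w_le[OF fg]) (use size(3) in auto)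
          have "w (\<Sum>l<Suc i. f l * g l) \<le> len"
            by (rule w_le[OF sum_size]) (use i(1) size(3) in auto)
          then show "w ((\<Sum>l<i. f l * g l) + f i * g i) \<le> len"
            by simp
        qed
        show "?I (Suc i) (snd (store ?r (rval (Add ?r ?c) t') t'))"
          unfolding rval.simps Mv cv store.simps iv' using i(2) names by (simp add: t')
      qed
    qed simp
  qed (use names m U_ge_1 in \<open>auto simp: s1\<close>)
next
  have "U \<le> X * U"
    using m(3) by simp
  then show "U + 10 * X * U \<le> B'"
    using bound unfolding mult.assoc by linarith
qed

section \<open>The evaluation procedure\<close>

abbreviation scal :: "vname \<Rightarrow> cell" where
  "scal y \<equiv> Cell y (N 0) (N 0)"

definition MatA :: com where
  "MatA = For ''a'' ''n'' (For ''b'' ''n''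
     (Seq (Dot (Cell ''A'' (V ''a'') (V ''b'')) ''i'' ''d'' (Cell ''v'' (V ''a'') (V ''i'')) (Cell ''v'' (V ''b'') (V ''i'')))
        (RAssign (Cell ''A'' (V ''a'') (V ''b'')) (Mul (Cell ''W'' (V ''a'') (N 0)) (Cell ''A'' (V ''a'') (V ''b''))))))"

definition MatT :: com where
  "MatT = For ''a'' ''n'' (For ''b'' ''n''
     (Dot (Cell ''T'' (V ''a'') (V ''b'')) ''i'' ''n'' (Cell ''A'' (V ''a'') (V ''i'')) (Cell ''L'' (V ''i'') (V ''b''))))"

definition MatL :: com where
  "MatL = For ''a'' ''n'' (For ''b'' ''n''
     (Seq (RAssign (scal ''x'') (Mul (scal ''J'') (Cell ''T'' (V ''a'') (V ''b''))))
        (RAssign (Cell ''L'' (V ''a'') (V ''b'')) (Sub (scal ''z'') (scal ''x'')))))"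

definition DiagL :: com where
  "DiagL = For ''a'' ''n'' (RAssign (Cell ''L'' (V ''a'') (V ''a'')) (Add (Cell ''L'' (V ''a'') (V ''a'')) (scal ''E'')))"

definition ZeroL :: com where
  "ZeroL = For ''a'' ''n'' (For ''b'' ''n'' (RAssign (Cell ''L'' (V ''a'') (V ''b'')) (Const 0)))"

definition OneL :: com where
  "OneL = For ''a'' ''n'' (RAssign (Cell ''L'' (V ''a'') (V ''a'')) (Const 1))"

definition DotN :: com where
  "DotN = Dot (scal ''N'') ''i'' ''n'' (Cell ''W'' (V ''i'') (N 0)) (Cell ''L'' (V ''i'') (V ''i''))"

text \<open>The trace is an inner product with the constant 1 held in \<open>''o''\<close>, so
  \<open>Dot\<close> can be reused.\<close>

definition DotE :: com where
  "DotE = Dot (scal ''E'') ''i'' ''n'' (Cell ''T'' (V ''i'') (V ''i'')) (scal ''o'')"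

text \<open>One round of \<open>flv\<close>. \<open>''N''\<close> is taken from \<open>''L''\<close>
  before the update, so that after round k both \<open>''N''\<close> and \<open>''E''\<close> stem
  from \<open>flv\<close> at index k - 1. The counter is raised first because the recursion
  multiplies by \<open>Suc j\<close>.\<close>

definition Step :: com where
  "Step = Seq (RAssign (scal ''J'') (Add (scal ''J'') (scal ''o'')))
     (Seq DotN (Seq MatT (Seq DotE (Seq MatL DiagL))))"

definition Eval :: com where
  "Eval = Seq (RAssign (scal ''o'') (Const 1)) (Seq (RAssign (scal ''z'') (Const 0)) (Seq (RAssign (scal ''J'') (Const 0))
     (Seq MatA (Seq ZeroL (Seq OneL (For ''j'' ''k'' Step))))))"

lemma mod_blocks [simp]:
  "imod MatA = {''a'', ''b'', ''i''}" "rmod MatA = {''A'', ''x''}"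
  "imod MatT = {''a'', ''b'', ''i''}" "rmod MatT = {''T'', ''x''}"
  "imod MatL = {''a'', ''b''}" "rmod MatL = {''L'', ''x''}"
  "imod DiagL = {''a''}" "rmod DiagL = {''L''}"
  "imod ZeroL = {''a'', ''b''}" "rmod ZeroL = {''L''}"
  "imod OneL = {''a''}" "rmod OneL = {''L''}"
  "imod DotN = {''i''}" "rmod DotN = {''N'', ''x''}"
  "imod DotE = {''i''}" "rmod DotE = {''E'', ''x''}"
  by (auto simp: MatA_def MatT_def MatL_def DiagL_def ZeroL_def OneL_def DotN_def DotE_def)

lemma mod_Step [simp]: "imod Step = {''a'', ''b'', ''i''}" "rmod Step = {''J'', ''N'', ''T'', ''E'', ''L'', ''x''}"
  by (auto simp: Step_def)

lemma mod_Eval [simp]: "imod Eval = {''a'', ''b'', ''i'', ''j''}"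
  "rmod Eval = {''o'', ''z'', ''A'', ''J'', ''N'', ''T'', ''E'', ''L'', ''x''}"
  by (auto simp: Eval_def)

definition env :: "nat \<Rightarrow> nat \<Rightarrow> (nat \<Rightarrow> nat \<Rightarrow> real) \<Rightarrow> (nat \<Rightarrow> real) \<Rightarrow> state \<Rightarrow> bool" where
  "env n d vf W s \<longleftrightarrow> fst s ''n'' = n \<and> fst s ''d'' = d \<and> snd s ''v'' = vf \<and> (\<forall>i. snd s ''W'' i 0 = W i)"

lemma env_frame:
  "env n d vf W s \<Longrightarrow> frame X Y s t \<Longrightarrow> ''n'' \<notin> X \<Longrightarrow> ''d'' \<notin> X \<Longrightarrow> ''v'' \<notin> Y \<Longrightarrow> ''W'' \<notin> Y \<Longrightarrow> env n d vf W t"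
  by (simp add: env_def frame_def)

text \<open>2 n + d + k + 5 bounds the growth in one round of the recursion: d + 3 for an entry of
  the matrix, n for each of two nested sums, k for the integer factor, and the rest for the
  subtraction and slack. There are k + 1 such shares.\<close>

definition size_bound :: "nat \<Rightarrow> nat \<Rightarrow> nat \<Rightarrow> nat" where
  "size_bound n d k = (k + 1) * (2 * n + d + k + 5)"

context size_classes
begin

section \<open>Correctness and cost of the building blocks\<close>

lemma runs_MatA:
  assumes env: "env n d vf W s" and X: "n \<le> X" "d \<le> X" "1 \<le> X"
    and size: "\<And>i a. i < n \<Longrightarrow> a < d \<Longrightarrow> vf i a \<in> \<sigma> 1" "\<And>i. i < n \<Longrightarrow> W i \<in> \<sigma> 1" "3 + d \<le> top"
  shows "runs w MatA s (300 * X ^ 3 * U) (\<lambda>t. \<forall>a<n. \<forall>b<n. snd t ''A'' a b = wgram d vf W a b)"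
  unfolding MatA_def
proof (rule runs_matrix[where X = X and B = "12 * X * U"])
  let ?D = "Dot (Cell ''A'' (V ''a'') (V ''b'')) ''i'' ''d'' (Cell ''v'' (V ''a'') (V ''i'')) (Cell ''v'' (V ''b'') (V ''i''))"
  let ?e = "Mul (Cell ''W'' (V ''a'') (N 0)) (Cell ''A'' (V ''a'') (V ''b''))"
  let ?R = "RAssign (Cell ''A'' (V ''a'') (V ''b'')) ?e"
  fix a b t
  assume ab: "a < n" "b < n" "fst t ''a'' = a" "fst t ''b'' = b"
    and fr: "frame (insert ''a'' (insert ''b'' (imod (Seq ?D ?R))))
       (rmod (Seq ?D ?R)) s t"
  have envt: "env n d vf W t"
    by (rule env_frame[OF env fr]) auto
  show "runs w (Seq ?D ?R) t (12 * X * U)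
     (\<lambda>t'. snd t' ''A'' = (snd t ''A'')(a := (snd t ''A'' a)(b := wgram d vf W a b)))"
  proof (rule runs_Seq)
    show "runs w ?D t (11 * X * U)
      (\<lambda>t'. snd t' ''A'' = (snd t ''A'')(a := (snd t ''A'' a)(b := \<Sum>i<d. vf a i * vf b i)))"
      by (rule runs_Dot[where \<alpha> = 1 and \<beta> = 1 and X = X])
        (use ab envt X size in \<open>auto simp: env_def\<close>)
  next
    fix t' assume A: "snd t' ''A'' = (snd t ''A'')(a := (snd t ''A'' a)(b := \<Sum>i<d. vf a i * vf b i))"
      and fr': "frame (imod ?D)
         (rmod ?D) t t'"
    have "env n d vf W t'"
      by (rule env_frame[OF envt fr']) auto
    moreover have r: "fst t' ''a'' = a" "fst t' ''b'' = b"
      using frame_fst[OF fr', of "''a''"] frame_fst[OF fr', of "''b''"] ab by simp_all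
    ultimately have v: "cval (Cell ''W'' (V ''a'') (N 0)) t' = W a" "cval (Cell ''A'' (V ''a'') (V ''b'')) t' = ip d (vf a) (vf b)"
      by (simp_all add: env_def A ip_def)
    have s: "ip d (vf a) (vf b) \<in> \<sigma> (2 + d)"
      unfolding ip_def by (rule size_sum) (use mult[OF size(1) size(1)] ab in \<open>auto simp: numeral_2_eq_2\<close>)
    show "runs w ?R t' U
       (\<lambda>t'. snd t' ''A'' = (snd t ''A'')(a := (snd t ''A'' a)(b := wgram d vf W a b)))"
    proof (rule runs_RAssign)
      show "rcost w ?e t' \<le> U"
        by (rule rcost_le; unfold v)
          (use w_le[OF size(2)[OF ab(1)]] w_le[OF s] w_le[OF mult[OF size(2)[OF ab(1)] s]] size(3) in auto)
      show "snd (store (Cell ''A'' (V ''a'') (V ''b'')) (rval ?e t') t') ''A''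
         = (snd t ''A'')(a := (snd t ''A'' a)(b := wgram d vf W a b))"
        unfolding rval.simps v by (simp add: r A)
    qed
  next
    have "U \<le> X * U"
      using X by simp
    then show "11 * X * U + U \<le> 12 * X * U"
      unfolding mult.assoc by linarith
  qed
qed (use env X U_ge_1 in \<open>auto simp: env_def power3_eq_cube power2_eq_square\<close>)

lemma runs_MatT:
  assumes n: "fst s ''n'' = n" and X: "n \<le> X" "1 \<le> X"
    and A: "\<And>a b. a < n \<Longrightarrow> b < n \<Longrightarrow> snd s ''A'' a b = A a b" and L: "\<And>a b. a < n \<Longrightarrow> b < n \<Longrightarrow> snd s ''L'' a b = L a b"
    and size: "\<And>a b. a < n \<Longrightarrow> b < n \<Longrightarrow> A a b \<in> \<sigma> \<alpha>" "\<And>a b. a < n \<Longrightarrow> b < n \<Longrightarrow> L a b \<in> \<sigma> l" "\<alpha> + l + n \<le> top"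
  shows "runs w MatT s (275 * X ^ 3 * U) (\<lambda>t. \<forall>a<n. \<forall>b<n. snd t ''T'' a b = (\<Sum>i<n. A a i * L i b))"
  unfolding MatT_def
proof (rule runs_matrix[where X = X and B = "11 * X * U"])
  let ?D = "Dot (Cell ''T'' (V ''a'') (V ''b'')) ''i'' ''n'' (Cell ''A'' (V ''a'') (V ''i'')) (Cell ''L'' (V ''i'') (V ''b''))"
  fix a b t
  assume ab: "a < n" "b < n" "fst t ''a'' = a" "fst t ''b'' = b"
    and fr: "frame (insert ''a'' (insert ''b'' (imod ?D))) (rmod ?D) s t"
  have AL: "snd t ''A'' = snd s ''A''" "snd t ''L'' = snd s ''L''" "fst t ''n'' = n"
    using frame_snd[OF fr] frame_fst[OF fr] n by simp_all
  show "runs w ?D t (11 * X * U)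
     (\<lambda>t'. snd t' ''T'' = (snd t ''T'')(a := (snd t ''T'' a)(b := \<Sum>i<n. A a i * L i b)))"
    by (rule runs_Dot[where \<alpha> = \<alpha> and \<beta> = l and X = X]) (use ab AL X A L size in auto)
qed (use n X U_ge_1 in \<open>auto simp: power3_eq_cube power2_eq_square\<close>)

lemma runs_MatL:
  assumes n: "fst s ''n'' = n" and X: "n \<le> X" "1 \<le> X"
    and T: "\<And>a b. a < n \<Longrightarrow> b < n \<Longrightarrow> snd s ''T'' a b = T a b" and J: "snd s ''J'' 0 0 = J" "snd s ''z'' 0 0 = 0"
    and size: "\<And>a b. a < n \<Longrightarrow> b < n \<Longrightarrow> T a b \<in> \<sigma> \<alpha>" "J \<in> \<sigma> \<beta>" "Suc (\<beta> + \<alpha>) \<le> top"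
  shows "runs w MatL s (50 * X ^ 2 * U) (\<lambda>t. \<forall>a<n. \<forall>b<n. snd t ''L'' a b = 0 - J * T a b)"
  unfolding MatL_def
proof (rule runs_matrix[where X = X and B = "2 * U"])
  let ?c = "Cell ''L'' (V ''a'') (V ''b'')"
  let ?T = "Cell ''T'' (V ''a'') (V ''b'')"
  let ?s = "Sub (scal ''z'') (scal ''x'')"
  let ?m = "Mul (scal ''J'') ?T"
  fix a b t
  let ?P = "RAssign (scal ''x'') ?m"
  let ?R = "RAssign ?c ?s"
  assume ab: "a < n" "b < n" "fst t ''a'' = a" "fst t ''b'' = b"
    and fr: "frame (insert ''a'' (insert ''b'' (imod (Seq ?P ?R)))) (rmod (Seq ?P ?R)) s t"
  have T': "snd t ''T'' = snd s ''T''" "snd t ''J'' = snd s ''J''" "snd t ''z'' = snd s ''z''"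
    using frame_snd[OF fr] by simp_all
  have JT: "J * T a b \<in> \<sigma> (\<beta> + \<alpha>)"
    using mult[OF size(2) size(1)] ab by simp
  show "runs w (Seq ?P ?R) t (2 * U) (\<lambda>t'. snd t' ''L'' = (snd t ''L'')(a := (snd t ''L'' a)(b := 0 - J * T a b)))"
  proof (rule runs_Seq)
    have v: "cval (scal ''J'') t = J" "cval ?T t = T a b"
      using ab T J by (simp_all add: T')
    show "runs w ?P t U (\<lambda>t'. t' = store (scal ''x'') (J * T a b) t)"
    proof (rule runs_RAssign)
      show "rcost w ?m t \<le> U"
        by (rule rcost_le; unfold v) (use w_le[OF size(2)] w_le[OF size(1)[OF ab(1,2)]] w_le[OF JT] size(3) in auto)
    qed (simp only: rval.simps v)
  next
    fix t' assume t': "t' = store (scal ''x'') (J * T a b) t"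
    have v: "cval (scal ''z'') t' = 0" "cval (scal ''x'') t' = J * T a b"
      using J by (simp_all add: t' T')
    show "runs w ?R t' U (\<lambda>t'. snd t' ''L'' = (snd t ''L'')(a := (snd t ''L'' a)(b := 0 - J * T a b)))"
    proof (rule runs_RAssign)
      show "rcost w ?s t' \<le> U"
        by (rule rcost_le; unfold v) (use w_le[OF zero] w_le[OF JT] w_le[OF diff[OF zero_any JT]] size(3) in auto)
      show "snd (store ?c (rval ?s t') t') ''L'' =
         (snd t ''L'')(a := (snd t ''L'' a)(b := 0 - J * T a b))"
        unfolding rval.simps v using ab by (simp add: t')
    qed
  qed simp
qed (use n X U_ge_1 in auto)

lemma runs_DiagL:
  assumes n: "fst s ''n'' = n" and X: "n \<le> X" "1 \<le> X" and E: "snd s ''E'' 0 0 = E"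
    and size: "\<And>a. a < n \<Longrightarrow> snd s ''L'' a a \<in> \<sigma> \<alpha>" "E \<in> \<sigma> \<alpha>" "Suc \<alpha> \<le> top"
  shows "runs w DiagL s (5 * X * U) (\<lambda>t. \<forall>a b. snd t ''L'' a b = (if a = b \<and> a < n then snd s ''L'' a a + E else snd s ''L'' a b))"
  unfolding DiagL_def
proof (rule runs_diagonal[where X = X and B = U])
  let ?c = "Cell ''L'' (V ''a'') (V ''a'')"
  let ?a = "Add ?c (scal ''E'')"
  fix a t
  let ?P = "RAssign ?c ?a"
  assume a: "a < n" "fst t ''a'' = a" and fr: "frame (insert ''a'' (imod ?P)) (rmod ?P) s t"
    and L: "snd t ''L'' a a = snd s ''L'' a a"
  have v: "cval ?c t = snd s ''L'' a a" "cval (scal ''E'') t = E"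
    using frame_snd[OF fr, of "''E''"] a L E by simp_all
  show "runs w ?P t U (\<lambda>t'. snd t' ''L'' = (snd t ''L'')(a := (snd t ''L'' a)(a := snd s ''L'' a a + E)))"
  proof (rule runs_RAssign)
    show "rcost w ?a t \<le> U"
      by (rule rcost_le; unfold v)
        (use w_le[OF size(1)[OF a(1)]] w_le[OF size(2)] w_le[OF add[OF size(1)[OF a(1)] size(2)]] size(3) in auto)
    show "snd (store ?c (rval ?a t) t) ''L'' =
       (snd t ''L'')(a := (snd t ''L'' a)(a := snd s ''L'' a a + E))"
      unfolding rval.simps v using a by simp
  qed
qed (use n X U_ge_1 in auto)

lemma runs_ZeroL:
  assumes n: "fst s ''n'' = n" and X: "n \<le> X" "1 \<le> X"
  shows "runs w ZeroL s (25 * X ^ 2 * U) (\<lambda>t. \<forall>a<n. \<forall>b<n. snd t ''L'' a b = 0)"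
  unfolding ZeroL_def
  by (rule runs_matrix[where X = X and B = U])
    (use n X w_le[OF zero] in \<open>auto intro!: runs_RAssign simp: U_def\<close>)

lemma runs_OneL:
  assumes n: "fst s ''n'' = n" and X: "n \<le> X" "1 \<le> X"
  shows "runs w OneL s (5 * X * U) (\<lambda>t. \<forall>a b. snd t ''L'' a b = (if a = b \<and> a < n then 1 else snd s ''L'' a b))"
  unfolding OneL_def
  by (rule runs_diagonal[where X = X and B = U])
    (use n X w_le[OF one] in \<open>auto intro!: runs_RAssign simp: U_def\<close>)

lemma runs_DotN:
  assumes env: "env n d vf W s" and X: "n \<le> X" "1 \<le> X"
    and L: "\<And>a b. a < n \<Longrightarrow> b < n \<Longrightarrow> snd s ''L'' a b = L a b"
    and size: "\<And>i. i < n \<Longrightarrow> W i \<in> \<sigma> 1" "\<And>a b. a < n \<Longrightarrow> b < n \<Longrightarrow> L a b \<in> \<sigma> l" "1 + l + n \<le> top"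
  shows "runs w DotN s (11 * X * U) (\<lambda>t. snd t ''N'' 0 0 = (\<Sum>i<n. W i * L i i))"
proof (rule runs_mono)
  show "runs w DotN s (11 * X * U) (\<lambda>t. snd t ''N'' = (snd s ''N'')(0 := (snd s ''N'' 0)(0 := \<Sum>i<n. W i * L i i)))"
    unfolding DotN_def
    by (rule runs_Dot[where \<alpha> = 1 and \<beta> = l and X = X]) (use env X L size in \<open>auto simp: env_def\<close>)
qed auto

lemma runs_DotE:
  assumes n: "fst s ''n'' = n" and X: "n \<le> X" "1 \<le> X"
    and T: "\<And>a b. a < n \<Longrightarrow> b < n \<Longrightarrow> snd s ''T'' a b = T a b" and o: "snd s ''o'' 0 0 = 1"
    and size: "\<And>a b. a < n \<Longrightarrow> b < n \<Longrightarrow> T a b \<in> \<sigma> \<alpha>" "\<alpha> + n \<le> top"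
  shows "runs w DotE s (11 * X * U) (\<lambda>t. snd t ''E'' 0 0 = (\<Sum>i<n. T i i))"
proof (rule runs_mono)
  show "runs w DotE s (11 * X * U) (\<lambda>t. snd t ''E'' = (snd s ''E'')(0 := (snd s ''E'' 0)(0 := \<Sum>i<n. T i i * 1)))"
    unfolding DotE_def
    by (rule runs_Dot[where \<alpha> = \<alpha> and \<beta> = 0 and X = X]) (use n X T o size one in auto)
qed auto

lemma runs_Step:
  assumes env: "env n d vf W s" and X: "n \<le> X" "1 \<le> X"
    and A: "\<And>a b. a < n \<Longrightarrow> b < n \<Longrightarrow> snd s ''A'' a b = A a b"
    and L: "\<And>a b. a < n \<Longrightarrow> b < n \<Longrightarrow> snd s ''L'' a b = flv n A j a b"
    and c: "snd s ''J'' 0 0 = real j" "snd s ''o'' 0 0 = 1" "snd s ''z'' 0 0 = 0"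
    and size: "\<And>a b. a < n \<Longrightarrow> b < n \<Longrightarrow> A a b \<in> \<sigma> \<alpha>" "\<And>a b. a < n \<Longrightarrow> b < n \<Longrightarrow> flv n A j a b \<in> \<sigma> l"
      "\<And>i. i < n \<Longrightarrow> W i \<in> \<sigma> 1" "\<alpha> + l + 2 * n + j + 3 \<le> top"
  shows "runs w Step s (353 * X ^ 3 * U) (\<lambda>t. snd t ''J'' 0 0 = real (Suc j) \<and>
     (\<forall>a<n. \<forall>b<n. snd t ''L'' a b = flv n A (Suc j) a b) \<and>
     snd t ''N'' 0 0 = (\<Sum>i<n. W i * flv n A j i i) \<and> snd t ''E'' 0 0 = (\<Sum>i<n. \<Sum>l<n. A i l * flv n A j l i))"
proof (rule runs_mono[of _ _ _ "U + (11 * X * U + (275 * X ^ 3 * U + (11 * X * U + (50 * X ^ 2 * U + 5 * X * U))))"])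
  let ?B5 = "50 * X ^ 2 * U + 5 * X * U"
  let ?B4 = "11 * X * U + ?B5"
  let ?B3 = "275 * X ^ 3 * U + ?B4"
  let ?B2 = "11 * X * U + ?B3"
  let ?J = "RAssign (scal ''J'') (Add (scal ''J'') (scal ''o''))"
  let ?P5 = "Seq MatL DiagL"
  let ?P4 = "Seq DotE ?P5"
  let ?P3 = "Seq MatT ?P4"
  let ?sN = "(\<Sum>i<n. W i * flv n A j i i)"
  define T where "T a b = (\<Sum>l<n. A a l * flv n A j l b)" for a b
  define E where "E = (\<Sum>i<n. T i i)"
  have sT: "T a b \<in> \<sigma> (\<alpha> + l + n)" if "a < n" "b < n" for a b
    unfolding T_def by (rule size_sum) (use that size in \<open>auto intro: mult\<close>)
  have sE: "E \<in> \<sigma> (\<alpha> + l + n + n)"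
    unfolding E_def by (rule size_sum) (use sT in auto)
  let ?Q = "\<lambda>t. snd t ''J'' 0 0 = real (Suc j) \<and> (\<forall>a<n. \<forall>b<n. snd t ''L'' a b = flv n A (Suc j) a b) \<and>
     snd t ''N'' 0 0 = ?sN \<and> snd t ''E'' 0 0 = E"
  show "runs w Step s (U + ?B2) ?Q"
    unfolding Step_def
  proof (rule runs_Seq[OF _ _ order_refl])
    have v: "cval (scal ''J'') s = real j" "cval (scal ''o'') s = 1"
      using c by simp_all
    show "runs w ?J s U (\<lambda>t. snd t ''J'' 0 0 = real (Suc j))"
    proof (rule runs_RAssign)
      show "rcost w (Add (scal ''J'') (scal ''o'')) s \<le> U"
      proof (rule rcost_le; unfold v)
        show "w (real j) \<le> len"
          by (rule w_le[OF size_of_nat]) (use size(4) in simp)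
        show "w 1 \<le> len"
          by (rule w_le[OF one]) simp
        have "w (real (Suc j)) \<le> len"
          by (rule w_le[OF size_of_nat]) (use size(4) in simp)
        then show "w (real j + 1) \<le> len"
          by (simp add: add.commute)
      qed
    qed (use c in simp)
  next
    fix s1 assume J: "snd s1 ''J'' 0 0 = real (Suc j)"
      and fr: "frame (imod ?J) (rmod ?J) s s1"
    have fr1: "frame {} {''J''} s s1"
      using fr by simp
    have env1: "env n d vf W s1"
      by (rule env_frame[OF env fr1]) auto
    show "runs w (Seq DotN ?P3) s1
       ?B2 ?Q"
    proof (rule runs_Seq[OF _ _ order_refl])
      show "runs w DotN s1 (11 * X * U) (\<lambda>t. snd t ''N'' 0 0 = ?sN)"
        by (rule runs_DotN[OF env1 X, where L = "flv n A j" and l = l]) (use frame_snd[OF fr1, of "''L''"] L size in auto)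
    next
      fix s2 assume NN: "snd s2 ''N'' 0 0 = ?sN"
        and fr2: "frame (imod DotN) (rmod DotN) s1 s2"
      have f2: "frame {''i''} {''J'', ''N'', ''x''} s s2"
        by (rule frame_trans[OF fr1 fr2]) auto
      have J2: "snd s2 ''J'' 0 0 = real (Suc j)"
        using frame_snd[OF fr2, of "''J''"] J by simp
      show "runs w ?P3 s2
         ?B3 ?Q"
      proof (rule runs_Seq[OF _ _ order_refl])
        show "runs w MatT s2 (275 * X ^ 3 * U) (\<lambda>t. \<forall>a<n. \<forall>b<n. snd t ''T'' a b = T a b)"
          unfolding T_def
          by (rule runs_MatT[where A = A and L = "flv n A j" and \<alpha> = \<alpha> and l = l])
            (use X env frame_fst[OF f2, of "''n''"] frame_snd[OF f2] A L size in \<open>auto simp: env_def\<close>)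
      next
        fix s3 assume TT: "\<forall>a<n. \<forall>b<n. snd s3 ''T'' a b = T a b" and fr3: "frame (imod MatT) (rmod MatT) s2 s3"
        have f3: "frame {''a'', ''b'', ''i''} {''J'', ''N'', ''x'', ''T''} s s3"
          by (rule frame_trans[OF f2 fr3]) auto
        have J3: "snd s3 ''J'' 0 0 = real (Suc j)" "snd s3 ''N'' 0 0 = ?sN"
          using frame_snd[OF fr3] J2 NN by simp_all
        show "runs w ?P4 s3 ?B4 ?Q"
        proof (rule runs_Seq[OF _ _ order_refl])
          show "runs w DotE s3 (11 * X * U) (\<lambda>t. snd t ''E'' 0 0 = E)"
            unfolding E_def
            by (rule runs_DotE[where T = T and \<alpha> = "\<alpha> + l + n"])
              (use X env frame_fst[OF f3] frame_snd[OF f3] TT c sT size(4) in \<open>auto simp: env_def\<close>)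
        next
          fix s4 assume EE: "snd s4 ''E'' 0 0 = E" and fr4: "frame (imod DotE) (rmod DotE) s3 s4"
          have f4: "frame {''a'', ''b'', ''i''} {''J'', ''N'', ''x'', ''T'', ''E''} s s4"
            by (rule frame_trans[OF f3 fr4]) auto
          have J4: "snd s4 ''J'' 0 0 = real (Suc j)" "snd s4 ''N'' 0 0 = ?sN"
            "\<forall>a<n. \<forall>b<n. snd s4 ''T'' a b = T a b"
            using frame_snd[OF fr4] J3 TT by simp_all
          show "runs w ?P5 s4 ?B5 ?Q"
          proof (rule runs_Seq[OF _ _ order_refl])
            show "runs w MatL s4 (50 * X ^ 2 * U) (\<lambda>t. \<forall>a<n. \<forall>b<n. snd t ''L'' a b = 0 - real (Suc j) * T a b)"
              by (rule runs_MatL[where T = T and \<alpha> = "\<alpha> + l + n" and \<beta> = "Suc j"])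
                (use X env frame_fst[OF f4] frame_snd[OF f4] J4 c sT size(4) size_of_nat[of "Suc j"] in \<open>auto simp: env_def\<close>)
          next
            fix s5 assume LL: "\<forall>a<n. \<forall>b<n. snd s5 ''L'' a b = 0 - real (Suc j) * T a b" and fr5: "frame (imod MatL) (rmod MatL) s4 s5"
            have J5: "snd s5 ''J'' 0 0 = real (Suc j)" "snd s5 ''N'' 0 0 = ?sN" "snd s5 ''E'' 0 0 = E"
              "fst s5 ''n'' = n"
              using frame_snd[OF fr5] J4 EE
                frame_fst[OF fr5] frame_fst[OF f4] env by (simp_all add: env_def)
            let ?\<beta> = "\<alpha> + l + 2 * n + j + 2"
            have sL: "snd s5 ''L'' a a \<in> \<sigma> ?\<beta>" if "a < n" for a
            proof -
              have "0 - real (Suc j) * T a a \<in> \<sigma> (Suc (Suc j + (\<alpha> + l + n)))"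
                by (rule diff[OF zero_any mult[OF size_of_nat sT]]) (use that in auto)
              then show ?thesis
                using LL that by (auto intro: size_mono)
            qed
            have sE': "E \<in> \<sigma> ?\<beta>"
              by (rule size_mono[OF sE]) simp
            have "runs w DiagL s5 (5 * X * U) (\<lambda>t. \<forall>a b. snd t ''L'' a b = (if a = b \<and> a < n then snd s5 ''L'' a a + E else snd s5 ''L'' a b))"
              by (rule runs_DiagL[OF J5(4) X J5(3) sL sE']) (use size(4) in auto)
            then show "runs w DiagL s5 (5 * X * U) ?Q"
            proof (rule runs_frame[OF _ order_refl])
              fix t assume L': "\<forall>a b. snd t ''L'' a b = (if a = b \<and> a < n then snd s5 ''L'' a a + E else snd s5 ''L'' a b)"
                and fr6: "frame (imod DiagL) (rmod DiagL) s5 t"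
              have "snd t ''L'' a b = flv n A (Suc j) a b" if "a < n" "b < n" for a b
                using that LL by (simp add: L' T_def E_def)
              moreover have "snd t ''J'' = snd s5 ''J''" "snd t ''N'' = snd s5 ''N''" "snd t ''E'' = snd s5 ''E''"
                using frame_snd[OF fr6] by simp_all
              ultimately show "?Q t"
                using J5 by simp
            qed
          qed
        qed
      qed
    qed
  qed
  show "?Q t \<Longrightarrow> snd t ''J'' 0 0 = real (Suc j) \<and>
     (\<forall>a<n. \<forall>b<n. snd t ''L'' a b = flv n A (Suc j) a b) \<and>
     snd t ''N'' 0 0 = ?sN \<and> snd t ''E'' 0 0 = (\<Sum>i<n. \<Sum>l<n. A i l * flv n A j l i)" for t
    by (simp add: E_def T_def)
  have p: "X ^ a * U \<le> X ^ 3 * U" if "a \<le> 3" for a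
    using that X by (intro mult_right_mono power_increasing) auto
  have q: "U \<le> X ^ 3 * U" "X * U \<le> X ^ 3 * U" "X ^ 2 * U \<le> X ^ 3 * U"
    using p[of 0] p[of 1] p[of 2] by simp_all
  \<comment> \<open>353 is 1 + 11 + 275 + 11 + 50 + 5, with all powers raised to the third.\<close>
  show "U + ?B2 \<le> 353 * X ^ 3 * U"
    using q unfolding mult.assoc by linarith
qed

lemma flv_size:
  assumes "\<And>a b. a < n \<Longrightarrow> b < n \<Longrightarrow> A a b \<in> \<sigma> \<alpha>"
  shows "j \<le> k \<Longrightarrow> a < n \<Longrightarrow> b < n \<Longrightarrow> flv n A j a b \<in> \<sigma> (j * (\<alpha> + 2 * n + k + 2))"
proof (induction j arbitrary: a b)
  case 0
  then show ?case
    by (simp add: zero one)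
next
  case (Suc j)
  define l where "l = j * (\<alpha> + 2 * n + k + 2)"
  have T: "(\<Sum>i<n. A a i * flv n A j i b) \<in> \<sigma> (\<alpha> + l + n)" if "a < n" "b < n" for a b
    by (rule size_sum) (use that assms Suc in \<open>auto simp: l_def intro!: mult\<close>)
  have "(\<Sum>i<n. \<Sum>l<n. A i l * flv n A j l i) \<in> \<sigma> (\<alpha> + l + n + n)"
    by (rule size_sum) (use T in auto)
  then have 1: "(if a = b then \<Sum>i<n. \<Sum>l<n. A i l * flv n A j l i else 0) \<in> \<sigma> (l + (\<alpha> + 2 * n + k + 1))"
    by (auto intro: size_mono zero_any)
  have "real (Suc j) * (\<Sum>l<n. A a l * flv n A j l b) \<in> \<sigma> (Suc j + (\<alpha> + l + n))"
    by (rule mult[OF size_of_nat T]) (use Suc in auto)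
  then have 2: "real (Suc j) * (\<Sum>l<n. A a l * flv n A j l b) \<in> \<sigma> (l + (\<alpha> + 2 * n + k + 1))"
    by (rule size_mono) (use Suc in auto)
  show ?case
    using diff[OF 1 2] by (simp add: l_def add_ac)
qed

lemma wgram_size:
  assumes "\<And>i a. i < n \<Longrightarrow> a < d \<Longrightarrow> vf i a \<in> \<sigma> 1" "\<And>i. i < n \<Longrightarrow> W i \<in> \<sigma> 1" "a < n" "b < n"
  shows "wgram d vf W a b \<in> \<sigma> (3 + d)"
proof -
  have "ip d (vf a) (vf b) \<in> \<sigma> (2 + d)"
    unfolding ip_def by (rule size_sum) (use mult[OF assms(1) assms(1)] assms(3,4) in \<open>auto simp: numeral_2_eq_2\<close>)
  then have "wgram d vf W a b \<in> \<sigma> (1 + (2 + d))"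
    by (rule mult[OF assms(2)[OF assms(3)]])
  then show ?thesis
    by (simp add: numeral_3_eq_3)
qed

text \<open>The deletion test multiplies two numbers of this size, which is why the classes have to
  reach \<open>2 * size_bound n d k\<close>.\<close>

lemma Eval_size:
  assumes k: "0 < k"
    and size: "\<And>i a. i < n \<Longrightarrow> a < d \<Longrightarrow> vf i a \<in> \<sigma> 1" "\<And>i. i < n \<Longrightarrow> W i \<in> \<sigma> 1"
  shows "fact (k - 1) * enum n d vf W k \<in> \<sigma> (size_bound n d k)" "fact k * esym n d vf W k \<in> \<sigma> (size_bound n d k)"
proof -
  let ?A = "wgram d vf W" and ?\<alpha> = "3 + d"
  let ?h = "?\<alpha> + 2 * n + k + 2"
  have sb: "size_bound n d k = k * ?h + ?h"
    by (simp add: size_bound_def algebra_simps)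
  note sA = wgram_size[OF size]
  have fl: "flv n ?A (k - 1) a b \<in> \<sigma> ((k - 1) * ?h)" if "a < n" "b < n" for a b
    by (rule flv_size[OF sA]) (use k that in auto)
  have "(\<Sum>i<n. W i * flv n ?A (k - 1) i i) \<in> \<sigma> (1 + (k - 1) * ?h + n)"
    by (rule size_sum) (use fl size(2) in \<open>auto intro!: mult[of _ 1, simplified]\<close>)
  moreover have "(\<Sum>i<n. \<Sum>l<n. ?A i l * flv n ?A (k - 1) l i) \<in> \<sigma> (?\<alpha> + (k - 1) * ?h + n + n)"
    by (intro size_sum mult sA fl) auto
  moreover have "?\<alpha> + (k - 1) * ?h + n + n \<le> size_bound n d k" "1 + (k - 1) * ?h + n \<le> size_bound n d k"
  proof -
    have "(k - 1) * ?h + ?h = k * ?h"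
      using k by (cases k) auto
    then show "?\<alpha> + (k - 1) * ?h + n + n \<le> size_bound n d k" "1 + (k - 1) * ?h + n \<le> size_bound n d k"
      unfolding sb by linarith+
  qed
  ultimately have "(\<Sum>i<n. W i * flv n ?A (k - 1) i i) \<in> \<sigma> (size_bound n d k)"
      "(\<Sum>i<n. \<Sum>l<n. ?A i l * flv n ?A (k - 1) l i) \<in> \<sigma> (size_bound n d k)"
    by (meson size_mono)+
  moreover have "Suc (k - 1) = k"
    using k by simp
  ultimately show "fact (k - 1) * enum n d vf W k \<in> \<sigma> (size_bound n d k)" "fact k * esym n d vf W k \<in> \<sigma> (size_bound n d k)"
    using flv_enum[where n = n and W = W and d = d and v = vf and k = k]
      flv_trace[where n = n and W = W and d = d and v = vf and j = "k - 1"] by (simp_all del: fact_Suc)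
qed

lemma runs_Eval:
  assumes env: "env n d vf W s" and k: "fst s ''k'' = k" "0 < k" "k \<le> X" and X: "n \<le> X" "d \<le> X" "1 \<le> X"
    and size: "\<And>i a. i < n \<Longrightarrow> a < d \<Longrightarrow> vf i a \<in> \<sigma> 1" "\<And>i. i < n \<Longrightarrow> W i \<in> \<sigma> 1" "2 * size_bound n d k \<le> top"
  shows "runs w Eval s (2100 * X ^ 4 * U) (\<lambda>t. snd t ''N'' 0 0 = fact (k - 1) * enum n d vf W k \<and>
    snd t ''E'' 0 0 = fact k * esym n d vf W k)"
proof (rule runs_mono[of _ _ _ "U + (U + (U + (300 * X ^ 3 * U + (25 * X ^ 2 * U + (5 * X * U + 5 * X * (353 * X ^ 3 * U))))))"])
  let ?B7 = "5 * X * (353 * X ^ 3 * U)"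
  let ?B6 = "5 * X * U + ?B7"
  let ?B5 = "25 * X ^ 2 * U + ?B6"
  let ?B4 = "300 * X ^ 3 * U + ?B5"
  let ?B3 = "U + ?B4"
  let ?F = "For ''j'' ''k'' Step"
  let ?P6 = "Seq OneL ?F"
  let ?P5 = "Seq ZeroL ?P6"
  let ?P4 = "Seq MatA ?P5"
  let ?o = "RAssign (scal ''o'') (Const 1)"
  let ?z = "RAssign (scal ''z'') (Const 0)"
  let ?J = "RAssign (scal ''J'') (Const 0)"
  let ?A = "wgram d vf W" and ?\<alpha> = "3 + d"
  let ?h = "?\<alpha> + 2 * n + k + 2"
  note sA = wgram_size[OF size(1,2)]
  have sb: "size_bound n d k = k * ?h + ?h"
    by (simp add: size_bound_def algebra_simps)
  have top_ge: "j * ?h + (?\<alpha> + 2 * n + j + 3) \<le> top" if "j < k" for j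
  proof -
    have "j * ?h + (?\<alpha> + 2 * n + j + 3) \<le> j * ?h + ?h "
      using that by simp
    also have "\<dots> \<le> k * ?h"
      using that mult_le_mono1[of "Suc j" k ?h] by simp
    also have "\<dots> \<le> size_bound n d k"
      by (simp add: sb)
    finally show ?thesis
      using size(3) by simp
  qed
  have top1: "3 + d \<le> top"
    using top_ge[OF k(2)] by simp
  let ?Q = "\<lambda>t. snd t ''N'' 0 0 = (\<Sum>i<n. W i * flv n ?A (k - 1) i i) \<and> snd t ''E'' 0 0 = (\<Sum>i<n. \<Sum>l<n. ?A i l * flv n ?A (k - 1) l i)"
  show "runs w Eval s (U + (U + ?B3)) ?Q"
    unfolding Eval_def
  proof (rule runs_Seq[OF _ _ order_refl])
    show "runs w ?o s U (\<lambda>t. snd t ''o'' 0 0 = 1)"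
      by (rule runs_RAssign) (use w_le[OF one] in \<open>auto simp: U_def\<close>)
  next
    fix s1 assume o1: "snd s1 ''o'' 0 0 = 1" and fr1: "frame (imod ?o) (rmod ?o) s s1"
    have f1: "frame {} {''o''} s s1"
      using fr1 by simp
    show "runs w (Seq ?z (Seq ?J ?P4)) s1
       (U + ?B3) ?Q"
    proof (rule runs_Seq[OF _ _ order_refl])
      show "runs w ?z s1 U (\<lambda>t. snd t ''z'' 0 0 = 0 \<and> snd t ''o'' 0 0 = 1)"
        by (rule runs_RAssign) (use w_le[OF zero] o1 in \<open>auto simp: U_def\<close>)
    next
      fix s2 assume o2: "snd s2 ''z'' 0 0 = 0 \<and> snd s2 ''o'' 0 0 = 1" and fr2: "frame (imod ?z) (rmod ?z) s1 s2"
      have f2: "frame {} {''o'', ''z''} s s2"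
        by (rule frame_trans[OF f1 fr2]) auto
      show "runs w (Seq ?J ?P4) s2
         ?B3 ?Q"
      proof (rule runs_Seq[OF _ _ order_refl])
        show "runs w ?J s2 U (\<lambda>t. snd t ''z'' 0 0 = 0 \<and> snd t ''o'' 0 0 = 1 \<and> snd t ''J'' 0 0 = 0)"
          by (rule runs_RAssign) (use w_le[OF zero] o2 in \<open>auto simp: U_def\<close>)
      next
        fix s3 assume o3: "snd s3 ''z'' 0 0 = 0 \<and> snd s3 ''o'' 0 0 = 1 \<and> snd s3 ''J'' 0 0 = 0"
          and fr3: "frame (imod ?J) (rmod ?J) s2 s3"
        have f3: "frame {} {''o'', ''z'', ''J''} s s3"
          by (rule frame_trans[OF f2 fr3]) auto
        have env3: "env n d vf W s3"
          by (rule env_frame[OF env f3]) auto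
        show "runs w ?P4 s3
           ?B4 ?Q"
        proof (rule runs_Seq[OF _ _ order_refl])
          show "runs w MatA s3 (300 * X ^ 3 * U) (\<lambda>t. \<forall>a<n. \<forall>b<n. snd t ''A'' a b = ?A a b)"
            by (rule runs_MatA[OF env3 X size(1,2) top1])
        next
          fix s4 assume A4: "\<forall>a<n. \<forall>b<n. snd s4 ''A'' a b = ?A a b" and fr4: "frame (imod MatA) (rmod MatA) s3 s4"
          have env4: "env n d vf W s4"
            by (rule env_frame[OF env3 fr4]) auto
          show "runs w ?P5 s4
             ?B5 ?Q"
          proof (rule runs_Seq[OF _ _ order_refl])
            show "runs w ZeroL s4 (25 * X ^ 2 * U) (\<lambda>t. \<forall>a<n. \<forall>b<n. snd t ''L'' a b = 0)"
              by (rule runs_ZeroL) (use env4 X in \<open>auto simp: env_def\<close>)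
          next
            fix s5 assume L5: "\<forall>a<n. \<forall>b<n. snd s5 ''L'' a b = 0" and fr5: "frame (imod ZeroL) (rmod ZeroL) s4 s5"
            have env5: "env n d vf W s5"
              by (rule env_frame[OF env4 fr5]) auto
            show "runs w ?P6 s5 ?B6 ?Q"
            proof (rule runs_Seq[OF _ _ order_refl])
              show "runs w OneL s5 (5 * X * U) (\<lambda>t. \<forall>a b. snd t ''L'' a b = (if a = b \<and> a < n then 1 else snd s5 ''L'' a b))"
                by (rule runs_OneL) (use env5 X in \<open>auto simp: env_def\<close>)
            next
              fix s6 assume L6: "\<forall>a b. snd s6 ''L'' a b = (if a = b \<and> a < n then 1 else snd s5 ''L'' a b)"
                and fr6: "frame (imod OneL) (rmod OneL) s5 s6"
              have env6: "env n d vf W s6"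
                by (rule env_frame[OF env5 fr6]) auto
              have f46: "frame {''a'', ''b''} {''L''} s4 s6"
                by (rule frame_trans[OF fr5 fr6]) auto
              have f36: "frame {''a'', ''b'', ''i''} {''A'', ''x'', ''L''} s3 s6"
                by (rule frame_trans[OF fr4 f46]) auto
              have f6: "frame {''a'', ''b'', ''i''} {''o'', ''z'', ''J'', ''A'', ''x'', ''L''} s s6"
                by (rule frame_trans[OF f3 f36]) auto
              have o6: "snd s6 ''z'' 0 0 = 0" "snd s6 ''o'' 0 0 = 1" "snd s6 ''J'' 0 0 = 0"
                using frame_snd[OF f36] o3 by simp_all
              have A6: "snd s6 ''A'' a b = ?A a b" if "a < n" "b < n" for a b
                using frame_snd[OF f46, of "''A''"] A4 that by simp
              \<comment> \<open>Before the first round \<open>''N''\<close> and \<open>''E''\<close>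
                hold nothing meaningful, hence the guard; afterwards they lag one index behind
                \<open>''L''\<close>.\<close>
              let ?I = "\<lambda>j S. S ''J'' 0 0 = real j \<and> (\<forall>a<n. \<forall>b<n. S ''L'' a b = flv n ?A j a b) \<and>
                (0 < j \<longrightarrow> S ''N'' 0 0 = (\<Sum>i<n. W i * flv n ?A (j - 1) i i) \<and> S ''E'' 0 0 = (\<Sum>i<n. \<Sum>l<n. ?A i l * flv n ?A (j - 1) l i))"
              have "runs w ?F s6 ?B7 (\<lambda>t. ?I k (snd t))"
              proof (rule runs_For[where I = ?I and X = X and B = "353 * X ^ 3 * U"])
                show "fst s6 ''k'' = k"
                  using frame_fst[OF f6, of "''k''"] k by simp
                show "?I 0 (snd s6)"
                  using o6 L5 L6 by auto
                have "1 \<le> X ^ 3"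
                  using X(3) by simp
                then show "1 \<le> 353 * X ^ 3 * U"
                  using U_ge_1 mult_le_mono[of 1 "353 * X ^ 3" 1 U] by simp
                fix j t assume j: "j < k" "?I j (snd t)" and fr: "frame (insert ''j'' (imod Step)) (rmod Step) s6 t"
                have "runs w Step t (353 * X ^ 3 * U) (\<lambda>t. snd t ''J'' 0 0 = real (Suc j) \<and>
                   (\<forall>a<n. \<forall>b<n. snd t ''L'' a b = flv n ?A (Suc j) a b) \<and>
                   snd t ''N'' 0 0 = (\<Sum>i<n. W i * flv n ?A j i i) \<and> snd t ''E'' 0 0 = (\<Sum>i<n. \<Sum>l<n. ?A i l * flv n ?A j l i))"
                proof (rule runs_Step[where \<alpha> = ?\<alpha> and l = "j * ?h" and d = d and vf = vf])
                  show "env n d vf W t"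
                    by (rule env_frame[OF env6 fr]) auto
                  show "snd t ''A'' a b = ?A a b" if "a < n" "b < n" for a b
                    using frame_snd[OF fr, of "''A''"] A6 that by simp
                  show "flv n ?A j a b \<in> \<sigma> (j * ?h)" if "a < n" "b < n" for a b
                    by (rule flv_size[OF sA]) (use j that in auto)
                  show "?\<alpha> + j * ?h + 2 * n + j + 3 \<le> top"
                    using top_ge[OF j(1)] by simp
                qed (use X j size(2) sA o6 frame_snd[OF fr] in auto)
                then show "runs w Step t (353 * X ^ 3 * U) (\<lambda>t'. ?I (Suc j) (snd t'))"
                  by (rule runs_mono) auto
              qed (use k X in auto)
              then show "runs w ?F s6 ?B7 ?Q"
                by (rule runs_mono) (use k in auto)
            qed
          qed
        qed
      qed
    qed
  qed
  have "Suc (k - 1) = k"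
    using k(2) by simp
  then show "?Q t \<Longrightarrow> snd t ''N'' 0 0 = fact (k - 1) * enum n d vf W k \<and> snd t ''E'' 0 0 = fact k * esym n d vf W k" for t
    using flv_enum[where n = n and W = W and d = d and v = vf and k = k]
      flv_trace[where n = n and W = W and d = d and v = vf and j = "k - 1"] by (simp del: fact_Suc)
  have p: "X ^ a * U \<le> X ^ 4 * U" if "a \<le> 4" for a
    using that X by (intro mult_right_mono power_increasing) auto
  have q: "U \<le> X ^ 4 * U" "X * U \<le> X ^ 4 * U" "X ^ 2 * U \<le> X ^ 4 * U" "X ^ 3 * U \<le> X ^ 4 * U"
    using p[of 0] p[of 1] p[of 2] p[of 3] by simp_all
  \<comment> \<open>The loop gives 5 times 353; together with 3 + 300 + 25 + 5 this is 2098.\<close>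
  have "?B7 = 1765 * (X ^ 4 * U)"
    using power_Suc[of X 3] by simp
  then show "U + (U + ?B3) \<le> 2100 * X ^ 4 * U"
    using q unfolding mult.assoc by linarith
qed

end

section \<open>The deletion algorithm\<close>

text \<open>The array \<open>''u''\<close> is never written and serves as the constant 0, so the
  guard tests membership of q as 0 < S q. \<open>''P''\<close> and \<open>''Q''\<close> hold the
  initial numerator and denominator. A rejected deletion is undone by reloading the weight from
  \<open>''c''\<close>.\<close>

definition Try :: com where
  "Try = Cond (BAnd (ILess (V ''k'') (V ''m'')) (RLess (scal ''u'') (Cell ''S'' (V ''q'') (N 0))))
     (Seq (RAssign (Cell ''W'' (V ''q'') (N 0)) (Const 0))
       (Seq Eval
         (Seq (RAssign (scal ''x'') (Mul (scal ''N'') (scal ''Q'')))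
           (Seq (RAssign (scal ''y'') (Mul (scal ''P'') (scal ''E'')))
             (Cond (BAnd (BNot (RLess (scal ''y'') (scal ''x''))) (RLess (scal ''u'') (scal ''E'')))
               (Seq (RAssign (Cell ''S'' (V ''q'') (N 0)) (Const 0)) (IAssign ''m'' (Minus (V ''m'') (N 1))))
               (RAssign (Cell ''W'' (V ''q'') (N 0)) (Load (Cell ''c'' (V ''q'') (N 0)))))))))
     Skip"

definition Init :: com where
  "Init = For ''a'' ''n'' (Seq (RAssign (Cell ''W'' (V ''a'') (N 0)) (Load (Cell ''c'' (V ''a'') (N 0))))
     (RAssign (Cell ''S'' (V ''a'') (N 0)) (Const 1)))"

text \<open>A single pass is not known to suffice: an accepted deletion changes the weights, so an
  index rejected earlier may become deletable. Every pass that begins with more than k indices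
  removes at least one, so n passes are enough.\<close>

definition Prog :: com where
  "Prog = Seq Init (Seq (IAssign ''m'' (V ''n'')) (Seq Eval
     (Seq (RAssign (scal ''P'') (Load (scal ''N''))) (Seq (RAssign (scal ''Q'') (Load (scal ''E'')))
       (For ''p'' ''n'' (For ''q'' ''n'' Try))))))"

lemma mod_Try [simp]: "imod Try = {''a'', ''b'', ''i'', ''j'', ''m''}"
  "rmod Try = {''o'', ''z'', ''A'', ''J'', ''N'', ''T'', ''E'', ''L'', ''x'', ''y'', ''W'', ''S''}"
  by (auto simp: Try_def)

lemma mod_Init [simp]: "imod Init = {''a''}" "rmod Init = {''W'', ''S''}"
  by (auto simp: Init_def)

lemma esym_cong:
  assumes "\<And>i. i < n \<Longrightarrow> W i = W' i"
  shows "esym n d v W k = esym n d v W' k"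
  unfolding esym_def by (intro sum.cong refl arg_cong2[where f = "(*)"] prod.cong) (auto simp: subs_def assms)

lemma enum_cong:
  assumes "\<And>i. i < n \<Longrightarrow> W i = W' i"
  shows "enum n d v W k = enum n d v W' k"
  unfolding enum_def by (intro sum.cong arg_cong2[where f = "(*)"] esym_cong) (auto simp: assms)

section \<open>The deletion process on index sets\<close>

locale deletion =
  fixes n d :: nat and vf :: "nat \<Rightarrow> nat \<Rightarrow> real" and cf :: "nat \<Rightarrow> real" and k :: nat
  assumes k_pos: "0 < k" and k_le: "k \<le> n" and cf_nonneg: "\<And>i. 0 \<le> cf i" and cf_zero: "\<And>i. n \<le> i \<Longrightarrow> cf i = 0"
    and esym_pos: "0 < esym n d vf cf k"
begin

definition wt :: "nat set \<Rightarrow> nat \<Rightarrow> real" where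
  "wt A i = (if i \<in> A then cf i else 0)"

text \<open>The comparison is with the initial ratio rather than that of the preceding stage, so two
  stored numbers serve for all tests. Cross multiplication avoids division.\<close>

definition ok :: "nat set \<Rightarrow> bool" where
  "ok A \<longleftrightarrow> 0 < esym n d vf (wt A) k \<and> enum n d vf (wt A) k * esym n d vf cf k \<le> enum n d vf cf k * esym n d vf (wt A) k"

definition step :: "nat set \<Rightarrow> nat \<Rightarrow> nat set" where
  "step A q = (if k < card A \<and> q \<in> A \<and> ok (A - {q}) then A - {q} else A)"

fun sweep :: "nat set \<Rightarrow> nat \<Rightarrow> nat set" where
  "sweep A 0 = A"
| "sweep A (Suc q) = step (sweep A q) q"

fun alive :: "nat \<Rightarrow> nat set" where
  "alive 0 = {..<n}"
| "alive (Suc p) = sweep (alive p) n"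

definition valid :: "nat set \<Rightarrow> bool" where
  "valid A \<longleftrightarrow> A \<subseteq> {..<n} \<and> k \<le> card A \<and> ok A"

lemma wt_full: "wt {..<n} = cf"
  using cf_zero by (auto simp: wt_def)

lemma wt_delete: "wt (A - {q}) = (wt A)(q := 0)"
  by (auto simp: wt_def)

lemma valid_full: "valid {..<n}"
  using k_le esym_pos by (simp add: valid_def ok_def wt_full)

lemma valid_step:
  assumes "valid A"
  shows "valid (step A q)"
proof -
  have "finite A"
    using assms finite_subset by (auto simp: valid_def)
  then show ?thesis
    using assms by (auto simp: valid_def step_def)
qed

lemma valid_sweep: "valid A \<Longrightarrow> valid (sweep A q)"
  by (induction q) (auto intro: valid_step)

lemma valid_alive: "valid (alive p)"
  by (induction p) (auto intro: valid_full valid_sweep)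

lemma sweep_mono: "q \<le> r \<Longrightarrow> sweep A r \<subseteq> sweep A q"
proof (induction r)
  case (Suc r)
  then show ?case
    by (cases "q = Suc r") (auto simp: step_def)
qed simp

text \<open>If a pass removed nothing, every test would have been made with the same set
  \<open>A\<close> and failed, contrary to \<open>exists_deletable\<close>.\<close>

lemma sweep_decreases:
  assumes A: "valid A" and k: "k < card A"
  shows "card (sweep A n) < card A"
proof (rule ccontr)
  have fA: "finite A"
    using A finite_subset by (auto simp: valid_def)
  assume "\<not> card (sweep A n) < card A"
  then have "sweep A n = A"
    using sweep_mono[of 0 n A] card_subset_eq[OF fA] card_mono[OF fA] by (metis le0 le_antisym not_le sweep.simps(1))
  then have same: "sweep A q = A" if "q \<le> n" for q
    using sweep_mono[OF that, of A] sweep_mono[of 0 q A] by simp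
  have no: "\<not> ok (A - {q})" if "q \<in> A" for q
  proof
    assume "ok (A - {q})"
    have q: "q < n"
      using A that by (auto simp: valid_def)
    have "step A q = A"
      using same[of q] same[of "Suc q"] q by simp
    then show False
      using \<open>ok (A - {q})\<close> k that by (auto simp: step_def split: if_splits)
  qed
  obtain i where "i \<in> A" "0 < esym n d vf ((wt A)(i := 0)) k"
    "enum n d vf ((wt A)(i := 0)) k * esym n d vf cf k \<le> enum n d vf cf k * esym n d vf ((wt A)(i := 0)) k"
  proof (rule exists_deletable)
    show "A \<subseteq> {..<n}" "0 < esym n d vf (wt A) k"
      "enum n d vf (wt A) k * esym n d vf cf k \<le> enum n d vf cf k * esym n d vf (wt A) k"
      using A by (auto simp: valid_def ok_def)
    show "0 \<le> enum n d vf cf k"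
      by (rule enum_nonneg) (rule cf_nonneg)
  qed (use k k_pos esym_pos in \<open>auto simp: wt_def cf_nonneg\<close>)
  then show False
    using no unfolding ok_def wt_delete by blast
qed

lemma card_alive: "card (alive p) \<le> max k (n - p)"
proof (induction p)
  case (Suc p)
  have "finite (alive p)"
    using valid_alive[of p] finite_subset by (auto simp: valid_def)
  then have le: "card (sweep (alive p) n) \<le> card (alive p)"
    using sweep_mono[of 0 n "alive p"] by (auto intro: card_mono)
  show ?case
  proof (cases "k < card (alive p)")
    case True
    then show ?thesis
      using sweep_decreases[OF valid_alive True] Suc by auto
  qed (use le in auto)
qed simp

lemma card_alive_final: "card (alive n) = k"
  using card_alive[of n] valid_alive[of n] by (simp add: valid_def)

definition invar :: "nat set \<Rightarrow> state \<Rightarrow> bool" where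
  "invar A t \<longleftrightarrow> valid A \<and> env n d vf (wt A) t \<and> fst t ''k'' = k \<and> fst t ''m'' = card A \<and>
     (\<forall>i. snd t ''c'' i 0 = cf i) \<and> snd t ''u'' 0 0 = 0 \<and> (\<forall>i<n. snd t ''S'' i 0 = (if i \<in> A then 1 else 0)) \<and>
     snd t ''P'' 0 0 = fact (k - 1) * enum n d vf cf k \<and> snd t ''Q'' 0 0 = fact k * esym n d vf cf k"

lemma invar_indep: "invar A t \<Longrightarrow> x \<notin> {''n'', ''d'', ''k'', ''m''} \<Longrightarrow> invar A ((fst t)(x := r), snd t)"
  by (auto simp: invar_def env_def)

end

section \<open>Verification of the deletion program\<close>

locale sized_deletion = deletion n d vf cf k + size_classes w \<sigma> top len
  for n d vf cf k w \<sigma> top len +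
  assumes vf_size: "\<And>i a. i < n \<Longrightarrow> a < d \<Longrightarrow> vf i a \<in> \<sigma> 1" and cf_size: "\<And>i. cf i \<in> \<sigma> 1"
    and top_ge: "2 * size_bound n d k \<le> top"
begin

lemma wt_size: "wt A i \<in> \<sigma> 1"
  using cf_size zero_any by (simp add: wt_def)

lemma runs_Try:
  assumes inv: "invar A t" and q: "fst t ''q'' = q" "q < n" and X: "n \<le> X" "d \<le> X" "1 \<le> X"
  shows "runs w Try t (2112 * X ^ 4 * U) (invar (step A q))"
  unfolding Try_def
proof (rule runs_Cond[where B = "2109 * X ^ 4 * U"])
  let ?b = "BAnd (ILess (V ''k'') (V ''m'')) (RLess (scal ''u'') (Cell ''S'' (V ''q'') (N 0)))"
  let ?g = "BAnd (BNot (RLess (scal ''y'') (scal ''x''))) (RLess (scal ''u'') (scal ''E''))"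
  let ?W = "RAssign (Cell ''W'' (V ''q'') (N 0)) (Const 0)"
  let ?x = "RAssign (scal ''x'') (Mul (scal ''N'') (scal ''Q''))"
  let ?y = "RAssign (scal ''y'') (Mul (scal ''P'') (scal ''E''))"
  let ?G = "invar (step A q)"
  let ?l = "Load (Cell ''c'' (V ''q'') (N 0))"
  let ?s = "\<sigma> (size_bound n d k)"
  let ?S = "RAssign (Cell ''S'' (V ''q'') (N 0)) (Const 0)"
  let ?m = "IAssign ''m'' (Minus (V ''m'') (N 1))"
  have U1: "U \<le> X ^ 4 * U"
    using X(3) by simp
  have top1: "1 \<le> top"
    using top_ge by (simp add: size_bound_def)
  have kX: "k \<le> X"
    using k_le X by simp
  have Sq: "snd t ''S'' q 0 = (if q \<in> A then 1 else 0)" and u0: "snd t ''u'' 0 0 = 0"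
    using inv q by (auto simp: invar_def)
  have "w (snd t ''S'' q 0) \<le> len" "w 0 \<le> len"
    unfolding Sq using w_le[OF zero] w_le[OF one] by auto
  then have "bcost w ?b t \<le> 3 * U"
    using u0 q by (simp add: U_def)
  then show "bcost w ?b t + 2109 * X ^ 4 * U \<le> 2112 * X ^ 4 * U"
    using U1 unfolding mult.assoc by linarith
  have cond: "bval ?b t \<longleftrightarrow> k < card A \<and> q \<in> A"
    using inv q by (auto simp: invar_def)
  show "runs w Skip t (2109 * X ^ 4 * U) ?G"
    if "\<not> bval ?b t"
  proof (rule runs_Skip)
    have "step A q = A"
      using that unfolding cond step_def by auto
    then show "?G t"
      using inv by simp
    show "1 \<le> 2109 * X ^ 4 * U"
      using U1 U_ge_1 unfolding mult.assoc by linarith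
  qed
  let ?R5 = "Cond ?g
     (Seq ?S ?m)
     (RAssign (Cell ''W'' (V ''q'') (N 0)) ?l)"
  let ?R4 = "Seq ?y ?R5"
  let ?R3 = "Seq ?x ?R4"
  show "runs w (Seq ?W (Seq Eval ?R3)) t (2109 * X ^ 4 * U) ?G"
    if c: "bval ?b t"
  proof (rule runs_mono)
    have kA: "k < card A" and qA: "q \<in> A"
      using c unfolding cond by auto
    let ?A = "A - {q}"
    have vA: "A \<subseteq> {..<n}" "finite A"
      using inv finite_subset by (auto simp: invar_def valid_def)
    show "runs w (Seq ?W (Seq Eval ?R3)) t
       (U + (2100 * X ^ 4 * U + (U + (U + 6 * U)))) ?G"
    proof (rule runs_Seq[OF _ _ order_refl])
      show "runs w ?W t U (\<lambda>t'. env n d vf (wt ?A) t')"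
        by (rule runs_RAssign) (use inv q w_le[OF zero] in \<open>auto simp: invar_def env_def U_def wt_delete\<close>)
    next
      fix t1 assume env1: "env n d vf (wt ?A) t1"
        and fr1: "frame (imod ?W) (rmod ?W) t t1"
      have f1: "frame {} {''W''} t t1"
        using fr1 by simp
      show "runs w (Seq Eval ?R3) t1 (2100 * X ^ 4 * U + (U + (U + 6 * U))) ?G"
      proof (rule runs_Seq[OF _ _ order_refl])
        show "runs w Eval t1 (2100 * X ^ 4 * U) (\<lambda>t. snd t ''N'' 0 0 = fact (k - 1) * enum n d vf (wt ?A) k \<and>
            snd t ''E'' 0 0 = fact k * esym n d vf (wt ?A) k)"
          using frame_fst[OF f1, of "''k''"] inv
          by (intro runs_Eval[OF env1 _ k_pos kX X vf_size wt_size top_ge]) (auto simp: invar_def)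
      next
        fix t2 assume Ev: "snd t2 ''N'' 0 0 = fact (k - 1) * enum n d vf (wt ?A) k \<and>
            snd t2 ''E'' 0 0 = fact k * esym n d vf (wt ?A) k"
          and fr2: "frame (imod Eval) (rmod Eval) t1 t2"
        define Nv Ev Pv Qv where "Nv = snd t2 ''N'' 0 0" and "Ev = snd t2 ''E'' 0 0"
          and "Pv = fact (k - 1) * enum n d vf cf k" and "Qv = fact k * esym n d vf cf k"
        have NE: "Nv = fact (k - 1) * enum n d vf (wt ?A) k" "Ev = fact k * esym n d vf (wt ?A) k"
          and sz: "Nv \<in> ?s" "Ev \<in> ?s" "Pv \<in> ?s" "Qv \<in> ?s"
          using Ev Eval_size[where W = "wt ?A", OF k_pos vf_size wt_size] Eval_size[OF k_pos vf_size cf_size]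
          by (simp_all add: Nv_def Ev_def Pv_def Qv_def)
        have wsz: "w r \<le> len" if "r \<in> ?s" for r
          using w_le[OF that] top_ge by simp
        have wprod: "w (r * r') \<le> len" if "r \<in> ?s" "r' \<in> ?s" for r r'
          using w_le[OF mult[OF that]] top_ge by simp
        have f2: "frame {''a'', ''b'', ''i'', ''j''} {''W'', ''o'', ''z'', ''A'', ''J'', ''N'', ''T'', ''E'', ''L'', ''x''} t t2"
          by (rule frame_trans[OF f1 fr2]) auto
        have env2: "env n d vf (wt ?A) t2"
          by (rule env_frame[OF env1 fr2]) auto
        have PQ: "snd t2 ''P'' 0 0 = Pv" "snd t2 ''Q'' 0 0 = Qv" "snd t2 ''u'' 0 0 = 0"
          using frame_snd[OF f2] inv
          by (simp_all add: invar_def Pv_def Qv_def)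
        \<comment> \<open>The machine holds numerator and denominator times (k-1)! and k!. Both
          cross products carry the same factor (k-1)! k!, so it does not affect the
          comparison.\<close>
        have ok_iff: "ok ?A \<longleftrightarrow> \<not> Pv * Ev < Nv * Qv \<and> 0 < Ev"
        proof -
          have e: "Nv * Qv = fact (k - 1) * fact k * (enum n d vf (wt ?A) k * esym n d vf cf k)"
            "Pv * Ev = fact (k - 1) * fact k * (enum n d vf cf k * esym n d vf (wt ?A) k)"
            by (simp_all add: NE Pv_def Qv_def mult_ac)
          have "0 < (fact (k - 1) * fact k :: real)"
            by simp
          then show ?thesis
            unfolding ok_def e not_less unfolding NE(2) by (auto simp: zero_less_mult_iff)
        qed
        show "runs w ?R3 t2 (U + (U + 6 * U)) ?G"
        proof (rule runs_Seq[OF _ _ order_refl])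
          have v: "cval (scal ''N'') t2 = Nv" "cval (scal ''Q'') t2 = Qv"
            using PQ by (simp_all add: Nv_def)
          show "runs w ?x t2 U (\<lambda>t'. snd t' ''x'' 0 0 = Nv * Qv)"
          proof (rule runs_RAssign)
            show "rcost w (Mul (scal ''N'') (scal ''Q'')) t2 \<le> U"
              by (rule rcost_le; unfold v) (intro wsz wprod sz)+
          qed (use v in simp)
        next
          fix t3 assume x3: "snd t3 ''x'' 0 0 = Nv * Qv"
            and fr3: "frame (imod ?x) (rmod ?x) t2 t3"
          have f23: "frame {} {''x''} t2 t3"
            using fr3 by simp
          show "runs w ?R4 t3 (U + 6 * U) ?G"
          proof (rule runs_Seq[OF _ _ order_refl])
            have v: "cval (scal ''P'') t3 = Pv" "cval (scal ''E'') t3 = Ev"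
              using PQ frame_snd[OF f23] by (simp_all add: Ev_def)
            show "runs w ?y t3 U (\<lambda>t'. snd t' ''y'' 0 0 = Pv * Ev)"
            proof (rule runs_RAssign)
              show "rcost w (Mul (scal ''P'') (scal ''E'')) t3 \<le> U"
                by (rule rcost_le; unfold v) (intro wsz wprod sz)+
            qed (use v in simp)
          next
            fix t4 assume y4: "snd t4 ''y'' 0 0 = Pv * Ev"
              and fr4: "frame (imod ?y) (rmod ?y) t3 t4"
            have f34: "frame {} {''y''} t3 t4"
              using fr4 by simp
            have f24: "frame {} {''x'', ''y''} t2 t4"
              by (rule frame_trans[OF f23 f34]) auto
            have f4: "frame {''a'', ''b'', ''i'', ''j''} {''W'', ''o'', ''z'', ''A'', ''J'', ''N'', ''T'', ''E'', ''L'', ''x'', ''y''} t t4"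
              by (rule frame_trans[OF f2 f24]) auto
            have env4: "env n d vf (wt ?A) t4"
              by (rule env_frame[OF env2 f24]) auto
            have v: "cval (scal ''x'') t4 = Nv * Qv" "cval (scal ''y'') t4 = Pv * Ev" "cval (scal ''u'') t4 = 0" "cval (scal ''E'') t4 = Ev"
              using x3 y4 PQ frame_snd[OF f34] frame_snd[OF f24]
              by (simp_all add: Ev_def)
            have r4: "fst t4 ''q'' = q" "fst t4 ''k'' = k" "fst t4 ''m'' = card A" "\<forall>i. snd t4 ''c'' i 0 = cf i"
              "snd t4 ''u'' 0 0 = 0" "\<forall>i<n. snd t4 ''S'' i 0 = (if i \<in> A then 1 else 0)"
              "snd t4 ''P'' 0 0 = Pv" "snd t4 ''Q'' 0 0 = Qv"
              using inv q frame_fst[OF f4]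
                frame_snd[OF f4]
              by (simp_all add: invar_def Pv_def Qv_def)
            show "runs w ?R5 t4 (6 * U) ?G"
            proof (rule runs_Cond[where B = "2 * U"])
              have b: "bval ?g t4 \<longleftrightarrow> ok ?A"
                unfolding bval.simps v ok_iff ..
              have "w 0 \<le> len"
                using w_le[OF zero] by simp
              then show "bcost w ?g t4 + 2 * U \<le> 6 * U"
                unfolding bcost.simps v using wprod[OF sz(1,4)] wprod[OF sz(3,2)] wsz[OF sz(2)] by (simp add: U_def)
              show "runs w (Seq ?S ?m) t4 (2 * U) ?G"
                if "bval ?g t4"
              proof -
                have st: "step A q = ?A"
                  using that kA qA unfolding b by (simp add: step_def)
                have va: "valid ?A"
                  using valid_step[of A q] inv unfolding st by (simp add: invar_def)
                have m: "card ?A = card A - 1"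
                  using vA qA by simp
                show ?thesis
                  unfolding st
                proof (rule runs_Seq)
                  show "runs w ?S t4 U
                     (\<lambda>t'. t' = store (Cell ''S'' (V ''q'') (N 0)) 0 t4)"
                    by (rule runs_RAssign) (use \<open>w 0 \<le> len\<close> in \<open>auto simp: U_def\<close>)
                  show "runs w ?m t' U (invar ?A)"
                    if "t' = store (Cell ''S'' (V ''q'') (N 0)) 0 t4" for t'
                    by (rule runs_IAssign) (use that va env4 r4 m U_ge_1 in \<open>auto simp: invar_def env_def Pv_def Qv_def\<close>)
                qed simp
              qed
              show "runs w (RAssign (Cell ''W'' (V ''q'') (N 0)) ?l) t4 (2 * U) ?G"
                if "\<not> bval ?g t4"
              proof -
                have st: "step A q = A"
                  using that unfolding b by (simp add: step_def)
                have va: "valid A"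
                  using inv by (simp add: invar_def)
                have cq: "cval (Cell ''c'' (V ''q'') (N 0)) t4 = cf q"
                  using r4 by simp
                have W: "wt ?A i = (if i = q then 0 else wt A i)" "wt A q = cf q" for i
                  using qA by (simp_all add: wt_def)
                show ?thesis
                  unfolding st
                proof (rule runs_RAssign)
                  show "rcost w ?l t4 \<le> 2 * U"
                    using w_le[OF cf_size top1, of q] cq by (simp add: U_def)
                  show "invar A (store (Cell ''W'' (V ''q'') (N 0)) (rval ?l t4) t4)"
                    unfolding rval.simps cq using va env4 r4 by (auto simp: invar_def env_def Pv_def Qv_def W)
                qed
              qed
            qed
          qed
        qed
      qed
    qed
    show "U + (2100 * X ^ 4 * U + (U + (U + 6 * U))) \<le> 2109 * X ^ 4 * U"
      using U1 unfolding mult.assoc by linarith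
  qed
qed

lemma runs_Init:
  assumes s: "fst s ''n'' = n" "\<And>i. snd s ''c'' i 0 = cf i" "\<And>i. snd s ''W'' i 0 = 0" and X: "n \<le> X" "1 \<le> X"
  shows "runs w Init s (10 * X * U) (\<lambda>t. (\<forall>a. snd t ''W'' a 0 = cf a) \<and> (\<forall>a<n. snd t ''S'' a 0 = 1))"
proof (rule runs_mono)
  let ?I = "\<lambda>i S. (\<forall>a. S ''W'' a 0 = (if a < i then cf a else 0)) \<and> (\<forall>a<i. S ''S'' a 0 = 1)"
  let ?P = "RAssign (Cell ''W'' (V ''a'') (N 0)) (Load (Cell ''c'' (V ''a'') (N 0)))"
  let ?R = "RAssign (Cell ''S'' (V ''a'') (N 0)) (Const 1)"
  have top1: "1 \<le> top"
    using top_ge by (simp add: size_bound_def)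
  show "runs w Init s (10 * X * U) (\<lambda>t. ?I n (snd t))"
    unfolding Init_def
  proof (rule runs_For[where I = ?I and X = X and B = "2 * U"])
    fix i t assume i: "i < n" "?I i (snd t)" "fst t ''a'' = i" and fr: "frame (insert ''a'' (imod (Seq ?P ?R))) (rmod (Seq ?P ?R)) s t"
    have c: "snd t ''c'' i 0 = cf i"
      using frame_snd[OF fr, of "''c''"] s by simp
    show "runs w (Seq ?P ?R) t (2 * U) (\<lambda>t'. ?I (Suc i) (snd t'))"
    proof (rule runs_Seq)
      show "runs w ?P t U (\<lambda>t'. t' = store (Cell ''W'' (V ''a'') (N 0)) (cf i) t)"
        by (rule runs_RAssign) (use i c w_le[OF cf_size top1, of i] in \<open>auto simp: U_def\<close>)
      show "runs w ?R t' U (\<lambda>t'. ?I (Suc i) (snd t'))" if "t' = store (Cell ''W'' (V ''a'') (N 0)) (cf i) t" for t'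
        by (rule runs_RAssign) (use that i w_le[OF one] in \<open>auto simp: U_def less_Suc_eq\<close>)
    qed simp
  qed (use s X U_ge_1 in auto)
  show "?I n (snd t) \<Longrightarrow> (\<forall>a. snd t ''W'' a 0 = cf a) \<and> (\<forall>a<n. snd t ''S'' a 0 = 1)" for t
    using cf_zero by auto
qed simp

lemma runs_Prog:
  assumes s: "fst s ''n'' = n" "fst s ''d'' = d" "fst s ''k'' = k" "snd s ''v'' = vf" "\<And>i. snd s ''c'' i 0 = cf i"
      "\<And>i. snd s ''W'' i 0 = 0" "snd s ''u'' 0 0 = 0"
    and X: "n \<le> X" "d \<le> X" "1 \<le> X"
  shows "runs w Prog s (55000 * X ^ 6 * U) (\<lambda>t. {i. i < n \<and> snd t ''S'' i 0 = 1} = alive n)"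
proof (rule runs_mono)
  let ?B6 = "5 * X * (5 * X * (2112 * X ^ 4 * U))"
  let ?B4 = "U + (U + ?B6)"
  let ?B3 = "2100 * X ^ 4 * U + ?B4"
  have kX: "k \<le> X"
    using k_le X by simp
  let ?R4 = "For ''p'' ''n'' (For ''q'' ''n'' Try)"
  let ?R3 = "Seq (RAssign (scal ''Q'') (Load (scal ''E''))) ?R4"
  let ?R2 = "Seq (RAssign (scal ''P'') (Load (scal ''N''))) ?R3"
  show "runs w Prog s (10 * X * U + (U + ?B3)) (invar (alive n))"
    unfolding Prog_def
  proof (rule runs_Seq[OF _ _ order_refl])
    show "runs w Init s (10 * X * U) (\<lambda>t. (\<forall>a. snd t ''W'' a 0 = cf a) \<and> (\<forall>a<n. snd t ''S'' a 0 = 1))"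
      by (rule runs_Init) (use s X in auto)
  next
    fix t1 assume W: "(\<forall>a. snd t1 ''W'' a 0 = cf a) \<and> (\<forall>a<n. snd t1 ''S'' a 0 = 1)"
      and fr1: "frame (imod Init) (rmod Init) s t1"
    have t1: "env n d vf cf t1" "fst t1 ''k'' = k" "\<forall>i. snd t1 ''c'' i 0 = cf i" "snd t1 ''u'' 0 0 = 0"
      using s W frame_fst[OF fr1] frame_snd[OF fr1] by (simp_all add: env_def)
    show "runs w (Seq (IAssign ''m'' (V ''n'')) (Seq Eval ?R2)) t1
        (U + ?B3) (invar (alive n))"
    proof (rule runs_Seq[OF _ _ order_refl])
      show "runs w (IAssign ''m'' (V ''n'')) t1 U (\<lambda>t. t = ((fst t1)(''m'' := n), snd t1))"
        by (rule runs_IAssign) (use t1 U_ge_1 in \<open>auto simp: env_def\<close>)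
    next
      fix t2 assume t2: "t2 = ((fst t1)(''m'' := n), snd t1)"
      have env2: "env n d vf cf t2"
        using t1 by (simp add: t2 env_def)
      show "runs w (Seq Eval ?R2) t2 ?B3 (invar (alive n))"
      proof (rule runs_Seq[OF _ _ order_refl])
        show "runs w Eval t2 (2100 * X ^ 4 * U) (\<lambda>t. snd t ''N'' 0 0 = fact (k - 1) * enum n d vf cf k \<and>
            snd t ''E'' 0 0 = fact k * esym n d vf cf k)"
          by (rule runs_Eval[OF env2 _ k_pos kX X vf_size cf_size top_ge]) (use t1 in \<open>auto simp: t2\<close>)
      next
        fix t3 assume E: "snd t3 ''N'' 0 0 = fact (k - 1) * enum n d vf cf k \<and> snd t3 ''E'' 0 0 = fact k * esym n d vf cf k"
          and fr3: "frame (imod Eval) (rmod Eval) t2 t3"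
        have env3: "env n d vf cf t3"
          by (rule env_frame[OF env2 fr3]) auto
        have t3: "fst t3 ''k'' = k" "fst t3 ''m'' = n" "\<forall>i. snd t3 ''c'' i 0 = cf i" "snd t3 ''u'' 0 0 = 0" "\<forall>i<n. snd t3 ''S'' i 0 = 1"
          using t1 W frame_fst[OF fr3] frame_snd[OF fr3] by (simp_all add: t2)
        have "w (fact (k - 1) * enum n d vf cf k) \<le> len" "w (fact k * esym n d vf cf k) \<le> len"
          using w_le[OF Eval_size(1)[OF k_pos vf_size cf_size]] w_le[OF Eval_size(2)[OF k_pos vf_size cf_size]] top_ge by simp_all
        then have wl: "w (snd t3 ''N'' 0 0) \<le> len" "w (snd t3 ''E'' 0 0) \<le> len"
          using E by simp_all
        show "runs w ?R2 t3 ?B4 (invar (alive n))"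
        proof (rule runs_Seq[OF _ _ order_refl])
          show "runs w (RAssign (scal ''P'') (Load (scal ''N''))) t3 U (\<lambda>t. t = store (scal ''P'') (snd t3 ''N'' 0 0) t3)"
            by (rule runs_RAssign) (use wl in \<open>auto simp: U_def\<close>)
        next
          fix t4 assume t4: "t4 = store (scal ''P'') (snd t3 ''N'' 0 0) t3"
          show "runs w ?R3 t4 (U + ?B6) (invar (alive n))"
          proof (rule runs_Seq[OF _ _ order_refl])
            show "runs w (RAssign (scal ''Q'') (Load (scal ''E''))) t4 U (\<lambda>t. t = store (scal ''Q'') (snd t3 ''E'' 0 0) t4)"
              by (rule runs_RAssign) (use wl in \<open>auto simp: U_def t4\<close>)
          next
            fix t5 assume t5: "t5 = store (scal ''Q'') (snd t3 ''E'' 0 0) t4"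
            have inv5: "invar (alive 0) t5"
              using valid_full env3 t3 E by (simp add: invar_def wt_full env_def t5 t4)
            have X4: "1 \<le> 2112 * X ^ 4 * U"
              using X(3) U_ge_1 mult_le_mono[of 1 "2112 * X ^ 4" 1 U] by simp
            show "runs w ?R4 t5 ?B6 (invar (alive n))"
            proof (rule runs_For_state[where I = "\<lambda>p. invar (alive p)" and X = X and B = "5 * X * (2112 * X ^ 4 * U)"])
              show "fst t5 ''n'' = n"
                using inv5 by (simp add: invar_def env_def)
              show "1 \<le> 5 * X * (2112 * X ^ 4 * U)"
                using X(3) X4 mult_le_mono[of 1 "5 * X" 1 "2112 * X ^ 4 * U"] by simp
              fix p t assume p: "invar (alive p) t"
              have "runs w (For ''q'' ''n'' Try) t (5 * X * (2112 * X ^ 4 * U)) (invar (sweep (alive p) n))"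
              proof (rule runs_For_state[where I = "\<lambda>q. invar (sweep (alive p) q)" and X = X and B = "2112 * X ^ 4 * U"])
                show "fst t ''n'' = n"
                  using p by (simp add: invar_def env_def)
                show "runs w Try t' (2112 * X ^ 4 * U) (invar (sweep (alive p) (Suc q)))"
                  if "q < n" "invar (sweep (alive p) q) t'" "fst t' ''q'' = q" for q t'
                  using runs_Try[OF that(2,3,1) X] by simp
              qed (use p X X4 in \<open>auto intro: invar_indep\<close>)
              then show "runs w (For ''q'' ''n'' Try) t (5 * X * (2112 * X ^ 4 * U)) (invar (alive (Suc p)))"
                by simp
            qed (use inv5 X in \<open>auto intro: invar_indep\<close>)
          qed
        qed
      qed
    qed
  qed
  show "invar (alive n) t \<Longrightarrow> {i. i < n \<and> snd t ''S'' i 0 = 1} = alive n" for t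
    by (auto simp: invar_def valid_def split: if_splits)
  have p: "X ^ a * U \<le> X ^ 6 * U" if "a \<le> 6" for a
    using that X by (intro mult_right_mono power_increasing) auto
  have q: "U \<le> X ^ 6 * U" "X * U \<le> X ^ 6 * U" "X ^ 4 * U \<le> X ^ 6 * U"
    using p[of 0] p[of 1] p[of 4] by simp_all
  \<comment> \<open>The two nested loops give 25 times 2112; the remaining 2113 units cover
    initialisation and the first evaluation.\<close>
  have "?B6 = 52800 * (X ^ 6 * U)"
    using power_add[of X 2 4] by (simp add: power2_eq_square)
  then show "10 * X * U + (U + ?B3) \<le> 55000 * X ^ 6 * U"
    using q unfolding mult.assoc by linarith
qed

end

section \<open>Binary length of rational numbers\<close>

lemma rat_length_le:
  assumes "q > 0" "x = of_int p / of_int q"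
  shows "rat_length x \<le> floorlog 2 (nat \<bar>p\<bar>) + floorlog 2 (nat q)"
  unfolding rat_length_def by (rule Least_le) (use assms in blast)

lemma rat_length_attained:
  assumes "x \<in> \<rat>"
  obtains p q :: int where "q > 0" "x = of_int p / of_int q"
    "rat_length x = floorlog 2 (nat \<bar>p\<bar>) + floorlog 2 (nat q)"
proof -
  let ?P = "\<lambda>l. \<exists>p q :: int. q > 0 \<and> x = of_int p / of_int q \<and> l = floorlog 2 (nat \<bar>p\<bar>) + floorlog 2 (nat q)"
  obtain p q :: int where "q > 0" "x = of_int p / of_int q"
    using assms by (metis Rats_cases')
  then have "?P (floorlog 2 (nat \<bar>p\<bar>) + floorlog 2 (nat q))"
    by blast
  then have "?P (rat_length x)"
    unfolding rat_length_def by (rule LeastI)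
  then show ?thesis
    using that by blast
qed

lemma floorlog_two_pow_le:
  assumes "m \<le> 2 ^ e"
  shows "floorlog 2 m \<le> Suc e"
  by (rule floorlog_leI) (use assms in \<open>auto intro: le_less_trans\<close>)

text \<open>Fractions need not be reduced: a denominator determined by the size alone lets sums of
  equal size be formed without searching for common multiples.\<close>

definition rat_class :: "nat \<Rightarrow> nat \<Rightarrow> nat \<Rightarrow> real set" where
  "rat_class Q \<rho> m = {x. \<exists>a :: int. x = of_int a / of_nat Q ^ m \<and> \<bar>a\<bar> \<le> (2 ^ \<rho>) ^ m}"

lemma rat_classI: "x = of_int a / of_nat Q ^ m \<Longrightarrow> \<bar>a\<bar> \<le> (2 ^ \<rho>) ^ m \<Longrightarrow> x \<in> rat_class Q \<rho> m"
  by (auto simp: rat_class_def)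

text \<open>A sum can double the numerator, and passing to denominator Q^(i+1) multiplies it by Q;
  this is the origin of \<open>2 * Q \<le> 2 ^ \<rho>\<close>. Numerator and denominator each have
  at most \<rho> e + 1 digits.\<close>

lemma size_classes_rat:
  assumes Q: "0 < Q" "2 * Q \<le> 2 ^ \<rho>"
  shows "size_classes rat_length (rat_class Q \<rho>) e (2 * (\<rho> * e + 1))"
proof
  have Q': "2 * int Q \<le> 2 ^ \<rho>"
    using Q(2) by (metis of_nat_le_iff of_nat_mult of_nat_numeral of_nat_power)
  show "0 \<in> rat_class Q \<rho> 0" "1 \<in> rat_class Q \<rho> 0"
    by (auto intro: rat_classI[of _ 0] rat_classI[of _ 1])
  fix x y i j
  {
    assume "x \<in> rat_class Q \<rho> i" "y \<in> rat_class Q \<rho> i"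
    then obtain a b :: int where ab: "x = of_int a / of_nat Q ^ i" "y = of_int b / of_nat Q ^ i"
      "\<bar>a\<bar> \<le> (2 ^ \<rho>) ^ i" "\<bar>b\<bar> \<le> (2 ^ \<rho>) ^ i"
      by (auto simp: rat_class_def)
    have bound: "\<bar>s * int Q\<bar> \<le> (2 ^ \<rho>) ^ Suc i" if "\<bar>s\<bar> \<le> 2 * (2 ^ \<rho>) ^ i" for s
    proof -
      have "\<bar>s * int Q\<bar> \<le> (2 * (2 ^ \<rho>) ^ i) * int Q"
        using that by (simp add: abs_mult mult_right_mono)
      also have "\<dots> = (2 ^ \<rho>) ^ i * (2 * int Q)"
        by simp
      also have "\<dots> \<le> (2 ^ \<rho>) ^ i * 2 ^ \<rho>"
        using Q' by (intro mult_left_mono) auto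
      finally show ?thesis
        by (simp add: mult.commute)
    qed
    show "x + y \<in> rat_class Q \<rho> (Suc i)"
    proof (rule rat_classI[OF _ bound])
      show "\<bar>a + b\<bar> \<le> 2 * (2 ^ \<rho>) ^ i"
        using ab(3,4) by linarith
    qed (use ab(1,2) Q in \<open>simp add: add_divide_distrib\<close>)
    show "x - y \<in> rat_class Q \<rho> (Suc i)"
    proof (rule rat_classI[OF _ bound])
      show "\<bar>a - b\<bar> \<le> 2 * (2 ^ \<rho>) ^ i"
        using ab(3,4) by linarith
    qed (use ab(1,2) Q in \<open>simp add: diff_divide_distrib\<close>)
  }
  {
    assume "x \<in> rat_class Q \<rho> i" "y \<in> rat_class Q \<rho> j"
    then obtain a b :: int where ab: "x = of_int a / of_nat Q ^ i" "y = of_int b / of_nat Q ^ j"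
      "\<bar>a\<bar> \<le> (2 ^ \<rho>) ^ i" "\<bar>b\<bar> \<le> (2 ^ \<rho>) ^ j"
      by (auto simp: rat_class_def)
    then show "x * y \<in> rat_class Q \<rho> (i + j)"
      by (intro rat_classI[of _ "a * b"]) (auto simp: power_add abs_mult intro!: mult_mono)
  }
  {
    assume "x \<in> rat_class Q \<rho> i"
    then obtain a :: int where a: "x = of_int a / of_nat Q ^ i" "\<bar>a\<bar> \<le> (2 ^ \<rho>) ^ i"
      by (auto simp: rat_class_def)
    have "int Q \<le> 2 ^ \<rho>"
      using Q' by linarith
    then have "\<bar>a * int Q\<bar> \<le> (2 ^ \<rho>) ^ i * 2 ^ \<rho>"
      unfolding abs_mult using a(2) by (intro mult_mono) auto
    then show "x \<in> rat_class Q \<rho> (Suc i)"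
      using a Q by (intro rat_classI[of _ "a * int Q"]) (auto simp: mult.commute)
    assume i: "i \<le> e"
    have le: "\<rho> * i \<le> \<rho> * e"
      using i by simp
    have "rat_length x \<le> floorlog 2 (nat \<bar>a\<bar>) + floorlog 2 (nat (int Q ^ i))"
      by (rule rat_length_le) (use a Q in auto)
    moreover have "floorlog 2 (nat \<bar>a\<bar>) \<le> Suc (\<rho> * i)"
    proof (rule floorlog_two_pow_le)
      have "int (nat \<bar>a\<bar>) \<le> int (2 ^ (\<rho> * i))"
        using a(2) by (simp add: power_mult)
      then show "nat \<bar>a\<bar> \<le> 2 ^ (\<rho> * i)"
        by (simp only: of_nat_le_iff)
    qed
    moreover have "floorlog 2 (nat (int Q ^ i)) \<le> Suc (\<rho> * i)"
    proof (rule floorlog_two_pow_le)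
      have "Q ^ i \<le> (2 ^ \<rho>) ^ i"
        using Q by (intro power_mono) auto
      then show "nat (int Q ^ i) \<le> 2 ^ (\<rho> * i)"
        by (simp add: power_mult nat_power_eq)
    qed
    ultimately have "rat_length x \<le> Suc (\<rho> * i) + Suc (\<rho> * i)"
      by (rule order_trans[OF _ add_mono])
    also have "\<dots> \<le> Suc (\<rho> * e) + Suc (\<rho> * e)"
      by (intro add_mono Suc_leI le_imp_less_Suc le)
    finally show "rat_length x \<le> 2 * (\<rho> * e + 1)"
      by simp
  }
qed

text \<open>Even zero pays one digit for its denominator, so the input length bounds the number of
  input entries.\<close>

lemma rat_length_pos:
  assumes "x \<in> \<rat>"
  shows "1 \<le> rat_length x"
proof -
  obtain p q :: int where "q > 0" "rat_length x = floorlog 2 (nat \<bar>p\<bar>) + floorlog 2 (nat q)"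
    using rat_length_attained[OF assms] by metis
  then show ?thesis
    by (simp add: floorlog_def)
qed

text \<open>\<open>Q\<close> is the product of all denominators, at most 2^l. Expanding a numerator
  to it yields at most 2^l times 2^l, and the exponent 2 l + 1 covers this as well as 2 Q.\<close>

lemma common_denominator:
  fixes f :: "'a \<Rightarrow> real"
  assumes I: "finite I" and rat: "\<And>i. i \<in> I \<Longrightarrow> f i \<in> \<rat>" and l: "l = (\<Sum>i\<in>I. rat_length (f i))"
  obtains Q where "0 < Q" "2 * Q \<le> 2 ^ (2 * l + 1)" "\<And>i. i \<in> I \<Longrightarrow> f i \<in> rat_class Q (2 * l + 1) 1"
proof -
  have "\<forall>i\<in>I. \<exists>p q :: int. q > 0 \<and> f i = of_int p / of_int q \<and> rat_length (f i) = floorlog 2 (nat \<bar>p\<bar>) + floorlog 2 (nat q)"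
    using rat rat_length_attained by metis
  then obtain p q :: "'a \<Rightarrow> int" where pq: "\<And>i. i \<in> I \<Longrightarrow> q i > 0" "\<And>i. i \<in> I \<Longrightarrow> f i = of_int (p i) / of_int (q i)"
    "\<And>i. i \<in> I \<Longrightarrow> rat_length (f i) = floorlog 2 (nat \<bar>p i\<bar>) + floorlog 2 (nat (q i))"
    by metis
  define Q where "Q = (\<Prod>i\<in>I. nat (q i))"
  have Q0: "0 < Q"
    unfolding Q_def by (rule prod_pos) (use pq in auto)
  have "Q \<le> (\<Prod>i\<in>I. 2 ^ rat_length (f i))"
    unfolding Q_def
  proof (rule prod_mono, intro conjI)
    fix i assume i: "i \<in> I"
    have "nat (q i) \<le> 2 ^ floorlog 2 (nat (q i))"
      using floorlog_leD[OF order_refl, of 2 "nat (q i)"] by simp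
    also have "\<dots> \<le> 2 ^ rat_length (f i)"
      using pq(3)[OF i] by (intro power_increasing) auto
    finally show "nat (q i) \<le> 2 ^ rat_length (f i)" .
  qed simp
  then have Ql: "Q \<le> 2 ^ l"
    by (simp add: l power_sum)
  have "2 * Q \<le> 2 ^ (2 * l + 1)"
  proof -
    have "2 * Q \<le> 2 * 2 ^ l"
      using Ql by simp
    also have "\<dots> \<le> 2 ^ (2 * l + 1)"
      using power_increasing[of "Suc l" "2 * l + 1" "2 :: nat"] by simp
    finally show ?thesis .
  qed
  moreover have "f i \<in> rat_class Q (2 * l + 1) 1" if i: "i \<in> I" for i
  proof -
    have "nat (q i) dvd Q"
      unfolding Q_def using I i by (rule dvd_prodI)
    then obtain r where r: "Q = nat (q i) * r"
      by auto
    have "int r \<le> int Q"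
      using r Q0 by (cases "nat (q i)") auto
    have "nat \<bar>p i\<bar> \<le> 2 ^ floorlog 2 (nat \<bar>p i\<bar>)"
      using floorlog_leD[OF order_refl, of 2 "nat \<bar>p i\<bar>"] by simp
    also have "\<dots> \<le> 2 ^ l"
    proof (intro power_increasing)
      have "floorlog 2 (nat \<bar>p i\<bar>) \<le> rat_length (f i)"
        using pq(3)[OF i] by simp
      also have "\<dots> \<le> l"
        unfolding l using I i by (intro member_le_sum) auto
      finally show "floorlog 2 (nat \<bar>p i\<bar>) \<le> l" .
    qed simp
    finally have "nat \<bar>p i\<bar> * r \<le> 2 ^ l * 2 ^ l"
      using \<open>int r \<le> int Q\<close> Ql by (intro mult_mono) auto
    also have "\<dots> \<le> 2 ^ (2 * l + 1)"
      by (simp add: power_add[symmetric] mult_2[symmetric])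
    finally have "int (nat \<bar>p i\<bar> * r) \<le> int (2 ^ (2 * l + 1))"
      by (simp only: of_nat_le_iff)
    then have "\<bar>p i * int r\<bar> \<le> (2 ^ (2 * l + 1)) ^ 1"
      by (simp add: abs_mult)
    moreover have "f i = of_int (p i * int r) / of_nat Q ^ 1"
    proof -
      have "real Q = of_int (q i) * real r"
        unfolding r using pq(1)[OF i] by simp
      moreover have "r \<noteq> 0"
        using r Q0 by auto
      ultimately show ?thesis
        using pq(2)[OF i] by simp
    qed
    ultimately show ?thesis
      by (rule rat_classI[rotated])
  qed
  ultimately show ?thesis
    using that Q0 by blast
qed

section \<open>The theorem\<close>

lemma (in size_classes) Prog_computes:
  assumes adm: "admissible n d v c k"
    and size: "\<And>i. i < n \<Longrightarrow> c i \<in> \<sigma> 1" "\<And>i j. i < n \<Longrightarrow> j < d \<Longrightarrow> v i $ j \<in> \<sigma> 1" "2 * size_bound n d k \<le> top"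
  shows "computes_within w Prog n d v c k (55000 * (n + d + 1) ^ 6 * U) (good_subset n d v c k)"
proof -
  \<comment> \<open>Extension by zero matches the contents of the arrays in
    \<open>input_state\<close>, also outside the index range.\<close>
  define vf where "vf = (\<lambda>i j. if i < n \<and> j < d then v i $ j else 0)"
  define cf where "cf = (\<lambda>i. if i < n then c i else 0)"
  have vf: "vf i a = v i $ a" if "i < n" "a < d" for i a
    using that by (simp add: vf_def)
  note b = admissible_bounds[OF adm vf]
  have k: "0 < k" and c: "\<And>i. i < n \<Longrightarrow> 0 \<le> c i"
    using adm by (auto simp: admissible_def)
  have cc: "esym n d vf cf k = esym n d vf c k" "enum n d vf cf k = enum n d vf c k"
    by (rule esym_cong enum_cong, simp add: cf_def)+
  interpret sized_deletion n d vf cf k w \<sigma> top len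
    by unfold_locales (use k b(1,2) c cc size zero_any in \<open>auto simp: cf_def vf_def\<close>)
  have "runs w Prog (input_state n d v c k) (55000 * (n + d + 1) ^ 6 * U) (\<lambda>t. {i. i < n \<and> snd t ''S'' i 0 = 1} = alive n)"
    by (rule runs_Prog) (auto simp: input_state_def vf_def cf_def)
  moreover have "good_subset n d v c k (alive n)"
  proof (rule good_subset_if_ratio[OF adm vf])
    have va: "valid (alive n)"
      by (rule valid_alive)
    then show "alive n \<subseteq> {..<n}" "0 < esym n d vf (wt (alive n)) k"
      "enum n d vf (wt (alive n)) k * esym n d vf c k \<le> enum n d vf c k * esym n d vf (wt (alive n)) k"
      by (auto simp: valid_def ok_def cc)
    show "card (alive n) = k"
      by (rule card_alive_final)
    show "wt (alive n) i = (if i \<in> alive n then c i else 0)" if "i < n" for i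
      unfolding wt_def using that by (simp add: cf_def)
  qed
  ultimately have "runs w Prog (input_state n d v c k) (55000 * (n + d + 1) ^ 6 * U) (\<lambda>t. good_subset n d v c k (output_set n t))"
    by (elim runs_mono) (simp_all add: output_set_def)
  then show ?thesis
    unfolding computes_within_def runs_def .
qed

lemma computes_within_mono:
  "computes_within w P n d v c k B good \<Longrightarrow> B \<le> B' \<Longrightarrow> computes_within w P n d v c k B' good"
  unfolding computes_within_def by (meson le_trans)

lemma size_classes_UNIV: "size_classes (\<lambda>_. 0) (\<lambda>_. UNIV) e 0"
  by unfold_locales auto

lemma computes_unit_cost:
  assumes "admissible n d v c k"
  shows "computes_within (\<lambda>_. 0) Prog n d v c k (poly (Polynomial.smult 55000 ([:1, 1:] ^ 6)) (n + d)) (good_subset n d v c k)"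
proof -
  interpret size_classes "\<lambda>_. 0" "\<lambda>_. UNIV" "2 * size_bound n d k" 0
    by (rule size_classes_UNIV)
  show ?thesis
    using Prog_computes[OF assms] by (simp add: U_def poly_power add.commute)
qed

text \<open>The degree 9 is 6 for the number of steps plus 3 for the length of a number: a size is
  quadratic in the input length, and each unit of size costs linearly many digits.\<close>

lemma computes_log_cost:
  assumes adm: "admissible n d v c k" and rat: "rational_input n d v c"
  shows "computes_within rat_length Prog n d v c k (poly (Polynomial.smult 7000000 ([:1, 1:] ^ 9)) (input_length n d v c)) (good_subset n d v c k)"
proof -
  define l where "l = input_length n d v c"
  \<comment> \<open>Slot d of row i stands for c_i, so that one index set covers all input
    entries.\<close>
  define I where "I = {..<n} \<times> {..d}"
  define f where "f = (\<lambda>(i, j). if j = d then c i else v i $ j)"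
  have lI: "l = (\<Sum>i\<in>I. rat_length (f i))"
  proof -
    have "(\<Sum>i\<in>I. rat_length (f i)) = (\<Sum>i<n. \<Sum>j\<le>d. rat_length (f (i, j)))"
      unfolding I_def by (simp add: sum.cartesian_product)
    also have "\<dots> = (\<Sum>i<n. rat_length (c i) + (\<Sum>j<d. rat_length (v i $ j)))"
      by (intro sum.cong refl) (simp add: f_def lessThan_Suc_atMost[symmetric] add.commute)
    finally show ?thesis
      by (simp add: l_def input_length_def)
  qed
  have fI: "finite I"
    by (simp add: I_def)
  have fr: "f i \<in> \<rat>" if "i \<in> I" for i
    using rat that by (auto simp: rational_input_def f_def I_def)
  obtain Q where Q: "0 < Q" "2 * Q \<le> 2 ^ (2 * l + 1)" "\<And>i. i \<in> I \<Longrightarrow> f i \<in> rat_class Q (2 * l + 1) 1"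
    using common_denominator[OF fI fr lI] by metis
  define T where "T = 2 * size_bound n d k"
  interpret size_classes rat_length "rat_class Q (2 * l + 1)" T "2 * ((2 * l + 1) * T + 1)"
    by (rule size_classes_rat[OF Q(1,2)])
  have "computes_within rat_length Prog n d v c k (55000 * (n + d + 1) ^ 6 * U) (good_subset n d v c k)"
  proof (rule Prog_computes[OF adm])
    show "c i \<in> rat_class Q (2 * l + 1) 1" if "i < n" for i
      using Q(3)[of "(i, d)"] that by (simp add: I_def f_def)
    show "v i $ j \<in> rat_class Q (2 * l + 1) 1" if "i < n" "j < d" for i j
      using Q(3)[of "(i, j)"] that by (simp add: I_def f_def)
  qed (simp add: T_def)
  moreover have "55000 * (n + d + 1) ^ 6 * U \<le> 7000000 * (l + 1) ^ 9"
  proof -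
    have kn: "k \<le> n" "0 < k"
      using admissible_bounds(2)[OF adm, of "\<lambda>i j. v i $ j"] adm by (auto simp: admissible_def)
    have "n * (d + 1) = (\<Sum>i\<in>I. 1)"
      by (simp add: I_def)
    also have "\<dots> \<le> l"
      unfolding lI by (intro sum_mono rat_length_pos fr)
    finally have "n + n * d \<le> l"
      by (simp add: algebra_simps)
    moreover have "d \<le> n * d"
      using kn by simp
    ultimately have nd: "n + d + 1 \<le> l + 1"
      by (metis add_le_mono1 add_left_mono le_trans)
    define Y where "Y = l + 1"
    have Y: "n + d + 1 \<le> Y" "1 \<le> Y" "2 * l + 1 \<le> 2 * Y"
      using nd by (auto simp: Y_def)
    have "T \<le> 2 * (Y * (5 * Y))"
      unfolding T_def size_bound_def by (intro mult_mono) (use Y kn in auto)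
    then have T: "T \<le> 10 * Y ^ 2"
      by (simp add: power2_eq_square)
    have "(2 * l + 1) * T \<le> (2 * Y) * (10 * Y ^ 2)"
      by (intro mult_mono T Y) auto
    also have "\<dots> = 20 * Y ^ 3"
      by (simp add: power2_eq_square power3_eq_cube)
    finally have "(2 * l + 1) * T \<le> 20 * Y ^ 3" .
    moreover have "1 \<le> Y ^ 3"
      using Y by simp
    \<comment> \<open>127 is 6 times 20 plus 7, and 55000 times 127 is 6985000, rounded up in the
      final polynomial.\<close>
    moreover have "1 + 3 * (2 * (z + 1)) \<le> 127 * y" if "z \<le> 20 * y" "1 \<le> y" for y z :: nat
    proof -
      have "1 + 3 * (2 * (z + 1)) = 6 * z + 7 * 1"
        by simp
      also have "\<dots> \<le> 6 * (20 * y) + 7 * y"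
        by (intro add_mono mult_left_mono that) auto
      finally show ?thesis
        by simp
    qed
    ultimately have U: "U \<le> 127 * Y ^ 3"
      unfolding U_def by blast
    have "55000 * (n + d + 1) ^ 6 * U \<le> 55000 * Y ^ 6 * (127 * Y ^ 3)"
      by (intro mult_mono power_mono U Y) auto
    also have "\<dots> = 6985000 * Y ^ 9"
      using power_add[of Y 6 3] by simp
    also have "\<dots> \<le> 7000000 * Y ^ 9"
      by simp
    finally show ?thesis
      unfolding Y_def .
  qed
  moreover have "poly (Polynomial.smult 7000000 ([:1, 1:] ^ 9)) l = 7000000 * (l + 1) ^ 9"
    by (simp add: poly_power)
  ultimately show ?thesis
    unfolding l_def[symmetric] by (simp only: computes_within_mono)
qed

theorem theoremA4:
  shows "(\<forall>n d v c k. admissible n d v c k \<longrightarrow> (\<exists>S. good_subset n d v c k S)) \<and>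
    (\<exists>(P :: com) (p :: nat poly) (q :: nat poly). \<forall>n d v c k. admissible n d v c k \<longrightarrow>
       computes_within (\<lambda>_. 0) P n d v c k (poly p (n + d)) (good_subset n d v c k) \<and>
       (rational_input n d v c \<longrightarrow>
         computes_within rat_length P n d v c k (poly q (input_length n d v c))
           (good_subset n d v c k)))"
proof (intro conjI allI impI)
  show "\<exists>S. good_subset n d v c k S" if "admissible n d v c k" for n d v c k
    \<comment> \<open>Existence is read off the output of the algorithm, which is correct for
      arbitrary real inputs under unit cost.\<close>
    using computes_unit_cost[OF that] by (auto simp: computes_within_def)
  show "\<exists>(P :: com) (p :: nat poly) (q :: nat poly). \<forall>n d v c k. admissible n d v c k \<longrightarrow>
       computes_within (\<lambda>_. 0) P n d v c k (poly p (n + d)) (good_subset n d v c k) \<and>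
       (rational_input n d v c \<longrightarrow>
         computes_within rat_length P n d v c k (poly q (input_length n d v c))
           (good_subset n d v c k))"
    using computes_unit_cost computes_log_cost by blast
qed

end
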